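(* Let $(\mathsf T,\otimes,\mathbf 1)$ be an essentially small rigid tensor triangulated category. If the Balmer spectrum $\operatorname{Spc}\mathsf T$ is connected as a topological space, then no non-zero and proper thick tensor ideal of $\mathsf T$ is strongly generated; that is, if $\mathsf S$ is a thick tensor ideal of $\mathsf T$ with $0\subsetneq \mathsf S\subsetneq \mathsf T$, then $\mathsf S$ does not admit a strong generator.
   Context: A thick subcategory of a triangulated category is a full triangulated subcategory closed under direct summands. The suspension is denoted $\Sigma$. Tensor triangulated categories: a tensor triangulated category $(\mathsf T,\otimes,\mathbf 1)$ is a triangulated category with a symmetric monoidal structure $(\otimes,\mathbf 1)$ such that $\otimes$ is exact in each variable. A thick subcategory $\mathsf S$ of $\mathsf T$ is a (thick) tensor ideal if $x\otimes s\in\mathsf S$ for all $x\in\mathsf T$, $s\in\mathsf S$. $\mathsf T$ is closed if $\otimes$ has a right adjoint, the internal hom $\underline{\mathsf{hom}}(-,-)$; then $x^\vee=\underline{\mathsf{hom}}(x,\mathbf 1)$. $\mathsf T$ is rigid if it is closed and for all $x,y\in\mathsf T$ the natural morphism $x^\vee\otimes y\to\underline{\mathsf{hom}}(x,y)$ is an isomorphism (so $x^\vee\otimes-$ is right adjoint to $x\otimes-$). Balmer spectrum: a proper thick tensor ideal $\mathcal P\subsetneq\mathsf T$ is prime if $x\otimes y\in\mathcal P$ implies $x\in\mathcal P$ or $y\in\mathcal P$. $\operatorname{Spc}\mathsf T$ is the set of prime thick tensor ideals, with the topology having as a basis of closed subsets the sets $\operatorname{supp} k=\{\mathcal P\in\operatorname{Spc}\mathsf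 T\mid k\notin\mathcal P\}$, $k\in\mathsf T$. Strong generators: for an object $x$ of a triangulated category $\mathsf S$, let $\langle x\rangle_1$ be the full subcategory of all direct summands of finite direct sums of suspensions $\Sigma^i x$, $i\in\mathbb Z$. For $i>1$, $\langle x\rangle_i$ consists of all $b'$ for which there exist an object $b''$ and a distinguished triangle $a\to b'\oplus b''\to c\to\Sigma a$ with $a\in\langle x\rangle_{i-1}$ and $c\in\langle x\rangle_1$. The object $x$ is a strong generator of $\mathsf S$ if $\langle x\rangle_n=\mathsf S$ for some $n\ge 1$; $\mathsf S$ is strongly generated if it admits a strong generator. *)

theory Defs
  imports "HOL-Algebra.Group" "HOL-Analysis.Abstract_Topology"
begin

section \<open>Categories\<close>

text \<open>
  A category is given by a set of objects and a set of arrows; every arrow knows its domain and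
  codomain, and \<open>g \<cdot>\<^bsub>C\<^esub> f\<close> means ``first \<open>f\<close>, then \<open>g\<close>''. Since types are sets, all categories
  below are small; a statement about essentially small categories that is invariant under
  equivalence loses nothing by this.
\<close>

record ('o, 'm) cat =
  Obj :: "'o set"
  Arr :: "'m set"
  Dom :: "'m \<Rightarrow> 'o"
  Cod :: "'m \<Rightarrow> 'o"
  Ident :: "'o \<Rightarrow> 'm"
  Comp :: "'m \<Rightarrow> 'm \<Rightarrow> 'm"  (infixl \<open>\<cdot>\<index>\<close> 70)

definition Hom :: "('o, 'm, 'x) cat_scheme \<Rightarrow> 'o \<Rightarrow> 'o \<Rightarrow> 'm set" where
  "Hom C x y = {f \<in> Arr C. Dom C f = x \<and> Cod C f = y}"

locale category =
  fixes C :: "('o, 'm, 'x) cat_scheme" (structure)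
  assumes Dom_in_Obj: "f \<in> Arr C \<Longrightarrow> Dom C f \<in> Obj C"
    and Cod_in_Obj: "f \<in> Arr C \<Longrightarrow> Cod C f \<in> Obj C"
    and Ident_in_Hom: "x \<in> Obj C \<Longrightarrow> Ident C x \<in> Hom C x x"
    and Comp_in_Hom: "\<lbrakk>f \<in> Hom C x y; g \<in> Hom C y z\<rbrakk> \<Longrightarrow> g \<cdot> f \<in> Hom C x z"
    and Comp_Ident_right: "f \<in> Hom C x y \<Longrightarrow> f \<cdot> Ident C x = f"
    and Comp_Ident_left: "f \<in> Hom C x y \<Longrightarrow> Ident C y \<cdot> f = f"
    and Comp_assoc: "\<lbrakk>f \<in> Hom C w x; g \<in> Hom C x y; h \<in> Hom C y z\<rbrakk>
                      \<Longrightarrow> (h \<cdot> g) \<cdot> f = h \<cdot> (g \<cdot> f)"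

definition inverse_arrows :: "('o, 'm, 'x) cat_scheme \<Rightarrow> 'm \<Rightarrow> 'm \<Rightarrow> bool" where
  "inverse_arrows C f g \<longleftrightarrow>
     f \<in> Arr C \<and> g \<in> Hom C (Cod C f) (Dom C f) \<and>
     g \<cdot>\<^bsub>C\<^esub> f = Ident C (Dom C f) \<and> f \<cdot>\<^bsub>C\<^esub> g = Ident C (Cod C f)"

definition is_iso :: "('o, 'm, 'x) cat_scheme \<Rightarrow> 'm \<Rightarrow> bool" where
  "is_iso C f \<longleftrightarrow> (\<exists>g. inverse_arrows C f g)"

definition isomorphic :: "('o, 'm, 'x) cat_scheme \<Rightarrow> 'o \<Rightarrow> 'o \<Rightarrow> bool" where
  "isomorphic C x y \<longleftrightarrow> (\<exists>f \<in> Hom C x y. is_iso C f)"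

definition zero_object :: "('o, 'm, 'x) cat_scheme \<Rightarrow> 'o \<Rightarrow> bool" where
  "zero_object C z \<longleftrightarrow>
     z \<in> Obj C \<and> (\<forall>x \<in> Obj C. (\<exists>!f. f \<in> Hom C x z) \<and> (\<exists>!f. f \<in> Hom C z x))"

definition is_functor ::
  "('o, 'm, 'x) cat_scheme \<Rightarrow> ('p, 'n, 'y) cat_scheme \<Rightarrow> ('o \<Rightarrow> 'p) \<Rightarrow> ('m \<Rightarrow> 'n) \<Rightarrow> bool" where
  "is_functor C D Fo Fa \<longleftrightarrow>
     (\<forall>x \<in> Obj C. Fo x \<in> Obj D \<and> Fa (Ident C x) = Ident D (Fo x)) \<and>
     (\<forall>x y f. f \<in> Hom C x y \<longrightarrow> Fa f \<in> Hom D (Fo x) (Fo y)) \<and>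
     (\<forall>x y z f g. f \<in> Hom C x y \<longrightarrow> g \<in> Hom C y z \<longrightarrow> Fa (g \<cdot>\<^bsub>C\<^esub> f) = Fa g \<cdot>\<^bsub>D\<^esub> Fa f)"

definition natural_iso ::
  "('o, 'm, 'x) cat_scheme \<Rightarrow> ('p, 'n, 'y) cat_scheme \<Rightarrow>
   ('o \<Rightarrow> 'p) \<Rightarrow> ('m \<Rightarrow> 'n) \<Rightarrow> ('o \<Rightarrow> 'p) \<Rightarrow> ('m \<Rightarrow> 'n) \<Rightarrow> ('o \<Rightarrow> 'n) \<Rightarrow> bool" where
  "natural_iso C D Fo Fa Go Ga \<tau> \<longleftrightarrow>
     (\<forall>x \<in> Obj C. \<tau> x \<in> Hom D (Fo x) (Go x) \<and> is_iso D (\<tau> x)) \<and>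
     (\<forall>x y f. f \<in> Hom C x y \<longrightarrow> \<tau> y \<cdot>\<^bsub>D\<^esub> Fa f = Ga f \<cdot>\<^bsub>D\<^esub> \<tau> x)"

definition autoequivalence ::
  "('o, 'm, 'x) cat_scheme \<Rightarrow> ('o \<Rightarrow> 'o) \<Rightarrow> ('m \<Rightarrow> 'm) \<Rightarrow> bool" where
  "autoequivalence C Fo Fa \<longleftrightarrow>
     is_functor C C Fo Fa \<and>
     (\<exists>Go Ga \<eta> \<epsilon>. is_functor C C Go Ga \<and>
        natural_iso C C (\<lambda>x. x) (\<lambda>f. f) (Go \<circ> Fo) (Ga \<circ> Fa) \<eta> \<and>
        natural_iso C C (Fo \<circ> Go) (Fa \<circ> Ga) (\<lambda>x. x) (\<lambda>f. f) \<epsilon>)"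


section \<open>Additive categories\<close>

record ('o, 'm) addcat = "('o, 'm) cat" +
  Add :: "'m \<Rightarrow> 'm \<Rightarrow> 'm"
  Zero :: "'o \<Rightarrow> 'o \<Rightarrow> 'm"

definition hom_group :: "('o, 'm, 'x) addcat_scheme \<Rightarrow> 'o \<Rightarrow> 'o \<Rightarrow> 'm monoid" where
  "hom_group C x y = \<lparr>carrier = Hom C x y, mult = Add C, one = Zero C x y\<rparr>"

definition Neg :: "('o, 'm, 'x) addcat_scheme \<Rightarrow> 'm \<Rightarrow> 'm" where
  "Neg C f = inv\<^bsub>hom_group C (Dom C f) (Cod C f)\<^esub> f"

text \<open>\<open>is_biproduct C x y b\<close> says that \<open>b\<close> is a direct sum of \<open>x\<close> and \<open>y\<close>.\<close>

definition is_biproduct :: "('o, 'm, 'x) addcat_scheme \<Rightarrow> 'o \<Rightarrow> 'o \<Rightarrow> 'o \<Rightarrow> bool" where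
  "is_biproduct C x y b \<longleftrightarrow>
     x \<in> Obj C \<and> y \<in> Obj C \<and> b \<in> Obj C \<and>
     (\<exists>i \<in> Hom C x b. \<exists>j \<in> Hom C y b. \<exists>p \<in> Hom C b x. \<exists>q \<in> Hom C b y.
        p \<cdot>\<^bsub>C\<^esub> i = Ident C x \<and> q \<cdot>\<^bsub>C\<^esub> j = Ident C y \<and>
        q \<cdot>\<^bsub>C\<^esub> i = Zero C x y \<and> p \<cdot>\<^bsub>C\<^esub> j = Zero C y x \<and>
        Add C (i \<cdot>\<^bsub>C\<^esub> p) (j \<cdot>\<^bsub>C\<^esub> q) = Ident C b)"

definition direct_summand :: "('o, 'm, 'x) addcat_scheme \<Rightarrow> 'o \<Rightarrow> 'o \<Rightarrow> bool" where
  "direct_summand C x b \<longleftrightarrow> (\<exists>y. is_biproduct C x y b)"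

locale additive_category = category C
  for C :: "('o, 'm, 'x) addcat_scheme" (structure) +
  assumes hom_comm_group: "\<lbrakk>x \<in> Obj C; y \<in> Obj C\<rbrakk> \<Longrightarrow> comm_group (hom_group C x y)"
    and Comp_Add_right: "\<lbrakk>f \<in> Hom C x y; f' \<in> Hom C x y; g \<in> Hom C y z\<rbrakk>
                          \<Longrightarrow> g \<cdot> Add C f f' = Add C (g \<cdot> f) (g \<cdot> f')"
    and Comp_Add_left: "\<lbrakk>f \<in> Hom C x y; g \<in> Hom C y z; g' \<in> Hom C y z\<rbrakk>
                          \<Longrightarrow> Add C g g' \<cdot> f = Add C (g \<cdot> f) (g' \<cdot> f)"
    and zero_object_exists: "\<exists>z. zero_object C z"
    and biproduct_exists: "\<lbrakk>x \<in> Obj C; y \<in> Obj C\<rbrakk> \<Longrightarrow> \<exists>b. is_biproduct C x y b"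

lemma (in additive_category) is_biproduct_swap:
  assumes "is_biproduct C x y b"
  shows "is_biproduct C y x b"
proof -
  from assms have obj: "x \<in> Obj C" "y \<in> Obj C" "b \<in> Obj C"
    by (simp_all add: is_biproduct_def)
  from assms obtain i j p q where
      hom: "i \<in> Hom C x b" "j \<in> Hom C y b" "p \<in> Hom C b x" "q \<in> Hom C b y" and
      eq: "p \<cdot> i = Ident C x" "q \<cdot> j = Ident C y" "q \<cdot> i = Zero C x y" "p \<cdot> j = Zero C y x"
      "Add C (i \<cdot> p) (j \<cdot> q) = Ident C b"
    unfolding is_biproduct_def by (elim conjE bexE) (rule that)
  interpret H: comm_group "hom_group C b b"
    using obj by (intro hom_comm_group)
  have "i \<cdot> p \<in> Hom C b b" "j \<cdot> q \<in> Hom C b b"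
    using Comp_in_Hom hom by blast+
  then have "Add C (j \<cdot> q) (i \<cdot> p) = Ident C b"
    using H.m_comm[of "i \<cdot> p" "j \<cdot> q"] eq(5) by (simp add: hom_group_def)
  then show ?thesis
    unfolding is_biproduct_def
    by (intro conjI obj bexI[OF _ hom(2)] bexI[OF _ hom(1)] bexI[OF _ hom(4)] bexI[OF _ hom(3)] eq)
qed

definition additive_functor ::
  "('o, 'm, 'x) addcat_scheme \<Rightarrow> ('p, 'n, 'y) addcat_scheme \<Rightarrow>
   ('o \<Rightarrow> 'p) \<Rightarrow> ('m \<Rightarrow> 'n) \<Rightarrow> bool" where
  "additive_functor C D Fo Fa \<longleftrightarrow>
     is_functor C D Fo Fa \<and>
     (\<forall>x y f g. f \<in> Hom C x y \<longrightarrow> g \<in> Hom C x y \<longrightarrow> Fa (Add C f g) = Add D (Fa f) (Fa g))"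


section \<open>Triangulated categories\<close>

text \<open>
  A triangle \<open>x \<rightarrow> y \<rightarrow> z \<rightarrow> \<Sigma>x\<close> is encoded by its three arrows; \<open>Tri\<close> is the class of
  distinguished triangles. The suspension is only required to be an autoequivalence.
\<close>

record ('o, 'm) tricat = "('o, 'm) addcat" +
  SuspO :: "'o \<Rightarrow> 'o"
  SuspA :: "'m \<Rightarrow> 'm"
  Tri :: "('m \<times> 'm \<times> 'm) set"

definition candidate_triangle :: "('o, 'm, 'x) tricat_scheme \<Rightarrow> 'm \<Rightarrow> 'm \<Rightarrow> 'm \<Rightarrow> bool" where
  "candidate_triangle T f g h \<longleftrightarrow>
     (\<exists>x y z. f \<in> Hom T x y \<and> g \<in> Hom T y z \<and> h \<in> Hom T z (SuspO T x))"

definition triangle_morphism ::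
  "('o, 'm, 'x) tricat_scheme \<Rightarrow> 'm \<times> 'm \<times> 'm \<Rightarrow> 'm \<times> 'm \<times> 'm \<Rightarrow> 'm \<Rightarrow> 'm \<Rightarrow> 'm \<Rightarrow> bool" where
  "triangle_morphism T = (\<lambda>(f, g, h) (f', g', h') a b c.
     a \<in> Hom T (Dom T f) (Dom T f') \<and>
     b \<in> Hom T (Cod T f) (Cod T f') \<and>
     c \<in> Hom T (Cod T g) (Cod T g') \<and>
     f' \<cdot>\<^bsub>T\<^esub> a = b \<cdot>\<^bsub>T\<^esub> f \<and> g' \<cdot>\<^bsub>T\<^esub> b = c \<cdot>\<^bsub>T\<^esub> g \<and> h' \<cdot>\<^bsub>T\<^esub> c = SuspA T a \<cdot>\<^bsub>T\<^esub> h)"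

locale triangulated_category = additive_category T
  for T :: "('o, 'm, 'x) tricat_scheme" (structure) +
  assumes Susp_autoequivalence: "autoequivalence T (SuspO T) (SuspA T)"
    and Susp_additive: "additive_functor T T (SuspO T) (SuspA T)"
    and Tri_candidate: "(f, g, h) \<in> Tri T \<Longrightarrow> candidate_triangle T f g h"
    and TR1_ident: "\<lbrakk>x \<in> Obj T; zero_object T z\<rbrakk>
          \<Longrightarrow> (Ident T x, Zero T x z, Zero T z (SuspO T x)) \<in> Tri T"
    and TR1_iso: "\<lbrakk>(f, g, h) \<in> Tri T; candidate_triangle T f' g' h';
          triangle_morphism T (f, g, h) (f', g', h') a b c;
          is_iso T a; is_iso T b; is_iso T c\<rbrakk> \<Longrightarrow> (f', g', h') \<in> Tri T"
    and TR1_cone: "f \<in> Arr T \<Longrightarrow> \<exists>g h. (f, g, h) \<in> Tri T"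
    and TR2: "candidate_triangle T f g h
          \<Longrightarrow> (f, g, h) \<in> Tri T \<longleftrightarrow> (g, h, Neg T (SuspA T f)) \<in> Tri T"
    and TR3: "\<lbrakk>(f, g, h) \<in> Tri T; (f', g', h') \<in> Tri T;
          a \<in> Hom T (Dom T f) (Dom T f'); b \<in> Hom T (Cod T f) (Cod T f'); f' \<cdot> a = b \<cdot> f\<rbrakk>
          \<Longrightarrow> \<exists>c. triangle_morphism T (f, g, h) (f', g', h') a b c"
    and TR4: "\<lbrakk>f \<in> Hom T x y; g \<in> Hom T y z;
          (f, f', f'') \<in> Tri T; (g, g', g'') \<in> Tri T; (g \<cdot> f, k', k'') \<in> Tri T\<rbrakk>
          \<Longrightarrow> \<exists>u \<in> Hom T (Cod T f') (Cod T k'). \<exists>v \<in> Hom T (Cod T k') (Cod T g').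
                u \<cdot> f' = k' \<cdot> g \<and> k'' \<cdot> u = f'' \<and>
                v \<cdot> k' = g' \<and> g'' \<cdot> v = SuspA T f \<cdot> k'' \<and>
                (u, v, SuspA T f' \<cdot> g'') \<in> Tri T"

definition exact_functor ::
  "('o, 'm, 'x) tricat_scheme \<Rightarrow> ('p, 'n, 'y) tricat_scheme \<Rightarrow>
   ('o \<Rightarrow> 'p) \<Rightarrow> ('m \<Rightarrow> 'n) \<Rightarrow> bool" where
  "exact_functor T U Fo Fa \<longleftrightarrow>
     additive_functor T U Fo Fa \<and>
     (\<exists>\<phi>. natural_iso T U (Fo \<circ> SuspO T) (Fa \<circ> SuspA T) (SuspO U \<circ> Fo) (SuspA U \<circ> Fa) \<phi> \<and>
          (\<forall>(f, g, h) \<in> Tri T. (Fa f, Fa g, \<phi> (Dom T f) \<cdot>\<^bsub>U\<^esub> Fa h) \<in> Tri U))"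

text \<open>
  \<open>SuspO\<close> need not be bijective on objects, so closure under desuspension is expressed through
  \<open>SuspO T x \<in> S \<Longrightarrow> x \<in> S\<close>, where \<open>S\<close> is closed under isomorphism.
\<close>

definition triangulated_subcategory :: "('o, 'm, 'x) tricat_scheme \<Rightarrow> 'o set \<Rightarrow> bool" where
  "triangulated_subcategory T S \<longleftrightarrow>
     S \<subseteq> Obj T \<and>
     (\<forall>z. zero_object T z \<longrightarrow> z \<in> S) \<and>
     (\<forall>x \<in> S. \<forall>y. isomorphic T x y \<longrightarrow> y \<in> S) \<and>
     (\<forall>x \<in> S. \<forall>y \<in> S. \<forall>b. is_biproduct T x y b \<longrightarrow> b \<in> S) \<and>
     (\<forall>x \<in> Obj T. x \<in> S \<longleftrightarrow> SuspO T x \<in> S) \<and>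
     (\<forall>(f, g, h) \<in> Tri T. Dom T f \<in> S \<longrightarrow> Cod T f \<in> S \<longrightarrow> Cod T g \<in> S)"

definition thick_subcategory :: "('o, 'm, 'x) tricat_scheme \<Rightarrow> 'o set \<Rightarrow> bool" where
  "thick_subcategory T S \<longleftrightarrow>
     triangulated_subcategory T S \<and> (\<forall>b \<in> S. \<forall>x. direct_summand T x b \<longrightarrow> x \<in> S)"

text \<open>The full subcategory on a set of objects, with the triangles of \<open>T\<close> that lie in it.\<close>

definition full_subcat :: "('o, 'm, 'x) tricat_scheme \<Rightarrow> 'o set \<Rightarrow> ('o, 'm, 'x) tricat_scheme" where
  "full_subcat T S =
     (let A = {f \<in> Arr T. Dom T f \<in> S \<and> Cod T f \<in> S}
      in T\<lparr>Obj := Obj T \<inter> S, Arr := A, Tri := Tri T \<inter> A \<times> A \<times> A\<rparr>)"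


section \<open>Strong generators\<close>

text \<open>
  \<open>is_suspension T i x y\<close> says that \<open>y\<close> is (isomorphic to) \<open>\<Sigma>\<^sup>i x\<close>. For negative \<open>i\<close> this means
  that \<open>\<Sigma>\<^sup>-\<^sup>i y\<close> is isomorphic to \<open>x\<close>, which avoids choosing a quasi-inverse of \<open>\<Sigma>\<close>.
\<close>

definition is_suspension :: "('o, 'm, 'x) tricat_scheme \<Rightarrow> int \<Rightarrow> 'o \<Rightarrow> 'o \<Rightarrow> bool" where
  "is_suspension T i x y \<longleftrightarrow> x \<in> Obj T \<and> y \<in> Obj T \<and>
     (if 0 \<le> i then isomorphic T y ((SuspO T ^^ nat i) x)
      else isomorphic T ((SuspO T ^^ nat (- i)) y) x)"

inductive_set finite_sums_of_suspensions :: "('o, 'm, 'x) tricat_scheme \<Rightarrow> 'o \<Rightarrow> 'o set"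
  for T :: "('o, 'm, 'x) tricat_scheme" and x :: 'o where
  empty_sum: "zero_object T z \<Longrightarrow> z \<in> finite_sums_of_suspensions T x"
| add_summand: "\<lbrakk>a \<in> finite_sums_of_suspensions T x; is_suspension T i x y; is_biproduct T a y b\<rbrakk>
    \<Longrightarrow> b \<in> finite_sums_of_suspensions T x"

text \<open>\<open>gen_level T x n\<close> is \<open>\<langle>x\<rangle>\<^sub>n\<close>, for \<open>n \<ge> 1\<close>; the value at \<open>0\<close> is a dummy.\<close>

fun gen_level :: "('o, 'm, 'x) tricat_scheme \<Rightarrow> 'o \<Rightarrow> nat \<Rightarrow> 'o set" where
  "gen_level T x 0 = {}"
| "gen_level T x (Suc 0) =
     {b \<in> Obj T. \<exists>d \<in> finite_sums_of_suspensions T x. direct_summand T b d}"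
| "gen_level T x (Suc (Suc n)) =
     {b' \<in> Obj T. \<exists>b'' d f g h. is_biproduct T b' b'' d \<and> (f, g, h) \<in> Tri T \<and> Cod T f = d \<and>
        Dom T f \<in> gen_level T x (Suc n) \<and> Cod T g \<in> gen_level T x (Suc 0)}"

definition strong_generator :: "('o, 'm, 'x) tricat_scheme \<Rightarrow> 'o \<Rightarrow> bool" where
  "strong_generator T x \<longleftrightarrow> x \<in> Obj T \<and> (\<exists>n \<ge> 1. gen_level T x n = Obj T)"

definition strongly_generated :: "('o, 'm, 'x) tricat_scheme \<Rightarrow> bool" where
  "strongly_generated T \<longleftrightarrow> (\<exists>x. strong_generator T x)"


section \<open>Tensor triangulated categories\<close>

record ('o, 'm) ttcat = "('o, 'm) tricat" +
  TensO :: "'o \<Rightarrow> 'o \<Rightarrow> 'o"  (infixl \<open>\<boxtimes>\<index>\<close> 75)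
  TensA :: "'m \<Rightarrow> 'm \<Rightarrow> 'm"  (infixl \<open>\<star>\<index>\<close> 75)
  Unit :: "'o"
  Assoc :: "'o \<Rightarrow> 'o \<Rightarrow> 'o \<Rightarrow> 'm"
  Lunit :: "'o \<Rightarrow> 'm"
  Runit :: "'o \<Rightarrow> 'm"
  Braid :: "'o \<Rightarrow> 'o \<Rightarrow> 'm"

locale symmetric_monoidal_category = category T
  for T :: "('o, 'm, 'x) ttcat_scheme" (structure) +
  assumes TensO_in_Obj: "\<lbrakk>x \<in> Obj T; y \<in> Obj T\<rbrakk> \<Longrightarrow> x \<boxtimes> y \<in> Obj T"
    and TensA_in_Hom: "\<lbrakk>f \<in> Hom T x x'; g \<in> Hom T y y'\<rbrakk> \<Longrightarrow> f \<star> g \<in> Hom T (x \<boxtimes> y) (x' \<boxtimes> y')"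
    and TensA_Ident: "\<lbrakk>x \<in> Obj T; y \<in> Obj T\<rbrakk> \<Longrightarrow> Ident T x \<star> Ident T y = Ident T (x \<boxtimes> y)"
    and TensA_Comp: "\<lbrakk>f \<in> Hom T x x'; f' \<in> Hom T x' x''; g \<in> Hom T y y'; g' \<in> Hom T y' y''\<rbrakk>
          \<Longrightarrow> (f' \<cdot> f) \<star> (g' \<cdot> g) = (f' \<star> g') \<cdot> (f \<star> g)"
    and Unit_in_Obj: "Unit T \<in> Obj T"
    and Assoc_in_Hom: "\<lbrakk>x \<in> Obj T; y \<in> Obj T; z \<in> Obj T\<rbrakk>
          \<Longrightarrow> Assoc T x y z \<in> Hom T ((x \<boxtimes> y) \<boxtimes> z) (x \<boxtimes> (y \<boxtimes> z))"
    and Assoc_iso: "\<lbrakk>x \<in> Obj T; y \<in> Obj T; z \<in> Obj T\<rbrakk> \<Longrightarrow> is_iso T (Assoc T x y z)"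
    and Assoc_natural: "\<lbrakk>f \<in> Hom T x x'; g \<in> Hom T y y'; h \<in> Hom T z z'\<rbrakk>
          \<Longrightarrow> Assoc T x' y' z' \<cdot> ((f \<star> g) \<star> h) = (f \<star> (g \<star> h)) \<cdot> Assoc T x y z"
    and Lunit_in_Hom: "x \<in> Obj T \<Longrightarrow> Lunit T x \<in> Hom T (Unit T \<boxtimes> x) x"
    and Lunit_iso: "x \<in> Obj T \<Longrightarrow> is_iso T (Lunit T x)"
    and Lunit_natural: "f \<in> Hom T x y \<Longrightarrow> Lunit T y \<cdot> (Ident T (Unit T) \<star> f) = f \<cdot> Lunit T x"
    and Runit_in_Hom: "x \<in> Obj T \<Longrightarrow> Runit T x \<in> Hom T (x \<boxtimes> Unit T) x"
    and Runit_iso: "x \<in> Obj T \<Longrightarrow> is_iso T (Runit T x)"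
    and Runit_natural: "f \<in> Hom T x y \<Longrightarrow> Runit T y \<cdot> (f \<star> Ident T (Unit T)) = f \<cdot> Runit T x"
    and Braid_in_Hom: "\<lbrakk>x \<in> Obj T; y \<in> Obj T\<rbrakk> \<Longrightarrow> Braid T x y \<in> Hom T (x \<boxtimes> y) (y \<boxtimes> x)"
    and Braid_natural: "\<lbrakk>f \<in> Hom T x x'; g \<in> Hom T y y'\<rbrakk>
          \<Longrightarrow> Braid T x' y' \<cdot> (f \<star> g) = (g \<star> f) \<cdot> Braid T x y"
    and Braid_symmetric: "\<lbrakk>x \<in> Obj T; y \<in> Obj T\<rbrakk>
          \<Longrightarrow> Braid T y x \<cdot> Braid T x y = Ident T (x \<boxtimes> y)"
    and pentagon: "\<lbrakk>w \<in> Obj T; x \<in> Obj T; y \<in> Obj T; z \<in> Obj T\<rbrakk>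
          \<Longrightarrow> Assoc T w x (y \<boxtimes> z) \<cdot> Assoc T (w \<boxtimes> x) y z
              = (Ident T w \<star> Assoc T x y z) \<cdot> Assoc T w (x \<boxtimes> y) z \<cdot> (Assoc T w x y \<star> Ident T z)"
    and triangle: "\<lbrakk>x \<in> Obj T; y \<in> Obj T\<rbrakk>
          \<Longrightarrow> (Ident T x \<star> Lunit T y) \<cdot> Assoc T x (Unit T) y = Runit T x \<star> Ident T y"
    and hexagon: "\<lbrakk>x \<in> Obj T; y \<in> Obj T; z \<in> Obj T\<rbrakk>
          \<Longrightarrow> Assoc T y z x \<cdot> Braid T x (y \<boxtimes> z) \<cdot> Assoc T x y z
              = (Ident T y \<star> Braid T x z) \<cdot> Assoc T y x z \<cdot> (Braid T x y \<star> Ident T z)"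

locale tensor_triangulated_category =
  triangulated_category T + symmetric_monoidal_category T
  for T :: "('o, 'm, 'x) ttcat_scheme" (structure) +
  assumes tensor_exact_right:
      "x \<in> Obj T \<Longrightarrow> exact_functor T T (\<lambda>y. x \<boxtimes> y) (\<lambda>f. Ident T x \<star> f)"
    and tensor_exact_left:
      "x \<in> Obj T \<Longrightarrow> exact_functor T T (\<lambda>y. y \<boxtimes> x) (\<lambda>f. f \<star> Ident T x)"

text \<open>
  \<open>internal_hom T H ev\<close> says that \<open>H x\<close> underlies a right adjoint of \<open>x \<otimes> _\<close>, with counit
  \<open>ev x y : x \<otimes> H x y \<rightarrow> y\<close>; the adjunction is given by the universal property of the counit.
\<close>

definition internal_hom ::
  "('o, 'm, 'x) ttcat_scheme \<Rightarrow> ('o \<Rightarrow> 'o \<Rightarrow> 'o) \<Rightarrow> ('o \<Rightarrow> 'o \<Rightarrow> 'm) \<Rightarrow> bool" where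
  "internal_hom T H ev \<longleftrightarrow>
     (\<forall>x \<in> Obj T. \<forall>y \<in> Obj T.
        H x y \<in> Obj T \<and> ev x y \<in> Hom T (x \<boxtimes>\<^bsub>T\<^esub> H x y) y \<and>
        (\<forall>z \<in> Obj T. \<forall>f \<in> Hom T (x \<boxtimes>\<^bsub>T\<^esub> z) y.
           \<exists>!g. g \<in> Hom T z (H x y) \<and> ev x y \<cdot>\<^bsub>T\<^esub> (Ident T x \<star>\<^bsub>T\<^esub> g) = f))"

text \<open>
  The natural morphism \<open>x\<^sup>\<or> \<otimes> y \<rightarrow> H x y\<close>, where \<open>x\<^sup>\<or> = H x \<one>\<close>, is the transpose of
  \<open>x \<otimes> (x\<^sup>\<or> \<otimes> y) \<cong> (x \<otimes> x\<^sup>\<or>) \<otimes> y \<rightarrow> \<one> \<otimes> y \<cong> y\<close>. The associator points the other way, hence its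
  inverse, which is unique in a category.
\<close>

definition natural_dual_map ::
  "('o, 'm, 'x) ttcat_scheme \<Rightarrow> ('o \<Rightarrow> 'o \<Rightarrow> 'o) \<Rightarrow> ('o \<Rightarrow> 'o \<Rightarrow> 'm) \<Rightarrow> 'o \<Rightarrow> 'o \<Rightarrow> 'm" where
  "natural_dual_map T H ev x y =
     (THE g. g \<in> Hom T (H x (Unit T) \<boxtimes>\<^bsub>T\<^esub> y) (H x y) \<and>
        ev x y \<cdot>\<^bsub>T\<^esub> (Ident T x \<star>\<^bsub>T\<^esub> g) =
          Lunit T y \<cdot>\<^bsub>T\<^esub> (ev x (Unit T) \<star>\<^bsub>T\<^esub> Ident T y) \<cdot>\<^bsub>T\<^esub>
            (THE a. inverse_arrows T (Assoc T x (H x (Unit T)) y) a))"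

definition rigid :: "('o, 'm, 'x) ttcat_scheme \<Rightarrow> bool" where
  "rigid T \<longleftrightarrow>
     (\<exists>H ev. internal_hom T H ev \<and>
        (\<forall>x \<in> Obj T. \<forall>y \<in> Obj T. is_iso T (natural_dual_map T H ev x y)))"

definition thick_tensor_ideal :: "('o, 'm, 'x) ttcat_scheme \<Rightarrow> 'o set \<Rightarrow> bool" where
  "thick_tensor_ideal T S \<longleftrightarrow>
     thick_subcategory T S \<and> (\<forall>x \<in> Obj T. \<forall>s \<in> S. x \<boxtimes>\<^bsub>T\<^esub> s \<in> S)"


section \<open>The Balmer spectrum\<close>

definition Spc :: "('o, 'm, 'x) ttcat_scheme \<Rightarrow> 'o set set" where
  "Spc T = {P. thick_tensor_ideal T P \<and> P \<subset> Obj T \<and>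
     (\<forall>x \<in> Obj T. \<forall>y \<in> Obj T. x \<boxtimes>\<^bsub>T\<^esub> y \<in> P \<longrightarrow> x \<in> P \<or> y \<in> P)}"

definition supp :: "('o, 'm, 'x) ttcat_scheme \<Rightarrow> 'o \<Rightarrow> 'o set set" where
  "supp T k = {P \<in> Spc T. k \<notin> P}"

text \<open>The complements of the sets \<open>supp T k\<close> form a basis of open sets.\<close>

definition Spc_topology :: "('o, 'm, 'x) ttcat_scheme \<Rightarrow> 'o set topology" where
  "Spc_topology T = topology (arbitrary union_of (\<lambda>U. \<exists>k \<in> Obj T. U = Spc T - supp T k))"

text \<open>\<open>topology\<close> is only specified on families that are topologies; this one is.\<close>

lemma (in tensor_triangulated_category) openin_Spc_topology:
  "openin (Spc_topology T) = arbitrary union_of (\<lambda>U. \<exists>k \<in> Obj T. U = Spc T - supp T k)"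
proof -
  let ?B = "\<lambda>U. \<exists>k \<in> Obj T. U = Spc T - supp T k"
  have "?B (U \<inter> V)" if "?B U" "?B V" for U V
  proof -
    from that obtain k l where k: "k \<in> Obj T" "U = Spc T - supp T k"
      and l: "l \<in> Obj T" "V = Spc T - supp T l"
      by blast
    obtain b where b: "is_biproduct T k l b"
      using biproduct_exists k l by blast
    then have b': "is_biproduct T l k b"
      by (rule is_biproduct_swap)
    have "b \<in> P \<longleftrightarrow> k \<in> P \<and> l \<in> P" if "P \<in> Spc T" for P
    proof -
      have P: "thick_subcategory T P"
        using that by (simp add: Spc_def thick_tensor_ideal_def)
      then have "\<forall>x \<in> P. \<forall>y \<in> P. \<forall>b. is_biproduct T x y b \<longrightarrow> b \<in> P"
        unfolding thick_subcategory_def triangulated_subcategory_def by (elim conjE)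
      moreover have "\<forall>b \<in> P. \<forall>x. direct_summand T x b \<longrightarrow> x \<in> P"
        using P unfolding thick_subcategory_def by (elim conjE)
      moreover have "direct_summand T k b" "direct_summand T l b"
        using b b' by (auto simp: direct_summand_def)
      ultimately show ?thesis using b by blast
    qed
    then have "U \<inter> V = Spc T - supp T b"
      unfolding k l supp_def by blast
    moreover have "b \<in> Obj T"
      using b by (simp add: is_biproduct_def)
    ultimately show ?thesis by blast
  qed
  then have "istopology (arbitrary union_of ?B)"
    by (intro istopology_base) blast
  then show ?thesis
    by (simp add: Spc_topology_def topology_inverse')
qed

lemma (in tensor_triangulated_category) topspace_Spc_topology: "topspace (Spc_topology T) = Spc T"
proof -
  obtain z where z: "zero_object T z"
    using zero_object_exists by blast
  have "z \<in> P" if "P \<in> Spc T" for P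
  proof -
    have "triangulated_subcategory T P"
      using that by (simp add: Spc_def thick_tensor_ideal_def thick_subcategory_def)
    then have "\<forall>z. zero_object T z \<longrightarrow> z \<in> P"
      unfolding triangulated_subcategory_def by (elim conjE)
    with z show ?thesis by blast
  qed
  then have "supp T z = {}"
    by (auto simp: supp_def)
  moreover have "z \<in> Obj T"
    using z by (simp add: zero_object_def)
  ultimately have "\<exists>k \<in> Obj T. Spc T = Spc T - supp T k"
    by (intro bexI[of _ z]) simp_all
  then have "openin (Spc_topology T) (Spc T)"
    unfolding openin_Spc_topology by (intro union_of_inc) (simp_all add: arbitrary_def)
  moreover have "U \<subseteq> Spc T" if "openin (Spc_topology T) U" for U
    using that unfolding openin_Spc_topology union_of_def by blast
  ultimately show ?thesis
    by (intro subset_antisym) (simp_all add: openin_subset)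
qed

end

theory Submission
  imports Defs
begin

text \<open>
  Suppose \<open>S = \<langle>g\<rangle>\<^sub>n\<close>. Let \<open>\<xi> : J \<rightarrow> \<one>\<close> be the fibre of the coevaluation
  \<open>\<one> \<rightarrow> hom(g, g)\<close>. Since \<open>g \<otimes> \<xi> = 0\<close>, the \<open>n\<close>-fold power \<open>e : E \<rightarrow> \<one>\<close> of \<open>\<xi>\<close> satisfies
  \<open>s \<otimes> e = 0\<close> for all \<open>s \<in> S\<close>, and the cones \<open>C\<close>, \<open>C\<^sub>2\<close> of \<open>e\<close> and \<open>e \<otimes> e\<close> lie in \<open>S\<close>. By rigidity
  \<open>e\<close> kills every map from an object of \<open>S\<close>, so the map \<open>C\<^sub>2 \<rightarrow> C\<close> under \<open>\<one>\<close> factors through a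
  map \<open>C\<^sub>2 \<rightarrow> \<one>\<close>. The composite \<open>a : \<one> \<rightarrow> C\<^sub>2 \<rightarrow> \<one>\<close> is an idempotent which is the identity on \<open>S\<close>
  and factors through \<open>S\<close>. Hence a prime contains \<open>g\<close> iff it does not contain the cone \<open>k\<close> of \<open>a\<close>:
  the support of \<open>g\<close> is open and closed. Connectedness makes it empty or everything, and the
  existence of primes above proper ideals then forces \<open>S = 0\<close> or \<open>S = T\<close>.
\<close>


section \<open>Categories\<close>

text \<open>The square of \<open>e\<close> is there because of an obstruction. The map
  \<open>C\<^sub>2 \<rightarrow> C\<close> lifts along \<open>\<one> \<rightarrow> C\<close> iff its
  composite with \<open>C \<rightarrow> \<Sigma>E\<close> vanishes. As this map comes from a
  morphism of triangles over \<open>E \<otimes> e : E \<otimes> E \<rightarrow> E\<close>, the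
  composite equals \<open>C\<^sub>2 \<rightarrow> \<Sigma>(E \<otimes> E) \<rightarrow>
  \<Sigma>E\<close>, whose last arrow is the suspension of \<open>E \<otimes> e\<close> and is
  annihilated by all of \<open>S\<close>. The connecting map
  \<open>C \<rightarrow> \<Sigma>E\<close> of a single cone has no such factor.

  Annihilation is a statement about tensor products, while the obstruction is a composite. Rigidity
  translates between the two: a map that is annihilated by the dual of \<open>x\<close> kills every
  map out of \<open>x\<close>, and the dual of an object of \<open>S\<close> is again in
  \<open>S\<close>.

  Idempotents of \<open>T\<close> need not split, so \<open>a\<close> yields no complementary
  summand of the unit. Its cone \<open>k\<close> replaces it: \<open>g \<otimes> a\<close> is the
  identity, hence \<open>g \<otimes> k = 0\<close>, and \<open>1 - a\<close> factors through
  \<open>k\<close>, hence the unit lies in every thick subcategory that contains \<open>S\<close>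
  and \<open>k\<close>.\<close>

context category
begin

lemma Hom_Obj: "f \<in> Hom C x y \<Longrightarrow> x \<in> Obj C" "f \<in> Hom C x y \<Longrightarrow> y \<in> Obj C"
  using Dom_in_Obj Cod_in_Obj by (auto simp: Hom_def)

lemma Ident_simps [simp]:
  assumes "x \<in> Obj C"
  shows "Ident C x \<in> Arr C" "Dom C (Ident C x) = x" "Cod C (Ident C x) = x"
  using Ident_in_Hom[OF assms] by (simp_all add: Hom_def)

lemma Comp_simps [simp]:
  assumes "f \<in> Arr C" "g \<in> Arr C" "Cod C f = Dom C g"
  shows "g \<cdot> f \<in> Arr C" "Dom C (g \<cdot> f) = Dom C f" "Cod C (g \<cdot> f) = Cod C g"
  using Comp_in_Hom[of f "Dom C f" "Cod C f" g "Cod C g"] assms by (simp_all add: Hom_def)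

lemma Comp_Ident_simps [simp]:
  assumes "f \<in> Arr C"
  shows "Dom C f = x \<Longrightarrow> f \<cdot> Ident C x = f" "Cod C f = y \<Longrightarrow> Ident C y \<cdot> f = f"
  using assms Comp_Ident_right[of f x "Cod C f"] Comp_Ident_left[of f "Dom C f" y]
  by (simp_all add: Hom_def)

lemma Comp_assoc_simp [simp]:
  assumes "f \<in> Arr C" "g \<in> Arr C" "h \<in> Arr C" "Cod C f = Dom C g" "Cod C g = Dom C h"
  shows "(h \<cdot> g) \<cdot> f = h \<cdot> (g \<cdot> f)"
  using assms Comp_assoc[of f "Dom C f" "Dom C g" g "Dom C h" h "Cod C h"] by (simp add: Hom_def)

declare Dom_in_Obj [simp] Cod_in_Obj [simp]

lemma isoI:
  assumes "f \<in> Hom C x y" "g \<in> Hom C y x" "g \<cdot> f = Ident C x" "f \<cdot> g = Ident C y"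
  shows "is_iso C f"
  using assms unfolding is_iso_def inverse_arrows_def by (auto simp: Hom_def)

lemma isoE:
  assumes "is_iso C f" "f \<in> Hom C x y"
  obtains g where "g \<in> Hom C y x" "g \<cdot> f = Ident C x" "f \<cdot> g = Ident C y"
  using assms unfolding is_iso_def inverse_arrows_def by (auto simp: Hom_def)

lemma isomorphicI:
  assumes "f \<in> Hom C x y" "g \<in> Hom C y x" "g \<cdot> f = Ident C x" "f \<cdot> g = Ident C y"
  shows "isomorphic C x y"
  using isoI[OF assms] assms(1) by (auto simp: isomorphic_def)

lemma isomorphicE:
  assumes "isomorphic C x y"
  obtains f g where "f \<in> Hom C x y" "g \<in> Hom C y x" "g \<cdot> f = Ident C x" "f \<cdot> g = Ident C y"
  using assms unfolding isomorphic_def by (metis isoE)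

lemma isomorphic_sym: "isomorphic C x y \<Longrightarrow> isomorphic C y x"
  by (metis isomorphicE isomorphicI)

lemma iso_mono:
  assumes "is_iso C i" "f \<in> Arr C" "f' \<in> Arr C" "i \<cdot> f = i \<cdot> f'"
    "i \<in> Arr C" "Cod C f = Dom C i" "Cod C f' = Dom C i"
  shows "f = f'"
proof -
  obtain j where j: "j \<in> Hom C (Cod C i) (Dom C i)" "j \<cdot> i = Ident C (Dom C i)"
    using isoE[OF assms(1), of "Dom C i" "Cod C i"] assms by (auto simp: Hom_def)
  have "(j \<cdot> i) \<cdot> f = (j \<cdot> i) \<cdot> f'"
    using assms j(1) by (simp add: Hom_def)
  then show ?thesis using j assms by (simp add: Hom_def)
qed

lemma iso_epi:
  assumes "is_iso C i" "f \<in> Arr C" "f' \<in> Arr C" "f \<cdot> i = f' \<cdot> i"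
    "i \<in> Arr C" "Dom C f = Cod C i" "Dom C f' = Cod C i"
  shows "f = f'"
proof -
  obtain j where j: "j \<in> Hom C (Cod C i) (Dom C i)" "i \<cdot> j = Ident C (Cod C i)"
    using isoE[OF assms(1), of "Dom C i" "Cod C i"] assms by (auto simp: Hom_def)
  have "f \<cdot> (i \<cdot> j) = f' \<cdot> (i \<cdot> j)"
    using assms j(1) Comp_assoc_simp[of j i f] Comp_assoc_simp[of j i f'] by (simp add: Hom_def)
  then show ?thesis using j assms by (simp add: Hom_def)
qed

lemma isomorphic_trans:
  assumes "isomorphic C x y" "isomorphic C y z"
  shows "isomorphic C x z"
proof -
  obtain f g where f: "f \<in> Hom C x y" "g \<in> Hom C y x" "g \<cdot> f = Ident C x" "f \<cdot> g = Ident C y"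
    using assms by (blast elim: isomorphicE)
  obtain h k where h: "h \<in> Hom C y z" "k \<in> Hom C z y" "k \<cdot> h = Ident C y" "h \<cdot> k = Ident C z"
    using assms by (blast elim: isomorphicE)
  have "(g \<cdot> k) \<cdot> (h \<cdot> f) = g \<cdot> ((k \<cdot> h) \<cdot> f)" "(h \<cdot> f) \<cdot> (g \<cdot> k) = h \<cdot> ((f \<cdot> g) \<cdot> k)"
    using f(1,2) h(1,2) by (simp_all add: Hom_def)
  then have "(g \<cdot> k) \<cdot> (h \<cdot> f) = Ident C x" "(h \<cdot> f) \<cdot> (g \<cdot> k) = Ident C z"
    using f h by (simp_all add: Hom_def)
  moreover have "h \<cdot> f \<in> Hom C x z" "g \<cdot> k \<in> Hom C z x"
    using f h Comp_in_Hom by blast+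
  ultimately show ?thesis by (blast intro: isomorphicI)
qed

lemma inverse_arrows_unique:
  assumes "inverse_arrows C f g" "inverse_arrows C f g'"
  shows "g = g'"
proof -
  have h: "f \<in> Arr C" "g \<in> Hom C (Cod C f) (Dom C f)" "g' \<in> Hom C (Cod C f) (Dom C f)"
    "g \<cdot> f = Ident C (Dom C f)" "f \<cdot> g' = Ident C (Cod C f)"
    using assms unfolding inverse_arrows_def by blast+
  have "g = g \<cdot> (f \<cdot> g')"
    using h by (simp add: Hom_def)
  also have "\<dots> = (g \<cdot> f) \<cdot> g'"
    using h(1-3) by (simp add: Hom_def)
  also have "\<dots> = g'"
    using h by (simp add: Hom_def)
  finally show ?thesis .
qed

lemma the_inverse_arrows:
  assumes "is_iso C f"
  shows "inverse_arrows C f (THE g. inverse_arrows C f g)"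
  using assms inverse_arrows_unique unfolding is_iso_def by (metis theI)

end


section \<open>Additive categories\<close>

context additive_category
begin

lemma
  assumes "f \<in> Hom C x y" "g \<in> Hom C x y"
  shows Add_in_Hom: "Add C f g \<in> Hom C x y"
    and Add_commute: "Add C f g = Add C g f"
    and Add_cancel: "Add C f g = f \<Longrightarrow> g = Zero C x y"
    and Add_Zero_right: "Add C f (Zero C x y) = f"
    and Add_Zero_left: "Add C (Zero C x y) f = f"
    and Neg_in_Hom: "Neg C f \<in> Hom C x y"
    and Add_Neg: "Add C f (Neg C f) = Zero C x y"
    and Neg_unique: "Add C f g = Zero C x y \<Longrightarrow> g = Neg C f"
    and Neg_inject: "Neg C f = Neg C g \<Longrightarrow> f = g"
    and Neg_Neg: "Neg C (Neg C f) = f"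
    and difference_exists: "\<exists>d \<in> Hom C x y. f = Add C g d"
proof -
  interpret G: comm_group "hom_group C x y"
    using Hom_Obj[OF assms(1)] by (rule hom_comm_group)
  have [simp]: "carrier (hom_group C x y) = Hom C x y"
    "mult (hom_group C x y) = Add C" "one (hom_group C x y) = Zero C x y"
    by (simp_all add: hom_group_def)
  have N: "Neg C h = inv\<^bsub>hom_group C x y\<^esub> h" if "h \<in> Hom C x y" for h
    using that by (simp add: Neg_def Hom_def)
  show "Add C f g \<in> Hom C x y"
    using assms G.m_closed[of f g] by simp
  show "Add C f g = Add C g f"
    using assms G.m_comm[of f g] by simp
  show "g = Zero C x y" if "Add C f g = f"
    using assms G.Units_l_cancel[of f g "\<one>\<^bsub>hom_group C x y\<^esub>"] G.r_one[of f] G.Units_eq that G.one_closed by simp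
  show "Add C f (Zero C x y) = f" "Add C (Zero C x y) f = f"
    using assms G.r_one[of f] G.l_one[of f] by simp_all
  show "Neg C f \<in> Hom C x y" "Add C f (Neg C f) = Zero C x y"
    using G.inv_closed[of f] G.r_inv[of f] assms by (simp_all add: N)
  show "g = Neg C f" if "Add C f g = Zero C x y"
    using G.inv_equality[of g f] G.m_comm[of f g] assms that by (simp add: N)
  show "Neg C (Neg C f) = f"
    using G.inv_inv[of f] G.inv_closed[of f] assms by (simp add: N)
  show "f = g" if "Neg C f = Neg C g"
  proof -
    have "inv\<^bsub>hom_group C x y\<^esub> f = inv\<^bsub>hom_group C x y\<^esub> g"
      using that assms by (simp add: N)
    then have "inv\<^bsub>hom_group C x y\<^esub> (inv\<^bsub>hom_group C x y\<^esub> f) = g"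
      using G.inv_inv[of g] assms by simp
    then show ?thesis using G.inv_inv[of f] assms by simp
  qed
  have "f = Add C g (Add C (Neg C g) f)"
    using G.m_assoc[of g "Neg C g" f] G.r_inv[of g] G.inv_closed[of g]
      G.l_one[of f] assms by (simp add: N)
  moreover have "Add C (Neg C g) f \<in> Hom C x y"
    using G.m_closed[of "Neg C g" f] G.inv_closed[of g] assms by (simp add: N)
  ultimately show "\<exists>d \<in> Hom C x y. f = Add C g d" by blast
qed

lemma Zero_in_Hom: "x \<in> Obj C \<Longrightarrow> y \<in> Obj C \<Longrightarrow> Zero C x y \<in> Hom C x y"
proof -
  assume "x \<in> Obj C" "y \<in> Obj C"
  then interpret G: comm_group "hom_group C x y"
    by (rule hom_comm_group)
  show ?thesis using G.one_closed by (simp add: hom_group_def)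
qed

lemma Zero_simps [simp]:
  assumes "x \<in> Obj C" "y \<in> Obj C"
  shows "Zero C x y \<in> Arr C" "Dom C (Zero C x y) = x" "Cod C (Zero C x y) = y"
  using Zero_in_Hom[OF assms] by (simp_all add: Hom_def)

lemma Comp_Zero_right:
  assumes "g \<in> Hom C y z" "x \<in> Obj C"
  shows "g \<cdot> Zero C x y = Zero C x z"
proof -
  have 0: "Zero C x y \<in> Hom C x y"
    using Zero_in_Hom assms Hom_Obj by blast
  have "Add C (g \<cdot> Zero C x y) (g \<cdot> Zero C x y) = g \<cdot> Zero C x y"
    using Comp_Add_right[OF 0 0 assms(1)] Add_Zero_right[OF 0 0] by simp
  then show ?thesis
    using Add_cancel Comp_in_Hom[OF 0 assms(1)] by blast
qed

lemma Comp_Zero_left: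
  assumes "g \<in> Hom C x y" "z \<in> Obj C"
  shows "Zero C y z \<cdot> g = Zero C x z"
proof -
  have 0: "Zero C y z \<in> Hom C y z"
    using Zero_in_Hom assms Hom_Obj by blast
  have "Add C (Zero C y z \<cdot> g) (Zero C y z \<cdot> g) = Zero C y z \<cdot> g"
    using Comp_Add_left[OF assms(1) 0 0] Add_Zero_right[OF 0 0] by simp
  then show ?thesis
    using Add_cancel Comp_in_Hom[OF assms(1) 0] by blast
qed

lemma Comp_Zero_simps [simp]:
  assumes "g \<in> Arr C" "x \<in> Obj C"
  shows "Dom C g = y \<Longrightarrow> g \<cdot> Zero C x y = Zero C x (Cod C g)"
    "Cod C g = y \<Longrightarrow> Zero C y x \<cdot> g = Zero C (Dom C g) x"
  using assms by (auto intro!: Comp_Zero_right Comp_Zero_left simp: Hom_def)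

lemma
  assumes "f \<in> Hom C x y" "g \<in> Hom C y z"
  shows Comp_Neg_right: "g \<cdot> Neg C f = Neg C (g \<cdot> f)"
    and Comp_Neg_left: "Neg C g \<cdot> f = Neg C (g \<cdot> f)"
proof -
  have nf: "Neg C f \<in> Hom C x y" and ng: "Neg C g \<in> Hom C y z"
    using assms Neg_in_Hom by blast+
  have gf: "g \<cdot> f \<in> Hom C x z" "g \<cdot> Neg C f \<in> Hom C x z" "Neg C g \<cdot> f \<in> Hom C x z"
    using Comp_in_Hom assms nf ng by blast+
  have O: "x \<in> Obj C" "z \<in> Obj C"
    using assms Hom_Obj by blast+
  have "Add C (g \<cdot> f) (g \<cdot> Neg C f) = Zero C x z"
    using Comp_Add_right[OF assms(1) nf assms(2)] Add_Neg[OF assms(1) nf]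
      Comp_Zero_right[OF assms(2) O(1)] by simp
  then show "g \<cdot> Neg C f = Neg C (g \<cdot> f)"
    using Neg_unique gf by blast
  have "Add C (g \<cdot> f) (Neg C g \<cdot> f) = Zero C x z"
    using Comp_Add_left[OF assms(1) assms(2) ng] Add_Neg[OF assms(2) ng]
      Comp_Zero_left[OF assms(1) O(2)] by simp
  then show "Neg C g \<cdot> f = Neg C (g \<cdot> f)"
    using Neg_unique gf by blast
qed

lemma Neg_eq_Zero:
  assumes "f \<in> Hom C x y" "Neg C f = Zero C x y"
  shows "f = Zero C x y"
  using assms Add_Neg[OF assms(1) assms(1)] Add_Zero_right[OF assms(1) assms(1)] by simp

text \<open>Every arrow into or out of \<open>z\<close> is unchanged by composition with the
  identity of \<open>z\<close>, so it vanishes once that identity does. A universal property thus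
  becomes one equation, which additive functors and retracts preserve.\<close>

lemma zero_object_iff: "zero_object C z \<longleftrightarrow> z \<in> Obj C \<and> Ident C z = Zero C z z"
proof
  assume z: "zero_object C z"
  then have "z \<in> Obj C" "\<exists>!f. f \<in> Hom C z z"
    by (auto simp: zero_object_def)
  then show "z \<in> Obj C \<and> Ident C z = Zero C z z"
    using Ident_in_Hom Zero_in_Hom by blast
next
  assume z: "z \<in> Obj C \<and> Ident C z = Zero C z z"
  have "f = Zero C x z" if "f \<in> Hom C x z" for f x
    using Comp_Zero_left[OF that, of z] Comp_Ident_left[OF that] z by simp
  moreover have "f = Zero C z x" if "f \<in> Hom C z x" for f x
    using Comp_Zero_right[OF that, of z] Comp_Ident_right[OF that] z by simp
  moreover have "Zero C x z \<in> Hom C x z" "Zero C z x \<in> Hom C z x" if "x \<in> Obj C" for x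
    using Zero_in_Hom that z by blast+
  ultimately show "zero_object C z"
    unfolding zero_object_def using z by blast
qed

lemma zero_object_Hom:
  assumes "zero_object C z"
  shows "f \<in> Hom C z x \<Longrightarrow> f = Zero C z x" "f \<in> Hom C x z \<Longrightarrow> f = Zero C x z"
proof -
  have z: "z \<in> Obj C" using assms by (simp add: zero_object_def)
  show "f \<in> Hom C z x \<Longrightarrow> f = Zero C z x"
    using assms Hom_Obj(2)[of f z x] Zero_in_Hom[OF z, of x] unfolding zero_object_def by blast
  show "f \<in> Hom C x z \<Longrightarrow> f = Zero C x z"
    using assms Hom_Obj(1)[of f x z] Zero_in_Hom[OF _ z, of x] unfolding zero_object_def by blast
qed

lemma zero_object_retract:
  assumes "i \<in> Hom C x z" "p \<in> Hom C z x" "p \<cdot> i = Ident C x" "zero_object C z"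
  shows "zero_object C x"
proof -
  have "i = Zero C x z" using zero_object_Hom assms by blast
  moreover have "x \<in> Obj C" using assms Hom_Obj by blast
  ultimately show ?thesis
    using Comp_Zero_right[OF assms(2), of x] assms(3) by (simp add: zero_object_iff)
qed

lemma zero_object_isomorphic:
  "isomorphic C x y \<Longrightarrow> zero_object C x \<Longrightarrow> zero_object C y"
  by (erule isomorphicE) (rule zero_object_retract)

lemma biproductE:
  assumes "is_biproduct C x y b"
  obtains i j p q where "i \<in> Hom C x b" "j \<in> Hom C y b" "p \<in> Hom C b x" "q \<in> Hom C b y"
    "p \<cdot> i = Ident C x" "q \<cdot> j = Ident C y"
    "q \<cdot> i = Zero C x y" "p \<cdot> j = Zero C y x" "Add C (i \<cdot> p) (j \<cdot> q) = Ident C b"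
  using assms unfolding is_biproduct_def by (elim conjE bexE) (rule that)

lemma zero_object_biproduct:
  assumes "is_biproduct C x y b" "zero_object C x" "zero_object C y"
  shows "zero_object C b"
proof -
  obtain i j p q where h: "i \<in> Hom C x b" "j \<in> Hom C y b" "p \<in> Hom C b x" "q \<in> Hom C b y"
    "Add C (i \<cdot> p) (j \<cdot> q) = Ident C b"
    using assms(1) by (rule biproductE) (rule that)
  have b: "b \<in> Obj C" using h Hom_Obj by blast
  have "p = Zero C b x" "q = Zero C b y"
    using h assms zero_object_Hom by blast+
  then have "i \<cdot> p = Zero C b b" "j \<cdot> q = Zero C b b"
    using h b Comp_Zero_right by auto
  then show ?thesis
    using h b Add_Zero_right[OF Zero_in_Hom[OF b b] Zero_in_Hom[OF b b]] by (simp add: zero_object_iff)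
qed

end


section \<open>Triangulated categories\<close>

context category
begin

lemma is_iso_Ident: "x \<in> Obj C \<Longrightarrow> is_iso C (Ident C x)"
  using isoI[of "Ident C x" x x "Ident C x"] Ident_in_Hom Comp_Ident_left by blast

lemma functorD:
  assumes "is_functor C D F A"
  shows "x \<in> Obj C \<Longrightarrow> F x \<in> Obj D"
    and "x \<in> Obj C \<Longrightarrow> A (Ident C x) = Ident D (F x)"
    and "f \<in> Hom C x y \<Longrightarrow> A f \<in> Hom D (F x) (F y)"
    and "f \<in> Hom C x y \<Longrightarrow> g \<in> Hom C y z \<Longrightarrow> A (g \<cdot> f) = A g \<cdot>\<^bsub>D\<^esub> A f"
  using assms unfolding is_functor_def by blast+

lemma natural_isoD:
  assumes "natural_iso C D F A G B \<tau>"
  shows "x \<in> Obj C \<Longrightarrow> \<tau> x \<in> Hom D (F x) (G x)"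
    and "x \<in> Obj C \<Longrightarrow> is_iso D (\<tau> x)"
    and "f \<in> Hom C x y \<Longrightarrow> \<tau> y \<cdot>\<^bsub>D\<^esub> A f = B f \<cdot>\<^bsub>D\<^esub> \<tau> x"
  using assms unfolding natural_iso_def by blast+

text \<open>Naturality reads \<open>\<tau> y \<cdot> f = L f \<cdot> \<tau> x\<close>, so
  \<open>L f\<close> determines \<open>f\<close> after cancelling \<open>\<tau> y\<close>.\<close>

lemma faithful_if_natural_iso_Ident:
  assumes "natural_iso C C (\<lambda>x. x) (\<lambda>f. f) K L \<tau>"
    and "f \<in> Hom C x y" "f' \<in> Hom C x y" "L f = L f'"
  shows "f = f'"
proof (rule iso_mono)
  have y: "y \<in> Obj C" using assms Hom_Obj by blast
  show "is_iso C (\<tau> y)" "\<tau> y \<cdot> f = \<tau> y \<cdot> f'"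
    using natural_isoD[OF assms(1)] y assms(2-4) by metis+
  show "f \<in> Arr C" "f' \<in> Arr C" "\<tau> y \<in> Arr C" "Cod C f = Dom C (\<tau> y)" "Cod C f' = Dom C (\<tau> y)"
    using natural_isoD(1)[OF assms(1) y] assms(2,3) by (simp_all add: Hom_def)
qed

lemma faithful_if_natural_iso_Ident':
  assumes "natural_iso C C K L (\<lambda>x. x) (\<lambda>f. f) \<tau>"
    and "f \<in> Hom C x y" "f' \<in> Hom C x y" "L f = L f'"
  shows "f = f'"
proof (rule iso_epi)
  have x: "x \<in> Obj C" using assms Hom_Obj by blast
  show "is_iso C (\<tau> x)" "f \<cdot> \<tau> x = f' \<cdot> \<tau> x"
    using natural_isoD[OF assms(1)] x assms(2-4) by metis+
  show "f \<in> Arr C" "f' \<in> Arr C" "\<tau> x \<in> Arr C" "Dom C f = Cod C (\<tau> x)" "Dom C f' = Cod C (\<tau> x)"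
    using natural_isoD(1)[OF assms(1) x] assms(2,3) by (simp_all add: Hom_def)
qed

text \<open>The unit and counit in \<open>autoequivalence\<close> satisfy no triangle identities.
  Fullness therefore combines two facts: the unit provides a candidate preimage, and the counit
  shows that the quasi-inverse is faithful.\<close>

lemma
  assumes "autoequivalence C F A"
  shows autoequivalence_faithful:
      "\<lbrakk>f \<in> Hom C x y; f' \<in> Hom C x y; A f = A f'\<rbrakk> \<Longrightarrow> f = f'"
    and autoequivalence_full:
      "\<lbrakk>x \<in> Obj C; y \<in> Obj C; c \<in> Hom C (F x) (F y)\<rbrakk> \<Longrightarrow> \<exists>f \<in> Hom C x y. A f = c"
    and autoequivalence_ess_surj: "x \<in> Obj C \<Longrightarrow> \<exists>w \<in> Obj C. isomorphic C (F w) x"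
proof -
  obtain G B \<eta> \<epsilon> where F: "is_functor C C F A" and G: "is_functor C C G B"
    and \<eta>: "natural_iso C C (\<lambda>x. x) (\<lambda>f. f) (G \<circ> F) (B \<circ> A) \<eta>"
    and \<epsilon>: "natural_iso C C (F \<circ> G) (A \<circ> B) (\<lambda>x. x) (\<lambda>f. f) \<epsilon>"
    using assms unfolding autoequivalence_def by blast
  show "f = f'" if "f \<in> Hom C x y" "f' \<in> Hom C x y" "A f = A f'"
    using faithful_if_natural_iso_Ident[OF \<eta> that(1,2)] that(3) by simp
  show "\<exists>w \<in> Obj C. isomorphic C (F w) x" if "x \<in> Obj C"
    using natural_isoD(1,2)[OF \<epsilon> that] functorD(1)[OF G that] by (auto simp: isomorphic_def)
  show "\<exists>f \<in> Hom C x y. A f = c" if x: "x \<in> Obj C" and y: "y \<in> Obj C" and c: "c \<in> Hom C (F x) (F y)"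
  proof -
    have ex: "\<eta> x \<in> Hom C x (G (F x))" "is_iso C (\<eta> x)" and ey: "\<eta> y \<in> Hom C y (G (F y))" "is_iso C (\<eta> y)"
      using natural_isoD(1,2)[OF \<eta>] x y by auto
    obtain j where j: "j \<in> Hom C (G (F y)) y" "\<eta> y \<cdot> j = Ident C (G (F y))"
      using isoE ey by metis
    have Bc: "B c \<in> Hom C (G (F x)) (G (F y))"
      using functorD(3)[OF G c] .
    \<comment> \<open>The conjugate of \<open>B c\<close> by the unit; naturality of
      \<open>\<eta>\<close> then gives \<open>B (A f) = B c\<close>.\<close>
    define f where "f = j \<cdot> (B c \<cdot> \<eta> x)"
    have Bce: "B c \<cdot> \<eta> x \<in> Hom C x (G (F y))"
      using ex Bc Comp_in_Hom by blast
    then have f: "f \<in> Hom C x y"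
      unfolding f_def using j(1) Comp_in_Hom by blast
    have Af: "A f \<in> Hom C (F x) (F y)" "B (A f) \<in> Hom C (G (F x)) (G (F y))"
      using functorD(3)[OF F f] functorD(3)[OF G] by blast+
    have "\<eta> y \<cdot> f = (\<eta> y \<cdot> j) \<cdot> (B c \<cdot> \<eta> x)"
      unfolding f_def using Comp_assoc[OF Bce j(1) ey(1)] by simp
    also have "\<dots> = B c \<cdot> \<eta> x"
      using j Bce Comp_Ident_left by simp
    finally have "B (A f) \<cdot> \<eta> x = B c \<cdot> \<eta> x"
      using natural_isoD(3)[OF \<eta> f] by simp
    then have "B (A f) = B c"
      by (rule iso_epi[OF ex(2), rotated 2]) (use Af Bc ex(1) in \<open>simp_all add: Hom_def\<close>)
    then have "A f = c"
      using faithful_if_natural_iso_Ident'[OF \<epsilon> Af(1) c] by simp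
    then show ?thesis using f by blast
  qed
qed

end

section \<open>Distinguished triangles\<close>

context triangulated_category
begin

text \<open>Elements of \<open>Tri\<close> carry only arrows; naming the three objects keeps the
  typing of all later compositions explicit.\<close>

definition dist_tri :: "'o \<Rightarrow> 'o \<Rightarrow> 'o \<Rightarrow> 'm \<Rightarrow> 'm \<Rightarrow> 'm \<Rightarrow> bool" where
  "dist_tri x y z f g h \<longleftrightarrow>
     f \<in> Hom T x y \<and> g \<in> Hom T y z \<and> h \<in> Hom T z (SuspO T x) \<and> (f, g, h) \<in> Tri T"

lemma dist_triD:
  assumes "dist_tri x y z f g h"
  shows "f \<in> Hom T x y" "g \<in> Hom T y z" "h \<in> Hom T z (SuspO T x)" "(f, g, h) \<in> Tri T"
    "x \<in> Obj T" "y \<in> Obj T" "z \<in> Obj T"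
  using assms Hom_Obj unfolding dist_tri_def by blast+

lemma Tri_dist_tri:
  assumes "(f, g, h) \<in> Tri T"
  shows "dist_tri (Dom T f) (Cod T f) (Cod T g) f g h"
  using Tri_candidate[OF assms] assms unfolding candidate_triangle_def dist_tri_def
  by (auto simp: Hom_def)

lemma
  shows SuspO_in_Obj: "x \<in> Obj T \<Longrightarrow> SuspO T x \<in> Obj T"
    and SuspA_Ident: "x \<in> Obj T \<Longrightarrow> SuspA T (Ident T x) = Ident T (SuspO T x)"
    and SuspA_in_Hom: "f \<in> Hom T x y \<Longrightarrow> SuspA T f \<in> Hom T (SuspO T x) (SuspO T y)"
    and SuspA_Comp: "f \<in> Hom T x y \<Longrightarrow> g \<in> Hom T y z \<Longrightarrow> SuspA T (g \<cdot> f) = SuspA T g \<cdot> SuspA T f"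
  using functorD[of T "SuspO T" "SuspA T"] Susp_additive unfolding additive_functor_def by blast+

text \<open>Only sums are preserved by definition. The image of zero equals its own double, and in a
  group that forces it to be zero.\<close>

lemma additive_functor_Zero:
  assumes F: "additive_functor T T F A" and "x \<in> Obj T" "y \<in> Obj T"
  shows "A (Zero T x y) = Zero T (F x) (F y)"
proof -
  have 0: "Zero T x y \<in> Hom T x y"
    using assms Zero_in_Hom by blast
  then have A0: "A (Zero T x y) \<in> Hom T (F x) (F y)"
    using F functorD(3) unfolding additive_functor_def by blast
  have "A (Add T (Zero T x y) (Zero T x y)) = Add T (A (Zero T x y)) (A (Zero T x y))"
    using F 0 unfolding additive_functor_def by blast
  then have "Add T (A (Zero T x y)) (A (Zero T x y)) = A (Zero T x y)"
    using Add_Zero_right[OF 0 0] by simp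
  then show ?thesis
    using Add_cancel[OF A0 A0] by simp
qed

lemma zero_object_SuspO:
  assumes "zero_object T z"
  shows "zero_object T (SuspO T z)"
proof -
  have z: "z \<in> Obj T" "Ident T z = Zero T z z"
    using assms by (simp_all add: zero_object_iff)
  then show ?thesis
    using additive_functor_Zero[OF Susp_additive z(1) z(1)] SuspO_in_Obj[OF z(1)] SuspA_Ident[OF z(1)]
    by (simp add: zero_object_iff)
qed

lemma rotate:
  assumes "dist_tri x y z f g h"
  shows "dist_tri y z (SuspO T x) g h (Neg T (SuspA T f))"
proof -
  note d = dist_triD[OF assms]
  have "candidate_triangle T f g h"
    using d unfolding candidate_triangle_def by blast
  then have "(g, h, Neg T (SuspA T f)) \<in> Tri T"
    using TR2 d by blast
  moreover have "Neg T (SuspA T f) \<in> Hom T (SuspO T x) (SuspO T y)"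
    using Neg_in_Hom SuspA_in_Hom d by blast
  ultimately show ?thesis
    using d unfolding dist_tri_def by blast
qed

lemma rotate_back:
  assumes "f \<in> Hom T x y" "g \<in> Hom T y z" "h \<in> Hom T z (SuspO T x)"
    and "(g, h, Neg T (SuspA T f)) \<in> Tri T"
  shows "dist_tri x y z f g h"
  using assms TR2[of f g h] unfolding candidate_triangle_def dist_tri_def by blast

lemma dist_tri_morphism:
  assumes "dist_tri x y z f g h" "dist_tri x' y' z' f' g' h'"
    and "a \<in> Hom T x x'" "b \<in> Hom T y y'" "f' \<cdot> a = b \<cdot> f"
  obtains c where "c \<in> Hom T z z'" "g' \<cdot> b = c \<cdot> g" "h' \<cdot> c = SuspA T a \<cdot> h"
proof -
  note d = dist_triD[OF assms(1)] and d' = dist_triD[OF assms(2)]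
  have D: "Dom T f = x" "Cod T f = y" "Cod T g = z" "Dom T f' = x'" "Cod T f' = y'" "Cod T g' = z'"
    using d d' by (simp_all add: Hom_def)
  then obtain c where "triangle_morphism T (f, g, h) (f', g', h') a b c"
    using TR3[OF d(4) d'(4)] assms by metis
  then show ?thesis
    using that unfolding triangle_morphism_def by (auto simp: D)
qed

lemma dist_tri_Ident:
  assumes "x \<in> Obj T" "zero_object T o'"
  shows "dist_tri x x o' (Ident T x) (Zero T x o') (Zero T o' (SuspO T x))"
  using assms TR1_ident Ident_in_Hom Zero_in_Hom SuspO_in_Obj
  unfolding dist_tri_def by (auto simp: zero_object_iff)

text \<open>This is a backward rotation of the identity triangle whose third vertex is
  \<open>SuspO T o'\<close>. The sign in the rotation is harmless, since the arrow concerned starts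
  at a zero object.\<close>

lemma dist_tri_Ident':
  assumes "x \<in> Obj T" "zero_object T o'"
  shows "dist_tri o' x x (Zero T o' x) (Ident T x) (Zero T x (SuspO T o'))"
proof (rule rotate_back)
  have o: "o' \<in> Obj T" and so: "zero_object T (SuspO T o')" "SuspO T o' \<in> Obj T"
    using assms zero_object_SuspO SuspO_in_Obj by (auto simp: zero_object_iff)
  show "Zero T o' x \<in> Hom T o' x" "Ident T x \<in> Hom T x x" "Zero T x (SuspO T o') \<in> Hom T x (SuspO T o')"
    using o so assms Zero_in_Hom Ident_in_Hom by blast+
  have "Neg T (SuspA T (Zero T o' x)) \<in> Hom T (SuspO T o') (SuspO T x)"
    using Zero_in_Hom[OF o assms(1)] SuspA_in_Hom Neg_in_Hom by blast
  then have "Neg T (SuspA T (Zero T o' x)) = Zero T (SuspO T o') (SuspO T x)"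
    using zero_object_Hom so by blast
  then show "(Ident T x, Zero T x (SuspO T o'), Neg T (SuspA T (Zero T o' x))) \<in> Tri T"
    using TR1_ident[OF assms(1) so(1)] by simp
qed

text \<open>The pair \<open>(Ident T x, f)\<close> extends to a morphism from the identity triangle
  on \<open>x\<close>, so \<open>g \<cdot> f\<close> factors through a zero object.\<close>

lemma dist_tri_comp:
  assumes "dist_tri x y z f g h"
  shows "g \<cdot> f = Zero T x z"
proof -
  note d = dist_triD[OF assms]
  obtain o' where o: "zero_object T o'" "o' \<in> Obj T"
    using zero_object_exists by (auto simp: zero_object_iff)
  obtain c where c: "c \<in> Hom T o' z" "g \<cdot> f = c \<cdot> Zero T x o'"
    by (rule dist_tri_morphism[OF dist_tri_Ident[OF d(5) o(1)] assms Ident_in_Hom[OF d(5)] d(1)])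
      (auto simp: d)
  then show ?thesis
    using Comp_Zero_right d(5) by simp
qed

lemma dist_tri_comp':
  assumes "dist_tri x y z f g h"
  shows "h \<cdot> g = Zero T y (SuspO T x)" "SuspA T f \<cdot> h = Zero T z (SuspO T y)"
proof -
  note d = dist_triD[OF assms]
  note r = rotate[OF assms]
  show "h \<cdot> g = Zero T y (SuspO T x)"
    using dist_tri_comp[OF r] .
  have sf: "SuspA T f \<in> Hom T (SuspO T x) (SuspO T y)"
    using d SuspA_in_Hom by blast
  have "Neg T (SuspA T f \<cdot> h) = Zero T z (SuspO T y)"
    using dist_tri_comp[OF rotate[OF r]] Comp_Neg_left[OF d(3) sf] by simp
  then show "SuspA T f \<cdot> h = Zero T z (SuspO T y)"
    using Neg_eq_Zero Comp_in_Hom[OF d(3) sf] by blast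
qed

text \<open>Weak cokernel property: \<open>b\<close> extends to a morphism into the triangle
  \<open>0 \<rightarrow> w \<rightarrow> w\<close>, whose third component is
  \<open>t\<close>.\<close>

lemma dist_tri_extend:
  assumes "dist_tri x y z f g h" "b \<in> Hom T y w" "b \<cdot> f = Zero T x w"
  obtains t where "t \<in> Hom T z w" "b = t \<cdot> g"
proof -
  note d = dist_triD[OF assms(1)]
  have w: "w \<in> Obj T" using assms Hom_Obj by blast
  obtain o' where o: "zero_object T o'" "o' \<in> Obj T"
    using zero_object_exists by (auto simp: zero_object_iff)
  obtain t where "t \<in> Hom T z w" "Ident T w \<cdot> b = t \<cdot> g"
    by (rule dist_tri_morphism[OF assms(1) dist_tri_Ident'[OF w o(1)] Zero_in_Hom[OF d(5) o(2)] assms(2)])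
      (use o d w assms(3) in simp_all)
  then show ?thesis
    using that Comp_Ident_left[OF assms(2)] by simp
qed

text \<open>Weak kernel property. \<open>TR3\<close> only ever supplies a third component, so both
  triangles are rotated until the wanted arrow occupies that place. It then appears suspended, and
  the suspension is full and faithful.\<close>

lemma dist_tri_lift:
  assumes "dist_tri x y z f g h" "a \<in> Hom T w y" "g \<cdot> a = Zero T w z"
  obtains t where "t \<in> Hom T w x" "a = f \<cdot> t"
proof -
  note d = dist_triD[OF assms(1)]
  have w: "w \<in> Obj T" using assms Hom_Obj by blast
  obtain o' where o: "zero_object T o'" "o' \<in> Obj T"
    using zero_object_exists by (auto simp: zero_object_iff)
  have sf: "SuspA T f \<in> Hom T (SuspO T x) (SuspO T y)"
    and sa: "SuspA T a \<in> Hom T (SuspO T w) (SuspO T y)"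
    and iw: "Ident T (SuspO T w) \<in> Hom T (SuspO T w) (SuspO T w)"
    using SuspA_in_Hom d assms w SuspO_in_Obj Ident_in_Hom by blast+
  obtain c where c: "c \<in> Hom T (SuspO T w) (SuspO T x)"
    "Neg T (SuspA T f) \<cdot> c = SuspA T a \<cdot> Neg T (SuspA T (Ident T w))"
    by (rule dist_tri_morphism[OF rotate[OF dist_tri_Ident[OF w o(1)]] rotate[OF assms(1)] assms(2)
          Zero_in_Hom[OF o(2) d(7)]]) (use o d w assms(3) in simp_all)
  then have "Neg T (SuspA T f \<cdot> c) = Neg T (SuspA T a)"
    using Comp_Neg_left[OF c(1) sf] Comp_Neg_right[OF iw sa] SuspA_Ident[OF w]
      Comp_Ident_right[OF sa] by simp
  then have "SuspA T f \<cdot> c = SuspA T a"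
    using Neg_inject Comp_in_Hom[OF c(1) sf] sa by blast
  moreover obtain t where t: "t \<in> Hom T w x" "SuspA T t = c"
    using autoequivalence_full[OF Susp_autoequivalence w d(5) c(1)] by blast
  ultimately have "SuspA T (f \<cdot> t) = SuspA T a"
    using SuspA_Comp[OF t(1) d(1)] by simp
  then have "a = f \<cdot> t"
    using autoequivalence_faithful[OF Susp_autoequivalence Comp_in_Hom[OF t(1) d(1)] assms(2)] by simp
  then show ?thesis using t that by blast
qed

lemma cone_exists:
  assumes "f \<in> Hom T x y"
  obtains z g h where "dist_tri x y z f g h"
proof -
  obtain g h where t: "(f, g, h) \<in> Tri T"
    using TR1_cone[of f] assms by (auto simp: Hom_def)
  then show ?thesis
    using Tri_dist_tri[OF t] assms that by (auto simp: Hom_def)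
qed

lemma SuspO_ess_surj:
  assumes "x \<in> Obj T"
  obtains w where "w \<in> Obj T" "isomorphic T (SuspO T w) x"
  using autoequivalence_ess_surj[OF Susp_autoequivalence assms] by blast

lemma fibre_exists:
  assumes "g \<in> Hom T y z"
  obtains x f h where "dist_tri x y z f g h"
proof -
  obtain c k l where c: "dist_tri y z c g k l"
    using cone_exists[OF assms] .
  note d = dist_triD[OF c]
  obtain x where x: "x \<in> Obj T" "isomorphic T (SuspO T x) c"
    using SuspO_ess_surj[OF d(7)] .
  then obtain s t where s: "s \<in> Hom T (SuspO T x) c" "t \<in> Hom T c (SuspO T x)"
    "t \<cdot> s = Ident T (SuspO T x)" "s \<cdot> t = Ident T c"
    by (blast elim: isomorphicE)
  have ls: "l \<cdot> s \<in> Hom T (SuspO T x) (SuspO T y)" and tk: "t \<cdot> k \<in> Hom T z (SuspO T x)"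
    using Comp_in_Hom d s by blast+
  \<comment> \<open>The sign cancels the one that \<open>TR2\<close> introduces.\<close>
  obtain f where f: "f \<in> Hom T x y" "SuspA T f = Neg T (l \<cdot> s)"
    using autoequivalence_full[OF Susp_autoequivalence x(1) d(5) Neg_in_Hom[OF ls ls]] by blast
  have "(g, t \<cdot> k, l \<cdot> s) \<in> Tri T"
  proof (rule TR1_iso[OF d(4)])
    show "candidate_triangle T g (t \<cdot> k) (l \<cdot> s)"
      unfolding candidate_triangle_def using d tk ls by blast
    have "(l \<cdot> s) \<cdot> t = l"
      using Comp_assoc[OF s(2,1) d(3)] s(4) Comp_Ident_right[OF d(3)] by simp
    then show "triangle_morphism T (g, k, l) (g, t \<cdot> k, l \<cdot> s) (Ident T y) (Ident T z) t"
      unfolding triangle_morphism_def using d s by (simp add: Hom_def SuspA_Ident)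
    show "is_iso T t"
      using isoI[OF s(2) s(1)] s by blast
    show "is_iso T (Ident T y)" "is_iso T (Ident T z)"
      using d is_iso_Ident by blast+
  qed
  then have "dist_tri x y z f g (t \<cdot> k)"
    using rotate_back[OF f(1) assms tk] f(2) Neg_Neg[OF ls ls] by simp
  then show ?thesis using that by blast
qed

text \<open>Both arrows at \<open>z\<close> vanish, because each becomes zero after composition with
  an isomorphism. As \<open>h = 0\<close>, the identity of \<open>z\<close> factors through
  \<open>g\<close>, which is zero.\<close>

lemma cone_iso_zero:
  assumes "dist_tri x y z f g h" "is_iso T f"
  shows "zero_object T z"
proof -
  note d = dist_triD[OF assms(1)]
  obtain f' where f': "f' \<in> Hom T y x" "f' \<cdot> f = Ident T x" "f \<cdot> f' = Ident T y"
    using isoE assms(2) d(1) by metis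
  have "SuspA T f' \<cdot> (SuspA T f \<cdot> h) = (SuspA T f' \<cdot> SuspA T f) \<cdot> h"
    using Comp_assoc[OF d(3) SuspA_in_Hom[OF d(1)] SuspA_in_Hom[OF f'(1)]] by simp
  also have "\<dots> = h"
    using SuspA_Comp[OF d(1) f'(1)] f'(2) SuspA_Ident d Comp_Ident_left[OF d(3)] by simp
  finally have "h = Zero T z (SuspO T x)"
    using dist_tri_comp'(2)[OF assms(1)] Comp_Zero_right[OF SuspA_in_Hom[OF f'(1)] d(7)] by simp
  then have "h \<cdot> Ident T z = Zero T z (SuspO T x)"
    using Comp_Ident_right d(3) by simp
  then obtain t where t: "t \<in> Hom T z y" "Ident T z = g \<cdot> t"
    using dist_tri_lift[OF rotate[OF assms(1)] Ident_in_Hom[OF d(7)]] by blast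
  have "g = (g \<cdot> f) \<cdot> f'"
    using Comp_assoc[OF f'(1) d(1,2)] f'(3) Comp_Ident_right[OF d(2)] by simp
  then have "g = Zero T y z"
    using dist_tri_comp[OF assms(1)] Comp_Zero_left[OF f'(1) d(7)] by simp
  then show ?thesis
    using t Comp_Zero_left d by (simp add: zero_object_iff)
qed

text \<open>The complement is the cone of \<open>i\<close>. Its connecting map vanishes because
  \<open>SuspA T i\<close> is a split monomorphism, so the projection onto the cone has a
  section.\<close>

lemma retract_direct_summand:
  assumes "i \<in> Hom T x b" "p \<in> Hom T b x" "p \<cdot> i = Ident T x"
  shows "direct_summand T x b"
proof -
  obtain y q h where t: "dist_tri x b y i q h"
    using cone_exists[OF assms(1)] .
  note d = dist_triD[OF t]
  note si = SuspA_in_Hom[OF assms(1)] and sp = SuspA_in_Hom[OF assms(2)]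
  have "h = (SuspA T p \<cdot> SuspA T i) \<cdot> h"
    using SuspA_Comp[OF assms(1,2)] assms(3) SuspA_Ident[OF d(5)] Comp_Ident_left[OF d(3)] by simp
  also have "\<dots> = Zero T y (SuspO T x)"
    using Comp_assoc[OF d(3) si sp] dist_tri_comp'(2)[OF t] Comp_Zero_right[OF sp d(7)] by simp
  finally have "h \<cdot> Ident T y = Zero T y (SuspO T x)"
    using Comp_Ident_right d(3) by simp
  then obtain j where j: "j \<in> Hom T y b" "Ident T y = q \<cdot> j"
    using dist_tri_lift[OF rotate[OF t] Ident_in_Hom[OF d(7)]] by blast
  have jq: "j \<cdot> q \<in> Hom T b b" and b1: "Ident T b \<in> Hom T b b"
    using Comp_in_Hom d j Ident_in_Hom by blast+
  \<comment> \<open>This \<open>e\<close> is the identity minus \<open>j \<cdot> q\<close>, the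
    projection onto the summand \<open>x\<close>.\<close>
  obtain e where e: "e \<in> Hom T b b" "Ident T b = Add T (j \<cdot> q) e"
    using difference_exists[OF b1 jq] by blast
  have qjq: "q \<cdot> (j \<cdot> q) = q"
    using Comp_assoc[OF d(2) j(1) d(2)] j(2) Comp_Ident_left[OF d(2)] by simp
  have "q = Add T q (q \<cdot> e)"
    using Comp_Add_right[OF jq e(1) d(2)] e(2) qjq Comp_Ident_right[OF d(2)] by simp
  then have "q \<cdot> e = Zero T b y"
    using Add_cancel[OF d(2) Comp_in_Hom[OF e(1) d(2)]] by simp
  \<comment> \<open>The given retraction \<open>p\<close> need not vanish on \<open>j\<close>; the
    biproduct uses \<open>p'\<close> in its place.\<close>
  then obtain p' where p': "p' \<in> Hom T b x" "e = i \<cdot> p'"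
    using dist_tri_lift[OF t e(1)] by blast
  have mono: "f = f'" if "f \<in> Hom T w x" "f' \<in> Hom T w x" "i \<cdot> f = i \<cdot> f'" for f f' w
  proof -
    have "(p \<cdot> i) \<cdot> f = (p \<cdot> i) \<cdot> f'"
      using Comp_assoc[OF that(1) assms(1,2)] Comp_assoc[OF that(2) assms(1,2)] that(3) by simp
    then show ?thesis using assms(3) that Comp_Ident_left by simp
  qed
  have qi: "q \<cdot> i = Zero T x y"
    using dist_tri_comp[OF t] .
  have jqi: "(j \<cdot> q) \<cdot> i = Zero T x b" "(j \<cdot> q) \<cdot> j = j"
    using Comp_assoc[OF d(1,2) j(1)] qi Comp_Zero_right[OF j(1) d(5)]
      Comp_assoc[OF j(1) d(2) j(1)] j(2) Comp_Ident_right[OF j(1)] by simp_all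
  have ei: "e \<cdot> i \<in> Hom T x b" and ej: "e \<cdot> j \<in> Hom T y b"
    using Comp_in_Hom e j d by blast+
  have "i = Add T (Zero T x b) (e \<cdot> i)"
    using Comp_Add_left[OF d(1) jq e(1)] e(2) jqi Comp_Ident_left[OF d(1)] by simp
  then have "e \<cdot> i = i"
    using Add_Zero_left[OF ei ei] by simp
  then have "i \<cdot> (p' \<cdot> i) = i \<cdot> Ident T x"
    using p' Comp_assoc[OF d(1) p'(1) d(1)] Comp_Ident_right[OF d(1)] by simp
  then have pi: "p' \<cdot> i = Ident T x"
    using mono Comp_in_Hom[OF d(1) p'(1)] Ident_in_Hom[OF d(5)] by blast
  have "j = Add T j (e \<cdot> j)"
    using Comp_Add_left[OF j(1) jq e(1)] e(2) jqi Comp_Ident_left[OF j(1)] by simp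
  then have "e \<cdot> j = Zero T y b"
    using Add_cancel[OF j(1) ej] by simp
  then have "i \<cdot> (p' \<cdot> j) = i \<cdot> Zero T y x"
    using p' Comp_assoc[OF j(1) p'(1) d(1)] Comp_Zero_right[OF d(1,7)] by simp
  then have pj: "p' \<cdot> j = Zero T y x"
    using mono Comp_in_Hom[OF j(1) p'(1)] Zero_in_Hom[OF d(7,5)] by blast
  have "Add T (i \<cdot> p') (j \<cdot> q) = Ident T b"
    using e p'(2) Add_commute[OF e(1) jq] by simp
  then have "is_biproduct T x y b"
    unfolding is_biproduct_def using d j p' pi pj qi by metis
  then show ?thesis by (auto simp: direct_summand_def)
qed

section \<open>Triangulated and thick subcategories\<close>

lemma triangulated_subcategoryD:
  assumes "triangulated_subcategory T S"
  shows "x \<in> S \<Longrightarrow> x \<in> Obj T"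
    and "zero_object T x \<Longrightarrow> x \<in> S"
    and "x \<in> S \<Longrightarrow> isomorphic T x y \<Longrightarrow> y \<in> S"
    and "x \<in> S \<Longrightarrow> y \<in> S \<Longrightarrow> is_biproduct T x y b \<Longrightarrow> b \<in> S"
    and "x \<in> Obj T \<Longrightarrow> SuspO T x \<in> S \<longleftrightarrow> x \<in> S"
    and "dist_tri x y z f g h \<Longrightarrow> x \<in> S \<Longrightarrow> y \<in> S \<Longrightarrow> z \<in> S"
proof -
  show "x \<in> S \<Longrightarrow> x \<in> Obj T"
    "zero_object T x \<Longrightarrow> x \<in> S"
    "x \<in> S \<Longrightarrow> isomorphic T x y \<Longrightarrow> y \<in> S"
    "x \<in> S \<Longrightarrow> y \<in> S \<Longrightarrow> is_biproduct T x y b \<Longrightarrow> b \<in> S"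
    "x \<in> Obj T \<Longrightarrow> SuspO T x \<in> S \<longleftrightarrow> x \<in> S"
    using assms unfolding triangulated_subcategory_def by blast+
  have "\<forall>(f, g, h) \<in> Tri T. Dom T f \<in> S \<longrightarrow> Cod T f \<in> S \<longrightarrow> Cod T g \<in> S"
    using assms unfolding triangulated_subcategory_def by blast
  then show "dist_tri x y z f g h \<Longrightarrow> x \<in> S \<Longrightarrow> y \<in> S \<Longrightarrow> z \<in> S"
    unfolding dist_tri_def Hom_def by auto
qed

lemma triangulated_subcategory_middle:
  assumes S: "triangulated_subcategory T S" and t: "dist_tri x y z f g h" and "x \<in> S" "z \<in> S"
  shows "y \<in> S"
  using triangulated_subcategoryD(6)[OF S rotate[OF rotate[OF t]]]
    triangulated_subcategoryD(5)[OF S] dist_triD[OF t] assms(3,4) by blast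

text \<open>The octahedral axiom places \<open>c\<close> in the middle of a triangle with outer
  vertices \<open>a\<close> and \<open>b\<close>.\<close>

lemma triangulated_subcategory_cone_Comp:
  assumes S: "triangulated_subcategory T S"
    and f: "dist_tri x y a f f' f''" and g: "dist_tri y z b g g' g''"
    and gf: "dist_tri x z c (g \<cdot> f) k' k''" and "a \<in> S" "b \<in> S"
  shows "c \<in> S"
proof -
  note df = dist_triD[OF f] and dg = dist_triD[OF g] and dgf = dist_triD[OF gf]
  have C: "Cod T f' = a" "Cod T g' = b" "Cod T k' = c"
    using df dg dgf by (simp_all add: Hom_def)
  have "\<exists>u \<in> Hom T (Cod T f') (Cod T k'). \<exists>v \<in> Hom T (Cod T k') (Cod T g').
                u \<cdot> f' = k' \<cdot> g \<and> k'' \<cdot> u = f'' \<and>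
                v \<cdot> k' = g' \<and> g'' \<cdot> v = SuspA T f \<cdot> k'' \<and>
                (u, v, SuspA T f' \<cdot> g'') \<in> Tri T"
    using TR4[OF df(1) dg(1) df(4) dg(4) dgf(4)] .
  then obtain u v where uv: "u \<in> Hom T a c" "v \<in> Hom T c b" "(u, v, SuspA T f' \<cdot> g'') \<in> Tri T"
    unfolding C by blast
  have "dist_tri a c b u v (SuspA T f' \<cdot> g'')"
    using Tri_dist_tri[OF uv(3)] uv by (simp add: Hom_def)
  then show ?thesis
    using triangulated_subcategory_middle[OF S] assms by blast
qed

lemma thick_subcategoryD:
  assumes "thick_subcategory T S"
  shows "triangulated_subcategory T S"
    and "b \<in> S \<Longrightarrow> direct_summand T x b \<Longrightarrow> x \<in> S"
  using assms unfolding thick_subcategory_def by blast+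

lemma thick_subcategoryI:
  assumes obj: "\<And>x. x \<in> S \<Longrightarrow> x \<in> Obj T"
    and zero: "\<And>x. zero_object T x \<Longrightarrow> x \<in> S"
    and iso: "\<And>x y. x \<in> S \<Longrightarrow> isomorphic T x y \<Longrightarrow> y \<in> S"
    and sum: "\<And>x y b. x \<in> S \<Longrightarrow> y \<in> S \<Longrightarrow> is_biproduct T x y b \<Longrightarrow> b \<in> S"
    and susp: "\<And>x. x \<in> S \<Longrightarrow> SuspO T x \<in> S"
    and desusp: "\<And>x. x \<in> Obj T \<Longrightarrow> SuspO T x \<in> S \<Longrightarrow> x \<in> S"
    and cone: "\<And>x y z f g h. dist_tri x y z f g h \<Longrightarrow> x \<in> S \<Longrightarrow> y \<in> S \<Longrightarrow> z \<in> S"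
    and summand: "\<And>x b. b \<in> S \<Longrightarrow> direct_summand T x b \<Longrightarrow> x \<in> S"
  shows "thick_subcategory T S"
proof -
  have "\<forall>(f, g, h) \<in> Tri T. Dom T f \<in> S \<longrightarrow> Cod T f \<in> S \<longrightarrow> Cod T g \<in> S"
    using cone Tri_dist_tri by fast
  then show ?thesis
    unfolding thick_subcategory_def triangulated_subcategory_def
    by (intro conjI)
      (use obj in blast, use zero in blast, use iso in blast, use sum in blast,
        use susp desusp in blast, assumption, use summand in blast)
qed

lemma thick_subcategory_retract:
  assumes "thick_subcategory T S" "b \<in> S" "i \<in> Hom T x b" "p \<in> Hom T b x" "p \<cdot> i = Ident T x"
  shows "x \<in> S"
  using assms retract_direct_summand unfolding thick_subcategory_def by blast

lemma thick_subcategory_zero_objects: "thick_subcategory T {z. zero_object T z}"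
proof -
  have susp: "zero_object T x" if x: "x \<in> Obj T" and "zero_object T (SuspO T x)" for x
  proof -
    have "SuspA T (Ident T x) = SuspA T (Zero T x x)"
      using that SuspA_Ident[OF x] additive_functor_Zero[OF Susp_additive x x]
      by (simp add: zero_object_iff)
    then show ?thesis
      using autoequivalence_faithful[OF Susp_autoequivalence Ident_in_Hom[OF x] Zero_in_Hom[OF x x]] x
      by (simp add: zero_object_iff)
  qed
  have cone: "zero_object T z" if t: "dist_tri x y z f g h" and z: "zero_object T x" "zero_object T y"
    for x y z f g h
  proof (rule cone_iso_zero[OF t])
    have f: "f = Zero T x y"
      using dist_triD[OF t] z zero_object_Hom by blast
    show "is_iso T f"
      unfolding f
    proof (rule isoI[of _ x y "Zero T y x"])
      show "Zero T x y \<in> Hom T x y" "Zero T y x \<in> Hom T y x"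
        "Zero T y x \<cdot> Zero T x y = Ident T x" "Zero T x y \<cdot> Zero T y x = Ident T y"
        using z by (simp_all add: zero_object_iff Hom_def)
    qed
  qed
  have summand: "zero_object T x" if "zero_object T b" "direct_summand T x b" for x b
  proof -
    obtain y where "is_biproduct T x y b"
      using \<open>direct_summand T x b\<close> by (auto simp: direct_summand_def)
    then obtain i p where "i \<in> Hom T x b" "p \<in> Hom T b x" "p \<cdot> i = Ident T x"
      by (rule biproductE) (rule that)
    then show ?thesis using zero_object_retract \<open>zero_object T b\<close> by blast
  qed
  show ?thesis
  proof (rule thick_subcategoryI; unfold mem_Collect_eq)
    show "x \<in> Obj T" if "zero_object T x" for x
      using that by (simp add: zero_object_iff)
    show "zero_object T y" if "zero_object T x" "isomorphic T x y" for x y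
      using zero_object_isomorphic that by blast
    show "zero_object T b" if "zero_object T x" "zero_object T y" "is_biproduct T x y b" for x y b
      using zero_object_biproduct that by blast
    show "zero_object T (SuspO T x)" if "zero_object T x" for x
      using zero_object_SuspO that by blast
    show "zero_object T x" if "x \<in> Obj T" "zero_object T (SuspO T x)" for x
      using susp that by blast
    show "zero_object T z" if "dist_tri x y z f g h" "zero_object T x" "zero_object T y" for x y z f g h
      using cone that by blast
    show "zero_object T x" if "zero_object T b" "direct_summand T x b" for x b
      using summand that by blast
  qed
qed

end

text \<open>The object \<open>x\<close> is a retract of the direct sum of \<open>c\<close> and
  \<open>k\<close>, via the column with entries \<open>u\<close>, \<open>q\<close> and the row with
  entries \<open>r\<close>, \<open>w\<close>.\<close>

lemma (in triangulated_category) thick_subcategory_sum_of_factors: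
  assumes P: "thick_subcategory T P" and "c \<in> P" "k \<in> P"
    and u: "u \<in> Hom T x c" and r: "r \<in> Hom T c x" and q: "q \<in> Hom T x k" and w: "w \<in> Hom T k x"
    and sum: "Add T (r \<cdot> u) (w \<cdot> q) = Ident T x"
  shows "x \<in> P"
proof -
  note tP = triangulated_subcategoryD[OF thick_subcategoryD(1)[OF P]]
  obtain d where d: "is_biproduct T c k d"
    using biproduct_exists tP(1) assms(2,3) by blast
  then obtain i j p s where h: "i \<in> Hom T c d" "j \<in> Hom T k d" "p \<in> Hom T d c" "s \<in> Hom T d k"
    and e: "p \<cdot> i = Ident T c" "s \<cdot> j = Ident T k" "s \<cdot> i = Zero T c k" "p \<cdot> j = Zero T k c"
    by (rule biproductE) (rule that)
  have o: "x \<in> Obj T" "c \<in> Obj T" "k \<in> Obj T"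
    using u q Hom_Obj by blast+
  have iu: "i \<cdot> u \<in> Hom T x d" and jq: "j \<cdot> q \<in> Hom T x d"
    and rp: "r \<cdot> p \<in> Hom T d x" and ws: "w \<cdot> s \<in> Hom T d x"
    using Comp_in_Hom h u r q w by blast+
  define l where "l = Add T (i \<cdot> u) (j \<cdot> q)"
  have l: "l \<in> Hom T x d"
    unfolding l_def using Add_in_Hom[OF iu jq] .
  have "p \<cdot> (i \<cdot> u) = u" "p \<cdot> (j \<cdot> q) = Zero T x c" "s \<cdot> (i \<cdot> u) = Zero T x k" "s \<cdot> (j \<cdot> q) = q"
    using Comp_assoc[OF u h(1,3)] Comp_assoc[OF q h(2,3)] Comp_assoc[OF u h(1,4)]
      Comp_assoc[OF q h(2,4)] e Comp_Ident_left[OF u] Comp_Ident_left[OF q]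
      Comp_Zero_left[OF u o(3)] Comp_Zero_left[OF q o(2)] by simp_all
  then have "p \<cdot> l = u" "s \<cdot> l = q"
    unfolding l_def using Comp_Add_right[OF iu jq h(3)] Comp_Add_right[OF iu jq h(4)]
      Add_Zero_right[OF u u] Add_Zero_left[OF q q] by simp_all
  then have "Add T (r \<cdot> p) (w \<cdot> s) \<cdot> l = Ident T x"
    using Comp_Add_left[OF l rp ws] Comp_assoc[OF l h(3) r] Comp_assoc[OF l h(4) w] sum by simp
  then show ?thesis
    using thick_subcategory_retract[OF P _ l Add_in_Hom[OF rp ws]] tP(4)[OF assms(2,3) d] by blast
qed


section \<open>Exact functors and levels of generation\<close>

context triangulated_category
begin

lemma functor_isomorphic:
  assumes F: "is_functor T T F A" and "isomorphic T x y"
  shows "isomorphic T (F x) (F y)"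
proof -
  obtain f g where f: "f \<in> Hom T x y" "g \<in> Hom T y x" "g \<cdot> f = Ident T x" "f \<cdot> g = Ident T y"
    using assms(2) by (rule isomorphicE)
  show ?thesis
  proof (rule isomorphicI)
    show "A f \<in> Hom T (F x) (F y)" "A g \<in> Hom T (F y) (F x)"
      using functorD(3)[OF F] f by blast+
    show "A g \<cdot> A f = Ident T (F x)" "A f \<cdot> A g = Ident T (F y)"
      using functorD(4)[OF F f(1,2)] functorD(4)[OF F f(2,1)] functorD(2)[OF F] f Hom_Obj[OF f(1)]
      by simp_all
  qed
qed

lemma additive_functor_biproduct:
  assumes F: "additive_functor T T F A" and b: "is_biproduct T x y b"
  shows "is_biproduct T (F x) (F y) (F b)"
proof -
  have funct: "is_functor T T F A"
    and add: "\<And>x y f g. f \<in> Hom T x y \<Longrightarrow> g \<in> Hom T x y \<Longrightarrow> A (Add T f g) = Add T (A f) (A g)"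
    using F unfolding additive_functor_def by blast+
  obtain i j p q where h: "i \<in> Hom T x b" "j \<in> Hom T y b" "p \<in> Hom T b x" "q \<in> Hom T b y"
    and e: "p \<cdot> i = Ident T x" "q \<cdot> j = Ident T y"
    "q \<cdot> i = Zero T x y" "p \<cdot> j = Zero T y x" "Add T (i \<cdot> p) (j \<cdot> q) = Ident T b"
    using b by (rule biproductE)
  have o: "x \<in> Obj T" "y \<in> Obj T" "b \<in> Obj T"
    using h Hom_Obj by blast+
  have "A p \<cdot> A i = Ident T (F x)" "A q \<cdot> A j = Ident T (F y)"
    "A q \<cdot> A i = Zero T (F x) (F y)" "A p \<cdot> A j = Zero T (F y) (F x)"
    using functorD(4)[OF funct h(1,3)] functorD(4)[OF funct h(2,4)] functorD(4)[OF funct h(1,4)]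
      functorD(4)[OF funct h(2,3)] e functorD(2)[OF funct] additive_functor_Zero[OF F] o by simp_all
  moreover have "Add T (A i \<cdot> A p) (A j \<cdot> A q) = Ident T (F b)"
    using add[OF Comp_in_Hom[OF h(3,1)] Comp_in_Hom[OF h(4,2)]] e(5) functorD(2)[OF funct o(3)]
      functorD(4)[OF funct h(3,1)] functorD(4)[OF funct h(4,2)] by simp
  moreover have "A i \<in> Hom T (F x) (F b)" "A j \<in> Hom T (F y) (F b)"
    "A p \<in> Hom T (F b) (F x)" "A q \<in> Hom T (F b) (F y)"
    using functorD(3)[OF funct] h by blast+
  ultimately show ?thesis
    unfolding is_biproduct_def using functorD(1)[OF funct] o by blast
qed

lemma additive_functor_zero_object:
  assumes F: "additive_functor T T F A" and "zero_object T z"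
  shows "zero_object T (F z)"
proof -
  have z: "z \<in> Obj T" "Ident T z = Zero T z z"
    using assms by (simp_all add: zero_object_iff)
  have "is_functor T T F A"
    using F unfolding additive_functor_def by blast
  then show ?thesis
    using functorD(1,2)[of T F A z] additive_functor_Zero[OF F z(1) z(1)] z
    by (simp add: zero_object_iff)
qed

text \<open>The comparison isomorphism between \<open>F \<circ> SuspO T\<close> and
  \<open>SuspO T \<circ> F\<close> is hidden in an existential. These are its consequences in a form
  that no longer mentions it; in particular the third arrow of an image triangle stays
  anonymous.\<close>

lemma
  assumes "exact_functor T T F A"
  shows exact_functor_additive: "additive_functor T T F A"
    and exact_functor_functor: "is_functor T T F A"
    and exact_functor_SuspO: "x \<in> Obj T \<Longrightarrow> isomorphic T (F (SuspO T x)) (SuspO T (F x))"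
    and exact_functor_SuspA_Zero: "\<lbrakk>m \<in> Hom T x y; A m = Zero T (F x) (F y)\<rbrakk>
          \<Longrightarrow> A (SuspA T m) = Zero T (F (SuspO T x)) (F (SuspO T y))"
    and exact_functor_dist_tri: "dist_tri x y z f g h \<Longrightarrow> \<exists>k. dist_tri (F x) (F y) (F z) (A f) (A g) k"
proof -
  obtain \<phi> where add: "additive_functor T T F A"
    and nat: "natural_iso T T (F \<circ> SuspO T) (A \<circ> SuspA T) (SuspO T \<circ> F) (SuspA T \<circ> A) \<phi>"
    and tri: "\<forall>(f, g, h) \<in> Tri T. (A f, A g, \<phi> (Dom T f) \<cdot> A h) \<in> Tri T"
    using assms unfolding exact_functor_def by blast
  show "additive_functor T T F A" by fact
  then show funct: "is_functor T T F A" unfolding additive_functor_def by blast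
  show "isomorphic T (F (SuspO T x)) (SuspO T (F x))" if "x \<in> Obj T"
    using natural_isoD(1,2)[OF nat that] by (auto simp: isomorphic_def)
  show "A (SuspA T m) = Zero T (F (SuspO T x)) (F (SuspO T y))"
    if m: "m \<in> Hom T x y" "A m = Zero T (F x) (F y)"
  proof -
    have o: "x \<in> Obj T" "y \<in> Obj T" "F x \<in> Obj T" "F y \<in> Obj T"
      "F (SuspO T x) \<in> Obj T" "F (SuspO T y) \<in> Obj T" "SuspO T (F y) \<in> Obj T"
      using m Hom_Obj functorD(1)[OF funct] SuspO_in_Obj by blast+
    have p: "\<phi> x \<in> Hom T (F (SuspO T x)) (SuspO T (F x))" "\<phi> y \<in> Hom T (F (SuspO T y)) (SuspO T (F y))"
      "is_iso T (\<phi> y)"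
      using natural_isoD(1,2)[OF nat] o by auto
    have Am: "A (SuspA T m) \<in> Hom T (F (SuspO T x)) (F (SuspO T y))"
      using functorD(3)[OF funct SuspA_in_Hom[OF m(1)]] .
    have "\<phi> y \<cdot> A (SuspA T m) = SuspA T (A m) \<cdot> \<phi> x"
      using natural_isoD(3)[OF nat m(1)] by simp
    also have "\<dots> = Zero T (F (SuspO T x)) (SuspO T (F y))"
      using m(2) additive_functor_Zero[OF Susp_additive o(3,4)] Comp_Zero_left[OF p(1) o(7)] by simp
    also have "\<dots> = \<phi> y \<cdot> Zero T (F (SuspO T x)) (F (SuspO T y))"
      using Comp_Zero_right[OF p(2) o(5)] by simp
    finally show ?thesis
      by (rule iso_mono[OF p(3), rotated 2]) (use p Am o in \<open>simp_all add: Hom_def\<close>)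
  qed
  show "\<exists>k. dist_tri (F x) (F y) (F z) (A f) (A g) k" if t: "dist_tri x y z f g h"
  proof -
    note d = dist_triD[OF t]
    have "(A f, A g, \<phi> (Dom T f) \<cdot> A h) \<in> Tri T"
      using tri d(4) by blast
    moreover have "A f \<in> Hom T (F x) (F y)" "A g \<in> Hom T (F y) (F z)"
      using functorD(3)[OF funct] d by blast+
    ultimately show ?thesis
      using Tri_dist_tri[of "A f" "A g"] by (auto simp: Hom_def)
  qed
qed

lemma thick_subcategory_preimage:
  assumes F: "exact_functor T T F A" and S: "thick_subcategory T S"
  shows "thick_subcategory T {x \<in> Obj T. F x \<in> S}"
proof -
  note tS = triangulated_subcategoryD[OF thick_subcategoryD(1)[OF S]]
  note add = exact_functor_additive[OF F] and funct = exact_functor_functor[OF F]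
  show ?thesis
  proof (rule thick_subcategoryI; unfold mem_Collect_eq)
    show "x \<in> Obj T \<and> F x \<in> S" if "zero_object T x" for x
      using that tS(2) additive_functor_zero_object[OF add that] by (simp add: zero_object_def)
    show "y \<in> Obj T \<and> F y \<in> S" if "x \<in> Obj T \<and> F x \<in> S" "isomorphic T x y" for x y
      using that(1) tS(3) functor_isomorphic[OF funct that(2)] that(2) Hom_Obj
      unfolding isomorphic_def by blast
    show "b \<in> Obj T \<and> F b \<in> S"
      if "x \<in> Obj T \<and> F x \<in> S" "y \<in> Obj T \<and> F y \<in> S" "is_biproduct T x y b" for x y b
      using that(1,2) tS(4) additive_functor_biproduct[OF add that(3)] that(3)
      unfolding is_biproduct_def[of _ x] by blast
    show "SuspO T x \<in> Obj T \<and> F (SuspO T x) \<in> S" if x: "x \<in> Obj T \<and> F x \<in> S" for x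
    proof -
      have "F x \<in> Obj T" "SuspO T (F x) \<in> S"
        using x tS(1,5) by blast+
      then show ?thesis
        using tS(3) isomorphic_sym[OF exact_functor_SuspO[OF F]] x SuspO_in_Obj by blast
    qed
    show "x \<in> Obj T \<and> F x \<in> S" if x: "x \<in> Obj T" "SuspO T x \<in> Obj T \<and> F (SuspO T x) \<in> S" for x
    proof -
      have "SuspO T (F x) \<in> S"
        using tS(3) exact_functor_SuspO[OF F x(1)] x by blast
      then show ?thesis
        using tS(5) functorD(1)[OF funct x(1)] x by blast
    qed
    show "z \<in> Obj T \<and> F z \<in> S"
      if "dist_tri x y z f g h" "x \<in> Obj T \<and> F x \<in> S" "y \<in> Obj T \<and> F y \<in> S" for x y z f g h
      using exact_functor_dist_tri[OF F that(1)] that tS(6) dist_triD(7)[OF that(1)] by blast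
    show "x \<in> Obj T \<and> F x \<in> S" if "b \<in> Obj T \<and> F b \<in> S" "direct_summand T x b" for x b
    proof -
      obtain y where b: "is_biproduct T x y b"
        using \<open>direct_summand T x b\<close> by (auto simp: direct_summand_def)
      then have "direct_summand T (F x) (F b)" "x \<in> Obj T"
        using additive_functor_biproduct[OF add b] b
        unfolding direct_summand_def is_biproduct_def[of _ x] by blast+
      then show ?thesis
        using thick_subcategoryD(2)[OF S] that by blast
    qed
  qed blast
qed

section \<open>Levels of generation\<close>

lemma SuspO_funpow_in_Obj: "x \<in> Obj T \<Longrightarrow> (SuspO T ^^ n) x \<in> Obj T"
  by (induction n) (auto intro: SuspO_in_Obj)

text \<open>No closure under cones is asked of \<open>S\<close>, so that the lemma serves
  annihilators of maps, which need not be closed under extensions, as well as thick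
  subcategories.\<close>

lemma gen_level_one_subset:
  assumes zero: "\<And>x. zero_object T x \<Longrightarrow> x \<in> S"
    and iso: "\<And>x y. x \<in> S \<Longrightarrow> isomorphic T x y \<Longrightarrow> y \<in> S"
    and sum: "\<And>x y b. x \<in> S \<Longrightarrow> y \<in> S \<Longrightarrow> is_biproduct T x y b \<Longrightarrow> b \<in> S"
    and susp: "\<And>x. x \<in> S \<Longrightarrow> SuspO T x \<in> S"
    and desusp: "\<And>x. x \<in> Obj T \<Longrightarrow> SuspO T x \<in> S \<Longrightarrow> x \<in> S"
    and summand: "\<And>x b. b \<in> S \<Longrightarrow> direct_summand T x b \<Longrightarrow> x \<in> S"
    and g: "g \<in> S"
  shows "gen_level T g 1 \<subseteq> S"
proof -
  have up: "(SuspO T ^^ n) x \<in> S" if "x \<in> S" for n x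
    using that by (induction n) (auto intro: susp)
  have down: "x \<in> S" if "x \<in> Obj T" "(SuspO T ^^ n) x \<in> S" for n x
    using that by (induction n) (auto intro: desusp SuspO_funpow_in_Obj)
  have susp': "y \<in> S" if "is_suspension T i g y" for i y
  proof (cases "0 \<le> i")
    case True
    then have "isomorphic T y ((SuspO T ^^ nat i) g)"
      using that unfolding is_suspension_def by simp
    then show ?thesis
      using up[OF g] iso isomorphic_sym by blast
  next
    case False
    then have "isomorphic T ((SuspO T ^^ nat (- i)) y) g" "y \<in> Obj T"
      using that unfolding is_suspension_def by auto
    then show ?thesis
      using down[of y "nat (- i)"] iso[OF g] isomorphic_sym by blast
  qed
  have "d \<in> S" if "d \<in> finite_sums_of_suspensions T g" for d
    using that by induction (use zero sum susp' in blast)+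
  then show ?thesis
    using summand by auto
qed

lemma gen_level_subset_thick:
  assumes S: "thick_subcategory T S" and g: "g \<in> S"
  shows "gen_level T g n \<subseteq> S"
proof -
  note tS = triangulated_subcategoryD[OF thick_subcategoryD(1)[OF S]]
  have one: "gen_level T g 1 \<subseteq> S"
    using tS(1-5) thick_subcategoryD(2)[OF S] g by (intro gen_level_one_subset) blast+
  show ?thesis
  proof (induction n)
    case (Suc n)
    show ?case
    proof (cases n)
      case (Suc m)
      show ?thesis
      proof
        fix b assume "b \<in> gen_level T g (Suc n)"
        then obtain b'' d f k h where b: "is_biproduct T b b'' d" "(f, k, h) \<in> Tri T" "Cod T f = d"
          "Dom T f \<in> gen_level T g n" "Cod T k \<in> gen_level T g 1"
          unfolding Suc gen_level.simps(3) One_nat_def by blast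
        then have "d \<in> S"
          using triangulated_subcategory_middle[OF thick_subcategoryD(1)[OF S] Tri_dist_tri[OF b(2)]]
            Suc.IH one b(3-5) by blast
        then show "b \<in> S"
          using thick_subcategoryD(2)[OF S] b(1) unfolding direct_summand_def by blast
      qed
    qed (use one in simp)
  qed simp
qed

section \<open>Generation inside a full subcategory and in the ambient category\<close>

lemma
  assumes "triangulated_subcategory T S"
  shows full_subcat_Obj: "Obj (full_subcat T S) = S"
    and full_subcat_Hom: "\<lbrakk>x \<in> S; y \<in> S\<rbrakk> \<Longrightarrow> Hom (full_subcat T S) x y = Hom T x y"
  using triangulated_subcategoryD(1)[OF assms]
  by (auto simp: full_subcat_def Let_def Hom_def)

lemma full_subcat_Hom_subset: "Hom (full_subcat T S) x y \<subseteq> Hom T x y"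
  by (auto simp: full_subcat_def Let_def Hom_def)

lemma full_subcat_simps:
  "Dom (full_subcat T S) = Dom T" "Cod (full_subcat T S) = Cod T"
  "Ident (full_subcat T S) = Ident T" "Comp (full_subcat T S) = Comp T"
  "Add (full_subcat T S) = Add T" "Zero (full_subcat T S) = Zero T"
  "SuspO (full_subcat T S) = SuspO T" "Tri (full_subcat T S) \<subseteq> Tri T"
  by (auto simp: full_subcat_def Let_def)

lemma full_subcat_isomorphic:
  assumes "isomorphic (full_subcat T S) x y"
  shows "isomorphic T x y"
proof -
  obtain f g where f: "f \<in> Hom (full_subcat T S) x y" "inverse_arrows (full_subcat T S) f g"
    using assms unfolding isomorphic_def is_iso_def by blast
  then have "f \<in> Hom T x y"
    using full_subcat_Hom_subset by blast
  moreover have "inverse_arrows T f g"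
    using f(2) full_subcat_Hom_subset[of S] calculation
    unfolding inverse_arrows_def full_subcat_simps by (auto simp: Hom_def)
  ultimately show ?thesis
    unfolding isomorphic_def is_iso_def by blast
qed

text \<open>Being zero is a property of the endomorphisms of \<open>z\<close> alone, and these are
  the same in a full subcategory.\<close>

lemma full_subcat_zero_object:
  assumes S: "triangulated_subcategory T S" and z: "zero_object (full_subcat T S) z"
  shows "zero_object T z"
proof -
  have zS: "z \<in> S" "\<exists>!f. f \<in> Hom (full_subcat T S) z z"
    using z unfolding zero_object_def full_subcat_Obj[OF S] by blast+
  then have "\<exists>!f. f \<in> Hom T z z" "z \<in> Obj T"
    using full_subcat_Hom[OF S] triangulated_subcategoryD(1)[OF S] by auto
  then show ?thesis
    using Ident_in_Hom Zero_in_Hom unfolding zero_object_iff by blast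
qed

lemma full_subcat_biproduct:
  assumes S: "triangulated_subcategory T S" and b: "is_biproduct (full_subcat T S) x y b"
  shows "is_biproduct T x y b"
proof -
  have "x \<in> S" "y \<in> S" "b \<in> S"
    using b unfolding is_biproduct_def full_subcat_Obj[OF S] by blast+
  then show ?thesis
    using b triangulated_subcategoryD(1)[OF S] unfolding is_biproduct_def full_subcat_simps
    by (simp add: full_subcat_Hom[OF S])
qed

lemma full_subcat_is_suspension:
  assumes S: "triangulated_subcategory T S" and i: "is_suspension (full_subcat T S) i x y"
  shows "is_suspension T i x y"
proof -
  have "x \<in> Obj T" "y \<in> Obj T"
    using i triangulated_subcategoryD(1)[OF S] unfolding is_suspension_def full_subcat_Obj[OF S] by blast+
  then show ?thesis
    using i full_subcat_isomorphic unfolding is_suspension_def full_subcat_simps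
    by (auto split: if_splits)
qed

text \<open>Strong generation of \<open>S\<close> refers to sums, summands and triangles inside
  \<open>S\<close>. All of them are also sums, summands and triangles of \<open>T\<close>, which
  allows arguing with levels of \<open>T\<close> from here on.\<close>

lemma full_subcat_gen_level:
  assumes S: "triangulated_subcategory T S"
  shows "gen_level (full_subcat T S) x n \<subseteq> gen_level T x n"
proof -
  have fin: "d \<in> finite_sums_of_suspensions T x" if "d \<in> finite_sums_of_suspensions (full_subcat T S) x" for d
    using that
  proof induction
    case (empty_sum z)
    then show ?case
      by (rule finite_sums_of_suspensions.empty_sum[OF full_subcat_zero_object[OF S]])
  next
    case (add_summand a i y b)
    show ?case
      by (rule finite_sums_of_suspensions.add_summand[OF add_summand.IH
            full_subcat_is_suspension[OF S add_summand.hyps(2)]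
            full_subcat_biproduct[OF S add_summand.hyps(3)]])
  qed
  have "direct_summand T b d" if "direct_summand (full_subcat T S) b d" for b d
    using that full_subcat_biproduct[OF S] unfolding direct_summand_def by blast
  then have one: "gen_level (full_subcat T S) x 1 \<subseteq> gen_level T x 1"
    using fin triangulated_subcategoryD(1)[OF S] by (auto simp: full_subcat_Obj[OF S])
  show ?thesis
  proof (induction n)
    case (Suc n)
    show ?case
    proof (cases n)
      case (Suc m)
      show ?thesis
      proof
        fix b assume "b \<in> gen_level (full_subcat T S) x (Suc n)"
        then have bS: "b \<in> S" and "\<exists>b'' d f g h. is_biproduct (full_subcat T S) b b'' d \<and>
            (f, g, h) \<in> Tri (full_subcat T S) \<and> Cod T f = d \<and>
            Dom T f \<in> gen_level (full_subcat T S) x n \<and> Cod T g \<in> gen_level (full_subcat T S) x 1"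
          unfolding Suc gen_level.simps(3) full_subcat_Obj[OF S] full_subcat_simps(1,2) One_nat_def by blast+
        then obtain b'' d f g h where "is_biproduct T b b'' d" "(f, g, h) \<in> Tri T" "Cod T f = d"
            "Dom T f \<in> gen_level T x n" "Cod T g \<in> gen_level T x 1"
          using full_subcat_biproduct[OF S] full_subcat_simps(8)[of S] Suc.IH one by blast
        moreover have "b \<in> Obj T"
          using bS triangulated_subcategoryD(1)[OF S] by blast
        ultimately show "b \<in> gen_level T x (Suc n)"
          unfolding Suc gen_level.simps(3) One_nat_def by blast
      qed
    qed (use one in simp)
  qed simp
qed

lemma strongly_generated_full_subcatE:
  assumes S: "triangulated_subcategory T S" and "strongly_generated (full_subcat T S)"
  obtains g n where "g \<in> S" "S \<subseteq> gen_level T g n"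
  using assms(2) full_subcat_gen_level[OF S] full_subcat_Obj[OF S]
  unfolding strongly_generated_def strong_generator_def by metis

end


section \<open>Tensor ideals and annihilators\<close>

context symmetric_monoidal_category
begin

lemma TensA_simps [simp]:
  assumes "f \<in> Arr T" "g \<in> Arr T"
  shows "f \<star> g \<in> Arr T" "Dom T (f \<star> g) = Dom T f \<boxtimes> Dom T g" "Cod T (f \<star> g) = Cod T f \<boxtimes> Cod T g"
  using TensA_in_Hom[of f "Dom T f" "Cod T f" g "Dom T g" "Cod T g"] assms
  by (simp_all add: Hom_def)

lemma
  assumes "f \<in> Hom T x x'" "g \<in> Hom T y y'"
  shows interchange: "f \<star> g = (f \<star> Ident T y') \<cdot> (Ident T x \<star> g)"
    and interchange': "f \<star> g = (Ident T x' \<star> g) \<cdot> (f \<star> Ident T y)"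
proof -
  have "x \<in> Obj T" "x' \<in> Obj T" "y \<in> Obj T" "y' \<in> Obj T"
    using assms Hom_Obj by blast+
  then show "f \<star> g = (f \<star> Ident T y') \<cdot> (Ident T x \<star> g)"
    "f \<star> g = (Ident T x' \<star> g) \<cdot> (f \<star> Ident T y)"
    using TensA_Comp[OF Ident_in_Hom assms(1) assms(2) Ident_in_Hom]
      TensA_Comp[OF assms(1) Ident_in_Hom Ident_in_Hom assms(2)]
      Comp_Ident_left Comp_Ident_right assms by metis+
qed

lemma
  assumes "x \<in> Obj T" "y \<in> Obj T"
  shows TensO_commute: "isomorphic T (x \<boxtimes> y) (y \<boxtimes> x)"
    and TensO_unit: "isomorphic T (Unit T \<boxtimes> x) x" "isomorphic T (x \<boxtimes> Unit T) x"
    and TensO_assoc: "z \<in> Obj T \<Longrightarrow> isomorphic T ((x \<boxtimes> y) \<boxtimes> z) (x \<boxtimes> (y \<boxtimes> z))"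
proof -
  show "isomorphic T (x \<boxtimes> y) (y \<boxtimes> x)"
    using isomorphicI[OF Braid_in_Hom[OF assms] Braid_in_Hom[OF assms(2,1)]] Braid_symmetric assms
    by blast
  show "isomorphic T (Unit T \<boxtimes> x) x"
    unfolding isomorphic_def by (rule bexI[OF _ Lunit_in_Hom], rule Lunit_iso) (fact assms)+
  show "isomorphic T (x \<boxtimes> Unit T) x"
    unfolding isomorphic_def by (rule bexI[OF _ Runit_in_Hom], rule Runit_iso) (fact assms)+
  show "isomorphic T ((x \<boxtimes> y) \<boxtimes> z) (x \<boxtimes> (y \<boxtimes> z))" if "z \<in> Obj T"
    unfolding isomorphic_def by (rule bexI[OF _ Assoc_in_Hom], rule Assoc_iso) (fact assms that)+
qed

end

context tensor_triangulated_category
begin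

lemma TensO_zero_object:
  assumes "x \<in> Obj T" "zero_object T z"
  shows "zero_object T (x \<boxtimes> z)" "zero_object T (z \<boxtimes> x)"
  using additive_functor_zero_object[OF exact_functor_additive[OF tensor_exact_right]]
    additive_functor_zero_object[OF exact_functor_additive[OF tensor_exact_left]] assms by blast+

lemma TensO_isomorphic:
  assumes "x \<in> Obj T" "isomorphic T y z"
  shows "isomorphic T (x \<boxtimes> y) (x \<boxtimes> z)" "isomorphic T (y \<boxtimes> x) (z \<boxtimes> x)"
  using functor_isomorphic[OF exact_functor_functor[OF tensor_exact_right]]
    functor_isomorphic[OF exact_functor_functor[OF tensor_exact_left]] assms by blast+

lemma TensO_SuspO:
  assumes "x \<in> Obj T" "y \<in> Obj T"
  shows "isomorphic T (x \<boxtimes> SuspO T y) (SuspO T (x \<boxtimes> y))"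
    "isomorphic T (SuspO T y \<boxtimes> x) (SuspO T (y \<boxtimes> x))"
  using exact_functor_SuspO[OF tensor_exact_right] exact_functor_SuspO[OF tensor_exact_left]
    assms by blast+

lemma TensA_Zero:
  assumes f: "f \<in> Hom T x y" and "u \<in> Obj T" "v \<in> Obj T"
  shows "f \<star> Zero T u v = Zero T (x \<boxtimes> u) (y \<boxtimes> v)"
proof -
  have o: "x \<in> Obj T" "y \<in> Obj T" "x \<boxtimes> u \<in> Obj T" "y \<boxtimes> u \<in> Obj T" "y \<boxtimes> v \<in> Obj T"
    using Hom_Obj[OF f] assms TensO_in_Obj by blast+
  have "Ident T y \<star> Zero T u v = Zero T (y \<boxtimes> u) (y \<boxtimes> v)"
    using additive_functor_Zero[OF exact_functor_additive[OF tensor_exact_right[OF o(2)]]] assms by simp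
  then show ?thesis
    using interchange'[OF f Zero_in_Hom[OF assms(2,3)]]
      Comp_Zero_left[OF TensA_in_Hom[OF f Ident_in_Hom[OF assms(2)]] o(5)] by simp
qed

text \<open>Exactness in each variable gives additivity only of tensoring with an identity; the
  interchange law carries it over to an arbitrary second factor.\<close>

lemma TensA_Add:
  assumes f: "f \<in> Hom T x y" "f' \<in> Hom T x y" and \<phi>: "\<phi> \<in> Hom T u v"
  shows "Add T f f' \<star> \<phi> = Add T (f \<star> \<phi>) (f' \<star> \<phi>)"
    and "\<phi> \<star> Add T f f' = Add T (\<phi> \<star> f) (\<phi> \<star> f')"
proof -
  have o: "x \<in> Obj T" "u \<in> Obj T" "v \<in> Obj T"
    using f \<phi> Hom_Obj by blast+
  have "Add T f f' \<star> Ident T v = Add T (f \<star> Ident T v) (f' \<star> Ident T v)"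
    using exact_functor_additive[OF tensor_exact_left[OF o(3)]] f
    unfolding additive_functor_def by blast
  then show "Add T f f' \<star> \<phi> = Add T (f \<star> \<phi>) (f' \<star> \<phi>)"
    using interchange[OF f(1) \<phi>] interchange[OF f(2) \<phi>] interchange[OF Add_in_Hom[OF f] \<phi>]
      Comp_Add_left TensA_in_Hom[OF f(1) Ident_in_Hom[OF o(3)]]
      TensA_in_Hom[OF f(2) Ident_in_Hom[OF o(3)]] TensA_in_Hom[OF Ident_in_Hom[OF o(1)] \<phi>]
    by metis
  have "Ident T v \<star> Add T f f' = Add T (Ident T v \<star> f) (Ident T v \<star> f')"
    using exact_functor_additive[OF tensor_exact_right[OF o(3)]] f
    unfolding additive_functor_def by blast
  then show "\<phi> \<star> Add T f f' = Add T (\<phi> \<star> f) (\<phi> \<star> f')"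
    using interchange'[OF \<phi> f(1)] interchange'[OF \<phi> f(2)] interchange'[OF \<phi> Add_in_Hom[OF f]]
      Comp_Add_left TensA_in_Hom[OF Ident_in_Hom[OF o(3)] f(1)]
      TensA_in_Hom[OF Ident_in_Hom[OF o(3)] f(2)] TensA_in_Hom[OF \<phi> Ident_in_Hom[OF o(1)]]
    by metis
qed

lemma SuspO_tensor:
  assumes "x \<in> Obj T"
  shows "isomorphic T (SuspO T (Unit T) \<boxtimes> x) (SuspO T x)"
proof -
  have "is_functor T T (SuspO T) (SuspA T)"
    using Susp_additive unfolding additive_functor_def by blast
  from functor_isomorphic[OF this TensO_unit(1)[OF assms assms]] show ?thesis
    by (rule isomorphic_trans[OF TensO_SuspO(2)[OF assms Unit_in_Obj]])
qed

text \<open>The object \<open>w\<close> is a desuspension of the unit: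
  \<open>w \<otimes> \<Sigma>x\<close>, \<open>\<Sigma>w \<otimes> x\<close> and \<open>x\<close>
  are isomorphic. Desuspending is thereby a case of tensoring.\<close>

lemma desusp_tensor:
  obtains w where "w \<in> Obj T" "\<And>x. x \<in> Obj T \<Longrightarrow> isomorphic T (w \<boxtimes> SuspO T x) x"
proof -
  obtain w where w: "w \<in> Obj T" "isomorphic T (SuspO T w) (Unit T)"
    using SuspO_ess_surj[OF Unit_in_Obj] .
  have "isomorphic T (w \<boxtimes> SuspO T x) x" if x: "x \<in> Obj T" for x
  proof -
    have "isomorphic T (w \<boxtimes> SuspO T x) (SuspO T w \<boxtimes> x)"
      using isomorphic_trans[OF TensO_SuspO(1)[OF w(1) x]
          isomorphic_sym[OF TensO_SuspO(2)[OF x w(1)]]] .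
    then show ?thesis
      using isomorphic_trans isomorphic_trans[OF TensO_isomorphic(2)[OF x w(2)] TensO_unit(1)[OF x x]]
      by blast
  qed
  with w(1) that show ?thesis by blast
qed

section \<open>Annihilators of maps\<close>

definition annihilator :: "'m \<Rightarrow> 'o set" where
  "annihilator \<phi> = {x \<in> Obj T. Ident T x \<star> \<phi> = Zero T (x \<boxtimes> Dom T \<phi>) (x \<boxtimes> Cod T \<phi>)}"

lemma annihilator_iff:
  assumes "\<phi> \<in> Hom T u v"
  shows "x \<in> annihilator \<phi> \<longleftrightarrow> x \<in> Obj T \<and> Ident T x \<star> \<phi> = Zero T (x \<boxtimes> u) (x \<boxtimes> v)"
  using assms unfolding annihilator_def Hom_def by auto

text \<open>The tensor product with a composite through \<open>x\<close> contains
  \<open>Ident T x \<star> \<phi>\<close> as a factor. Closure under retracts, isomorphisms and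
  direct sums all rest on this.\<close>

lemma annihilator_factor:
  assumes \<phi>: "\<phi> \<in> Hom T u v" and x: "x \<in> annihilator \<phi>" and "f \<in> Hom T w x" "g \<in> Hom T x y"
  shows "(g \<cdot> f) \<star> \<phi> = Zero T (w \<boxtimes> u) (y \<boxtimes> v)"
proof -
  have o: "x \<in> Obj T" "u \<in> Obj T" "v \<in> Obj T" "w \<in> Obj T" "y \<in> Obj T"
    using assms Hom_Obj by blast+
  have xv: "x \<boxtimes> v \<in> Obj T" and wu: "w \<boxtimes> u \<in> Obj T"
    using o TensO_in_Obj by blast+
  have "f \<star> \<phi> = Zero T (w \<boxtimes> u) (x \<boxtimes> v)"
    using x interchange'[OF assms(3) \<phi>] Comp_Zero_left[OF TensA_in_Hom[OF assms(3) Ident_in_Hom[OF o(2)]] xv]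
    unfolding annihilator_iff[OF \<phi>] by simp
  moreover have "(g \<cdot> f) \<star> \<phi> = (g \<star> Ident T v) \<cdot> (f \<star> \<phi>)"
    using TensA_Comp[OF assms(3,4) \<phi> Ident_in_Hom[OF o(3)]] Comp_Ident_left[OF \<phi>] by simp
  ultimately show ?thesis
    using Comp_Zero_right[OF TensA_in_Hom[OF assms(4) Ident_in_Hom[OF o(3)]] wu] by simp
qed

lemma annihilator_retract:
  assumes \<phi>: "\<phi> \<in> Hom T u v" and b: "b \<in> annihilator \<phi>"
    and "i \<in> Hom T x b" "p \<in> Hom T b x" "p \<cdot> i = Ident T x"
  shows "x \<in> annihilator \<phi>"
  using annihilator_factor[OF \<phi> b assms(3,4)] assms(5) Hom_Obj(1)[OF assms(3)]
  unfolding annihilator_iff[OF \<phi>] by simp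

lemma annihilator_isomorphic:
  "\<phi> \<in> Hom T u v \<Longrightarrow> x \<in> annihilator \<phi> \<Longrightarrow> isomorphic T x y \<Longrightarrow> y \<in> annihilator \<phi>"
  by (erule isomorphicE) (rule annihilator_retract)

lemma annihilator_tensor:
  assumes \<phi>: "\<phi> \<in> Hom T u v" and x: "x \<in> annihilator \<phi>" and y: "y \<in> Obj T"
  shows "y \<boxtimes> x \<in> annihilator \<phi>"
proof -
  have o: "x \<in> Obj T" "u \<in> Obj T" "v \<in> Obj T" and x0: "Ident T x \<star> \<phi> = Zero T (x \<boxtimes> u) (x \<boxtimes> v)"
    using x \<phi> Hom_Obj unfolding annihilator_iff[OF \<phi>] by blast+
  have oo: "y \<boxtimes> x \<in> Obj T" "x \<boxtimes> u \<in> Obj T" "x \<boxtimes> v \<in> Obj T" "(y \<boxtimes> x) \<boxtimes> u \<in> Obj T"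
    "(y \<boxtimes> x) \<boxtimes> v \<in> Obj T" "y \<boxtimes> (x \<boxtimes> v) \<in> Obj T"
    using o y TensO_in_Obj by blast+
  note a = Assoc_in_Hom[OF y o(1,2)] and a' = Assoc_in_Hom[OF y o(1,3)]
  have "Assoc T y x v \<cdot> (Ident T (y \<boxtimes> x) \<star> \<phi>) = (Ident T y \<star> (Ident T x \<star> \<phi>)) \<cdot> Assoc T y x u"
    using Assoc_natural[OF Ident_in_Hom[OF y] Ident_in_Hom[OF o(1)] \<phi>] TensA_Ident[OF y o(1)] by simp
  also have "\<dots> = Zero T ((y \<boxtimes> x) \<boxtimes> u) (y \<boxtimes> (x \<boxtimes> v))"
    using x0 TensA_Zero[OF Ident_in_Hom[OF y] oo(2,3)] Comp_Zero_left[OF a oo(6)] by simp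
  also have "\<dots> = Assoc T y x v \<cdot> Zero T ((y \<boxtimes> x) \<boxtimes> u) ((y \<boxtimes> x) \<boxtimes> v)"
    using Comp_Zero_right[OF a' oo(4)] by simp
  finally have "Ident T (y \<boxtimes> x) \<star> \<phi> = Zero T ((y \<boxtimes> x) \<boxtimes> u) ((y \<boxtimes> x) \<boxtimes> v)"
    by (rule iso_mono[OF Assoc_iso[OF y o(1,3)], rotated 2])
      (use a' oo \<phi> in \<open>simp_all add: Hom_def\<close>)
  then show ?thesis
    using oo unfolding annihilator_iff[OF \<phi>] by blast
qed

lemma annihilator_tensor_right:
  assumes \<phi>: "\<phi> \<in> Hom T u v" and x: "x \<in> annihilator \<phi>" and y: "y \<in> Obj T"
  shows "x \<boxtimes> y \<in> annihilator \<phi>"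
proof -
  have "x \<in> Obj T" using x unfolding annihilator_iff[OF \<phi>] by blast
  then show ?thesis
    using annihilator_isomorphic[OF \<phi> annihilator_tensor[OF assms]] TensO_commute y by blast
qed

text \<open>Up to associativity \<open>x \<otimes> (y \<otimes> \<phi>)\<close> is
  \<open>(x \<otimes> y) \<otimes> \<phi>\<close>, and the braiding makes annihilators closed under
  tensoring on the right as well.\<close>

lemma annihilator_whisker:
  assumes \<phi>: "\<phi> \<in> Hom T u v" and x: "x \<in> annihilator \<phi>" and y: "y \<in> Obj T"
  shows "x \<in> annihilator (Ident T y \<star> \<phi>)"
proof -
  have o: "x \<in> Obj T" "u \<in> Obj T" "v \<in> Obj T"
    using x \<phi> Hom_Obj unfolding annihilator_iff[OF \<phi>] by blast+
  have oo: "x \<boxtimes> y \<in> Obj T" "y \<boxtimes> u \<in> Obj T" "y \<boxtimes> v \<in> Obj T" "(x \<boxtimes> y) \<boxtimes> u \<in> Obj T"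
    "x \<boxtimes> (y \<boxtimes> u) \<in> Obj T" "x \<boxtimes> (y \<boxtimes> v) \<in> Obj T" "(x \<boxtimes> y) \<boxtimes> v \<in> Obj T"
    using o y TensO_in_Obj by blast+
  have \<phi>': "Ident T y \<star> \<phi> \<in> Hom T (y \<boxtimes> u) (y \<boxtimes> v)"
    using TensA_in_Hom[OF Ident_in_Hom[OF y] \<phi>] .
  note a = Assoc_in_Hom[OF o(1) y o(2)] and a' = Assoc_in_Hom[OF o(1) y o(3)]
  have "(Ident T x \<star> (Ident T y \<star> \<phi>)) \<cdot> Assoc T x y u = Assoc T x y v \<cdot> (Ident T (x \<boxtimes> y) \<star> \<phi>)"
    using Assoc_natural[OF Ident_in_Hom[OF o(1)] Ident_in_Hom[OF y] \<phi>] TensA_Ident[OF o(1) y] by simp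
  also have "\<dots> = Zero T ((x \<boxtimes> y) \<boxtimes> u) (x \<boxtimes> (y \<boxtimes> v))"
    using annihilator_tensor_right[OF assms] Comp_Zero_right[OF a' oo(4)]
    unfolding annihilator_iff[OF \<phi>] by simp
  also have "\<dots> = Zero T (x \<boxtimes> (y \<boxtimes> u)) (x \<boxtimes> (y \<boxtimes> v)) \<cdot> Assoc T x y u"
    using Comp_Zero_left[OF a oo(6)] by simp
  finally have "Ident T x \<star> (Ident T y \<star> \<phi>) = Zero T (x \<boxtimes> (y \<boxtimes> u)) (x \<boxtimes> (y \<boxtimes> v))"
    by (rule iso_epi[OF Assoc_iso[OF o(1) y o(2)], rotated 2])
      (use a oo o y \<phi> in \<open>simp_all add: Hom_def\<close>)
  then show ?thesis
    using o unfolding annihilator_iff[OF \<phi>'] by blast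
qed

lemma annihilator_Comp:
  assumes \<phi>: "\<phi> \<in> Hom T u v" and \<psi>: "\<psi> \<in> Hom T v w"
  shows "x \<in> annihilator \<phi> \<Longrightarrow> x \<in> annihilator (\<psi> \<cdot> \<phi>)"
    and "x \<in> annihilator \<psi> \<Longrightarrow> x \<in> annihilator (\<psi> \<cdot> \<phi>)"
proof -
  have o: "u \<in> Obj T" "v \<in> Obj T" "w \<in> Obj T"
    using assms Hom_Obj by blast+
  have *: "Ident T x \<star> (\<psi> \<cdot> \<phi>) = (Ident T x \<star> \<psi>) \<cdot> (Ident T x \<star> \<phi>)" if "x \<in> Obj T"
    using TensA_Comp[OF Ident_in_Hom[OF that] Ident_in_Hom[OF that] assms]
      Comp_Ident_left[OF Ident_in_Hom[OF that]] by simp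
  note iff = annihilator_iff[OF \<phi>] annihilator_iff[OF \<psi>] annihilator_iff[OF Comp_in_Hom[OF assms]]
  show "x \<in> annihilator \<phi> \<Longrightarrow> x \<in> annihilator (\<psi> \<cdot> \<phi>)"
    unfolding iff using * Comp_Zero_right[OF TensA_in_Hom[OF Ident_in_Hom \<psi>]] TensO_in_Obj o by auto
  show "x \<in> annihilator \<psi> \<Longrightarrow> x \<in> annihilator (\<psi> \<cdot> \<phi>)"
    unfolding iff using * Comp_Zero_left[OF TensA_in_Hom[OF Ident_in_Hom \<phi>]] TensO_in_Obj o by auto
qed

lemma annihilator_biproduct:
  assumes \<phi>: "\<phi> \<in> Hom T u v" and x: "x \<in> annihilator \<phi>" and y: "y \<in> annihilator \<phi>"
    and b: "is_biproduct T x y b"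
  shows "b \<in> annihilator \<phi>"
proof -
  obtain i j p q where h: "i \<in> Hom T x b" "j \<in> Hom T y b" "p \<in> Hom T b x" "q \<in> Hom T b y"
    and e: "Add T (i \<cdot> p) (j \<cdot> q) = Ident T b"
    using b by (rule biproductE) (rule that)
  have o: "b \<in> Obj T" "u \<in> Obj T" "v \<in> Obj T"
    using h \<phi> Hom_Obj by blast+
  then have 0: "Zero T (b \<boxtimes> u) (b \<boxtimes> v) \<in> Hom T (b \<boxtimes> u) (b \<boxtimes> v)"
    using Zero_in_Hom TensO_in_Obj by blast
  have "Ident T b \<star> \<phi> = Add T ((i \<cdot> p) \<star> \<phi>) ((j \<cdot> q) \<star> \<phi>)"
    using TensA_Add(1)[OF Comp_in_Hom[OF h(3,1)] Comp_in_Hom[OF h(4,2)] \<phi>] e by simp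
  also have "\<dots> = Zero T (b \<boxtimes> u) (b \<boxtimes> v)"
    using annihilator_factor[OF \<phi> x h(3,1)] annihilator_factor[OF \<phi> y h(4,2)]
      Add_Zero_right[OF 0 0] by simp
  finally show ?thesis
    using o unfolding annihilator_iff[OF \<phi>] by blast
qed

text \<open>
  The isomorphisms \<open>\<Sigma>x \<otimes> u \<cong> \<Sigma>(x \<otimes> u)\<close> are not assumed natural in \<open>u\<close>; closure under
  (de)suspension uses \<open>\<Sigma>x \<cong> \<Sigma>\<one> \<otimes> x\<close> instead.
\<close>

lemma gen_level_one_annihilator:
  assumes \<phi>: "\<phi> \<in> Hom T u v" and g: "g \<in> annihilator \<phi>"
  shows "gen_level T g 1 \<subseteq> annihilator \<phi>"
proof (rule gen_level_one_subset)
  show "x \<in> annihilator \<phi>" if z: "zero_object T x" for x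
  proof -
    have o: "x \<in> Obj T" "u \<in> Obj T" "v \<in> Obj T"
      using z Hom_Obj[OF \<phi>] by (simp_all add: zero_object_def)
    then show ?thesis
      using zero_object_Hom(1)[OF TensO_zero_object(2)[OF _ z] TensA_in_Hom[OF Ident_in_Hom \<phi>]]
      unfolding annihilator_iff[OF \<phi>] by blast
  qed
  show iso: "y \<in> annihilator \<phi>" if "x \<in> annihilator \<phi>" "isomorphic T x y" for x y
    using annihilator_isomorphic[OF \<phi>] that by blast
  show "b \<in> annihilator \<phi>" if "x \<in> annihilator \<phi>" "y \<in> annihilator \<phi>" "is_biproduct T x y b" for x y b
    using annihilator_biproduct[OF \<phi>] that by blast
  show "SuspO T x \<in> annihilator \<phi>" if x: "x \<in> annihilator \<phi>" for x
  proof -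
    have "x \<in> Obj T" using x unfolding annihilator_iff[OF \<phi>] by blast
    then show ?thesis
      using iso[OF annihilator_tensor[OF \<phi> x SuspO_in_Obj[OF Unit_in_Obj]]] SuspO_tensor by blast
  qed
  show "x \<in> annihilator \<phi>" if x: "x \<in> Obj T" "SuspO T x \<in> annihilator \<phi>" for x
  proof -
    obtain w where w: "w \<in> Obj T" "isomorphic T (w \<boxtimes> SuspO T x) x"
      using desusp_tensor x(1) by metis
    then show ?thesis
      using iso[OF annihilator_tensor[OF \<phi> x(2) w(1)]] by blast
  qed
  show "x \<in> annihilator \<phi>" if b: "b \<in> annihilator \<phi>" "direct_summand T x b" for x b
  proof -
    obtain y where "is_biproduct T x y b"
      using b(2) by (auto simp: direct_summand_def)
    then obtain i p where "i \<in> Hom T x b" "p \<in> Hom T b x" "p \<cdot> i = Ident T x"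
      by (rule biproductE) (rule that)
    then show ?thesis using annihilator_retract[OF \<phi> b(1)] by blast
  qed
qed (fact g)

text \<open>A ghost-lemma argument: \<open>b \<otimes> \<zeta>\<close> dies in
  \<open>c \<otimes> u\<close>, so it lifts to \<open>a \<otimes> u\<close>, and there
  \<open>h\<close> is annihilated. Composing two maps thus pays for one extension.\<close>

lemma annihilator_extension:
  assumes t: "dist_tri a b c f g k" and h: "h \<in> Hom T u v" and \<zeta>: "\<zeta> \<in> Hom T w u"
    and a: "a \<in> annihilator h" and c: "c \<in> annihilator \<zeta>"
  shows "b \<in> annihilator (h \<cdot> \<zeta>)"
proof -
  note d = dist_triD[OF t]
  have o: "u \<in> Obj T" "v \<in> Obj T" "w \<in> Obj T"
    using h \<zeta> Hom_Obj by blast+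
  have oo: "b \<boxtimes> w \<in> Obj T" "b \<boxtimes> v \<in> Obj T" "c \<boxtimes> u \<in> Obj T"
    using d o TensO_in_Obj by blast+
  obtain l where l: "dist_tri (a \<boxtimes> u) (b \<boxtimes> u) (c \<boxtimes> u) (f \<star> Ident T u) (g \<star> Ident T u) l"
    using exact_functor_dist_tri[OF tensor_exact_left[OF o(1)] t] by blast
  note dl = dist_triD[OF l]
  have b\<zeta>: "Ident T b \<star> \<zeta> \<in> Hom T (b \<boxtimes> w) (b \<boxtimes> u)" and bh: "Ident T b \<star> h \<in> Hom T (b \<boxtimes> u) (b \<boxtimes> v)"
    using TensA_in_Hom Ident_in_Hom d h \<zeta> by blast+
  have "(g \<star> Ident T u) \<cdot> (Ident T b \<star> \<zeta>) = Zero T (b \<boxtimes> w) (c \<boxtimes> u)"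
    using interchange[OF d(2) \<zeta>] annihilator_factor[OF \<zeta> c d(2) Ident_in_Hom[OF d(7)]]
      Comp_Ident_left[OF d(2)] by simp
  then obtain s where s: "s \<in> Hom T (b \<boxtimes> w) (a \<boxtimes> u)" "Ident T b \<star> \<zeta> = (f \<star> Ident T u) \<cdot> s"
    using dist_tri_lift[OF l b\<zeta>] by blast
  have "Ident T b \<star> (h \<cdot> \<zeta>) = (Ident T b \<star> h) \<cdot> ((f \<star> Ident T u) \<cdot> s)"
    using TensA_Comp[OF Ident_in_Hom[OF d(6)] Ident_in_Hom[OF d(6)] \<zeta> h] s(2)
      Comp_Ident_left[OF Ident_in_Hom[OF d(6)]] by simp
  also have "\<dots> = (f \<star> h) \<cdot> s"
    using Comp_assoc[OF s(1) dl(1) bh] interchange'[OF d(1) h] by simp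
  also have "\<dots> = Zero T (b \<boxtimes> w) (b \<boxtimes> v)"
    using annihilator_factor[OF h a Ident_in_Hom[OF d(5)] d(1)] Comp_Ident_right[OF d(1)]
      Comp_Zero_left[OF s(1) oo(2)] by simp
  finally show ?thesis
    using d(6) unfolding annihilator_iff[OF Comp_in_Hom[OF \<zeta> h]] by blast
qed

section \<open>Thick tensor ideals and the construction of an annihilating map\<close>

lemma
  assumes "thick_tensor_ideal T S"
  shows ideal_thick: "thick_subcategory T S"
    and ideal_triangulated: "triangulated_subcategory T S"
    and ideal_tensor: "\<lbrakk>x \<in> Obj T; s \<in> S\<rbrakk> \<Longrightarrow> x \<boxtimes> s \<in> S"
  using assms thick_subcategoryD(1) unfolding thick_tensor_ideal_def by blast+

lemma ideal_tensor_right: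
  assumes S: "thick_tensor_ideal T S" and "x \<in> Obj T" "s \<in> S"
  shows "s \<boxtimes> x \<in> S"
proof -
  note tS = triangulated_subcategoryD[OF ideal_triangulated[OF S]]
  show ?thesis
    using tS(3)[OF ideal_tensor[OF S assms(2,3)]] TensO_commute tS(1) assms by blast
qed

text \<open>The unitor replaces the target \<open>x \<otimes> \<one>\<close> of
  \<open>x \<otimes> e\<close> by \<open>x\<close>, so that the result composes with maps out of
  \<open>x\<close>. Being invertible, it has a zero cone, and the octahedral axiom leaves only
  \<open>x \<otimes> c\<close>, which is in \<open>S\<close>.\<close>

lemma cone_in_ideal_whisker:
  assumes S: "thick_tensor_ideal T S" and e: "dist_tri j (Unit T) c e e' e''" and c: "c \<in> S"
    and x: "x \<in> Obj T"
  shows "Runit T x \<cdot> (Ident T x \<star> e) \<in> Hom T (x \<boxtimes> j) x"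
    and "dist_tri (x \<boxtimes> j) x d (Runit T x \<cdot> (Ident T x \<star> e)) k l \<Longrightarrow> d \<in> S"
proof -
  note tS = ideal_triangulated[OF S]
  obtain e3 where t: "dist_tri (x \<boxtimes> j) (x \<boxtimes> Unit T) (x \<boxtimes> c) (Ident T x \<star> e) (Ident T x \<star> e') e3"
    using exact_functor_dist_tri[OF tensor_exact_right[OF x] e] by blast
  obtain r r' r'' where r: "dist_tri (x \<boxtimes> Unit T) x r (Runit T x) r' r''"
    using cone_exists[OF Runit_in_Hom[OF x]] .
  have "r \<in> S"
    using cone_iso_zero[OF r Runit_iso[OF x]] triangulated_subcategoryD(2)[OF tS] by blast
  then show "dist_tri (x \<boxtimes> j) x d (Runit T x \<cdot> (Ident T x \<star> e)) k l \<Longrightarrow> d \<in> S"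
    using triangulated_subcategory_cone_Comp[OF tS t r] ideal_tensor[OF S x c] by blast
  show "Runit T x \<cdot> (Ident T x \<star> e) \<in> Hom T (x \<boxtimes> j) x"
    using Comp_in_Hom[OF dist_triD(1)[OF t] Runit_in_Hom[OF x]] .
qed

text \<open>
  Composing \<open>n\<close> copies of \<open>\<xi>\<close> gives a map to \<open>\<one>\<close> that annihilates \<open>\<langle>g\<rangle>\<^sub>n\<close>: each factor
  absorbs one extension.
\<close>

lemma annihilating_map_exists:
  assumes S: "thick_tensor_ideal T S" and \<xi>: "dist_tri j (Unit T) c \<xi> u v" and c: "c \<in> S"
    and g: "g \<in> annihilator \<xi>"
  shows "\<exists>E e d u v. dist_tri E (Unit T) d e u v \<and> d \<in> S \<and> gen_level T g (Suc n) \<subseteq> annihilator e"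
\<comment> \<open>The level is shifted by one because level \<open>0\<close> is a dummy; the base
  case is \<open>\<xi>\<close> itself on the first level.\<close>
proof (induction n)
  case 0
  then show ?case
    using gen_level_one_annihilator[OF dist_triD(1)[OF \<xi>] g] \<xi> c unfolding One_nat_def by blast
next
  case (Suc n)
  then obtain E e d u' v' where e: "dist_tri E (Unit T) d e u' v'" "d \<in> S"
    and gen: "gen_level T g (Suc n) \<subseteq> annihilator e"
    by blast
  note de = dist_triD[OF e(1)] and d\<xi> = dist_triD[OF \<xi>]
  \<comment> \<open>Up to the unitor this is \<open>E \<otimes> \<xi>\<close>, so
    \<open>e \<cdot> m : E \<otimes> j \<rightarrow> \<one>\<close> is the next power.\<close>
  define m where "m = Runit T E \<cdot> (Ident T E \<star> \<xi>)"
  have m: "m \<in> Hom T (E \<boxtimes> j) E"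
    unfolding m_def using cone_in_ideal_whisker(1)[OF S \<xi> c de(5)] .
  have w: "Ident T E \<star> \<xi> \<in> Hom T (E \<boxtimes> j) (E \<boxtimes> Unit T)"
    using TensA_in_Hom[OF Ident_in_Hom[OF de(5)] d\<xi>(1)] .
  obtain dm um vm where tm: "dist_tri (E \<boxtimes> j) E dm m um vm"
    using cone_exists[OF m] .
  obtain d2 u2 v2 where t2: "dist_tri (E \<boxtimes> j) (Unit T) d2 (e \<cdot> m) u2 v2"
    using cone_exists[OF Comp_in_Hom[OF m de(1)]] .
  have "dm \<in> S"
    using cone_in_ideal_whisker(2)[OF S \<xi> c de(5)] tm unfolding m_def by blast
  then have d2: "d2 \<in> S"
    using triangulated_subcategory_cone_Comp[OF ideal_triangulated[OF S] tm e(1) t2] e(2) by blast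
  have one: "gen_level T g 1 \<subseteq> annihilator m"
  proof
    fix x assume "x \<in> gen_level T g 1"
    then have "x \<in> annihilator \<xi>"
      using gen_level_one_annihilator[OF d\<xi>(1) g] by blast
    then show "x \<in> annihilator m"
      unfolding m_def using annihilator_Comp(1)[OF w Runit_in_Hom[OF de(5)]]
        annihilator_whisker[OF d\<xi>(1) _ de(5)] by blast
  qed
  have "gen_level T g (Suc (Suc n)) \<subseteq> annihilator (e \<cdot> m)"
  proof
    fix b assume "b \<in> gen_level T g (Suc (Suc n))"
    then obtain b'' f k l where b: "is_biproduct T b b'' (Cod T f)" "(f, k, l) \<in> Tri T"
      "Dom T f \<in> gen_level T g (Suc n)" "Cod T k \<in> gen_level T g 1"
      unfolding gen_level.simps(3) One_nat_def by blast
    \<comment> \<open>In the triangle the first vertex has level \<open>Suc n\<close> and is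
      annihilated by \<open>e\<close>, the third has level one and is annihilated by
      \<open>m\<close>.\<close>
    then have "Cod T f \<in> annihilator (e \<cdot> m)"
      using annihilator_extension[OF Tri_dist_tri[OF b(2)] de(1) m] gen one by blast
    moreover obtain i p where "i \<in> Hom T b (Cod T f)" "p \<in> Hom T (Cod T f) b" "p \<cdot> i = Ident T b"
      using b(1) by (rule biproductE) (rule that)
    ultimately show "b \<in> annihilator (e \<cdot> m)"
      using annihilator_retract[OF Comp_in_Hom[OF m de(1)]] by blast
  qed
  then show ?case using t2 d2 by blast
qed

end


section \<open>Prime ideals\<close>

context tensor_triangulated_category
begin

lemma ideal_eq_Obj:
  assumes M: "thick_tensor_ideal T M" and "Unit T \<in> M"
  shows "M = Obj T"
proof
  note tM = triangulated_subcategoryD[OF ideal_triangulated[OF M]]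
  show "M \<subseteq> Obj T" using tM(1) by blast
  show "Obj T \<subseteq> M"
  proof
    fix x assume x: "x \<in> Obj T"
    then show "x \<in> M"
      using tM(3)[OF ideal_tensor[OF M x assms(2)] TensO_unit(2)[OF x x]] by blast
  qed
qed

lemma zero_objects_ideal: "thick_tensor_ideal T {z. zero_object T z}"
  unfolding thick_tensor_ideal_def
  using thick_subcategory_zero_objects TensO_zero_object(1) by blast

text \<open>This is the colon ideal of \<open>M\<close> by \<open>x\<close>. It is used twice: to
  prove that maximal ideals are prime, and with \<open>M\<close> the zero ideal, as the objects
  killed by tensoring with \<open>x\<close>.\<close>

lemma ideal_quotient:
  assumes M: "thick_tensor_ideal T M" and x: "x \<in> Obj T"
  shows "thick_tensor_ideal T {z \<in> Obj T. x \<boxtimes> z \<in> M}"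
  unfolding thick_tensor_ideal_def
proof (intro conjI ballI)
  show "thick_subcategory T {z \<in> Obj T. x \<boxtimes> z \<in> M}"
    using thick_subcategory_preimage[OF tensor_exact_right[OF x] ideal_thick[OF M]] .
  note tM = triangulated_subcategoryD[OF ideal_triangulated[OF M]]
  fix y z assume y: "y \<in> Obj T" and "z \<in> {z \<in> Obj T. x \<boxtimes> z \<in> M}"
  then have z: "z \<in> Obj T" "x \<boxtimes> z \<in> M" by blast+
  have "isomorphic T ((x \<boxtimes> z) \<boxtimes> y) (x \<boxtimes> (z \<boxtimes> y))"
    using TensO_assoc[OF x z(1) y] .
  then have "isomorphic T ((x \<boxtimes> z) \<boxtimes> y) (x \<boxtimes> (y \<boxtimes> z))"
    using TensO_isomorphic(1)[OF x TensO_commute[OF z(1) y]] isomorphic_trans by blast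
  then show "y \<boxtimes> z \<in> {z \<in> Obj T. x \<boxtimes> z \<in> M}"
    using tM(3) ideal_tensor_right[OF M y z(2)] TensO_in_Obj[OF y z(1)] by blast
qed

lemma ideal_Union_chain:
  assumes "\<C> \<noteq> {}" and ideal: "\<And>M. M \<in> \<C> \<Longrightarrow> thick_tensor_ideal T M"
    and chain: "\<And>M N. M \<in> \<C> \<Longrightarrow> N \<in> \<C> \<Longrightarrow> M \<subseteq> N \<or> N \<subseteq> M"
  shows "thick_tensor_ideal T (\<Union>\<C>)"
proof -
  \<comment> \<open>Each closure condition involves at most two given objects, which lie in a common
    member of the chain.\<close>
  have two: "\<exists>M \<in> \<C>. x \<in> M \<and> y \<in> M" if "x \<in> \<Union>\<C>" "y \<in> \<Union>\<C>" for x y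
    using that chain by blast
  have thick: "thick_subcategory T M" and tri: "triangulated_subcategory T M"
    and tensor: "\<And>x s. x \<in> Obj T \<Longrightarrow> s \<in> M \<Longrightarrow> x \<boxtimes> s \<in> M" if "M \<in> \<C>" for M
    using ideal_thick[OF ideal[OF that]] ideal_triangulated[OF ideal[OF that]]
      ideal_tensor[OF ideal[OF that]] by blast+
  have "thick_subcategory T (\<Union>\<C>)"
  proof (rule thick_subcategoryI)
    show "x \<in> Obj T" if "x \<in> \<Union>\<C>" for x
      using that triangulated_subcategoryD(1)[OF tri] by blast
    show "x \<in> \<Union>\<C>" if "zero_object T x" for x
      using that triangulated_subcategoryD(2)[OF tri] assms(1) by blast
    show "y \<in> \<Union>\<C>" if "x \<in> \<Union>\<C>" "isomorphic T x y" for x y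
      using that triangulated_subcategoryD(3)[OF tri] by blast
    show "b \<in> \<Union>\<C>" if "x \<in> \<Union>\<C>" "y \<in> \<Union>\<C>" "is_biproduct T x y b" for x y b
      using two[OF that(1,2)] that(3) triangulated_subcategoryD(4)[OF tri] by blast
    show "SuspO T x \<in> \<Union>\<C>" if "x \<in> \<Union>\<C>" for x
      using that triangulated_subcategoryD(1,5)[OF tri] by blast
    show "x \<in> \<Union>\<C>" if "x \<in> Obj T" "SuspO T x \<in> \<Union>\<C>" for x
      using that triangulated_subcategoryD(5)[OF tri] by blast
    show "z \<in> \<Union>\<C>" if "dist_tri x y z f g h" "x \<in> \<Union>\<C>" "y \<in> \<Union>\<C>" for x y z f g h
      using two[OF that(2,3)] triangulated_subcategoryD(6)[OF tri that(1)] by blast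
    show "x \<in> \<Union>\<C>" if "b \<in> \<Union>\<C>" "direct_summand T x b" for x b
      using that thick_subcategoryD(2)[OF thick] by blast
  qed
  then show ?thesis
    unfolding thick_tensor_ideal_def using tensor by blast
qed

text \<open>If \<open>x \<otimes> y\<close> is in \<open>M\<close>, the colon ideal of
  \<open>M\<close> by \<open>x\<close> contains \<open>M\<close> and \<open>y\<close>. Either it
  contains the unit, which puts \<open>x\<close> in \<open>M\<close>, or maximality identifies it
  with \<open>M\<close>, which puts \<open>y\<close> in \<open>M\<close>.\<close>

lemma maximal_ideal_prime:
  assumes M: "thick_tensor_ideal T M" and one: "Unit T \<notin> M"
    and max: "\<And>N. thick_tensor_ideal T N \<Longrightarrow> M \<subseteq> N \<Longrightarrow> Unit T \<notin> N \<Longrightarrow> N = M"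
  shows "M \<in> Spc T"
proof -
  note tM = triangulated_subcategoryD[OF ideal_triangulated[OF M]]
  have "x \<in> M \<or> y \<in> M" if x: "x \<in> Obj T" and y: "y \<in> Obj T" and xy: "x \<boxtimes> y \<in> M" for x y
  proof -
    let ?N = "{z \<in> Obj T. x \<boxtimes> z \<in> M}"
    have N: "thick_tensor_ideal T ?N" "M \<subseteq> ?N" "y \<in> ?N"
      using ideal_quotient[OF M x] tM(1) ideal_tensor[OF M x] y xy by blast+
    show ?thesis
    proof (cases "Unit T \<in> ?N")
      case True
      then have "x \<boxtimes> Unit T \<in> M" by blast
      then show ?thesis using tM(3) TensO_unit(2)[OF x x] by blast
    next
      case False
      then show ?thesis using max[OF N(1,2)] N(3) by blast
    qed
  qed
  moreover have "M \<subset> Obj T"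
    using tM(1) one Unit_in_Obj by blast
  ultimately show ?thesis
    unfolding Spc_def using M by blast
qed

lemma prime_ideal_exists:
  assumes S: "thick_tensor_ideal T S" "Unit T \<notin> S"
  obtains P where "P \<in> Spc T" "S \<subseteq> P"
proof -
  \<comment> \<open>Properness is expressed by the absence of the unit, a condition that passes to
    unions of chains.\<close>
  let ?A = "{M. thick_tensor_ideal T M \<and> S \<subseteq> M \<and> Unit T \<notin> M}"
  have "\<exists>M \<in> ?A. \<forall>X \<in> ?A. M \<subseteq> X \<longrightarrow> X = M"
  proof (rule subset_Zorn_nonempty)
    show "?A \<noteq> {}" using S by blast
    fix \<C> assume C: "\<C> \<noteq> {}" "subset.chain ?A \<C>"
    then have A: "\<C> \<subseteq> ?A" and "\<And>M N. M \<in> \<C> \<Longrightarrow> N \<in> \<C> \<Longrightarrow> M \<subseteq> N \<or> N \<subseteq> M"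
      unfolding subset_chain_def by blast+
    then have "thick_tensor_ideal T (\<Union>\<C>)"
      using ideal_Union_chain[OF C(1)] by blast
    then show "\<Union>\<C> \<in> ?A"
      using A C(1) by blast
  qed
  then obtain M where "M \<in> ?A" "\<forall>X \<in> ?A. M \<subseteq> X \<longrightarrow> X = M" by blast
  then show ?thesis
    using maximal_ideal_prime[of M] that by blast
qed

end


section \<open>Rigidity\<close>

locale rigid_tensor_triangulated_category = tensor_triangulated_category +
  fixes H :: "'a \<Rightarrow> 'a \<Rightarrow> 'a" and ev :: "'a \<Rightarrow> 'a \<Rightarrow> 'b"
  assumes internal_hom: "internal_hom T H ev"
    and natural_dual_map_iso:
      "\<lbrakk>x \<in> Obj T; y \<in> Obj T\<rbrakk> \<Longrightarrow> is_iso T (natural_dual_map T H ev x y)"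
begin

lemma
  assumes "x \<in> Obj T" "y \<in> Obj T"
  shows hom_in_Obj: "H x y \<in> Obj T"
    and ev_in_Hom: "ev x y \<in> Hom T (x \<boxtimes> H x y) y"
    and transpose_ex1: "\<lbrakk>z \<in> Obj T; f \<in> Hom T (x \<boxtimes> z) y\<rbrakk>
          \<Longrightarrow> \<exists>!g. g \<in> Hom T z (H x y) \<and> ev x y \<cdot> (Ident T x \<star> g) = f"
  using internal_hom assms unfolding internal_hom_def by blast+

text \<open>The evaluation \<open>x \<otimes> (x\<^sup>\<or> \<otimes> y) \<rightarrow> y\<close>,
  spelled exactly as in \<open>natural_dual_map\<close>, so that the latter is its transpose by
  definition.\<close>

definition dual_ev :: "'a \<Rightarrow> 'a \<Rightarrow> 'b" where
  "dual_ev x y = Lunit T y \<cdot> (ev x (Unit T) \<star> Ident T y) \<cdot>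
     (THE a. inverse_arrows T (Assoc T x (H x (Unit T)) y) a)"

lemma
  assumes x: "x \<in> Obj T" and y: "y \<in> Obj T"
  shows dual_ev_in_Hom: "dual_ev x y \<in> Hom T (x \<boxtimes> (H x (Unit T) \<boxtimes> y)) y"
    and dual_ev_Assoc: "dual_ev x y \<cdot> Assoc T x (H x (Unit T)) y = Lunit T y \<cdot> (ev x (Unit T) \<star> Ident T y)"
proof -
  let ?D = "H x (Unit T)" and ?a = "THE a. inverse_arrows T (Assoc T x (H x (Unit T)) y) a"
  have D: "?D \<in> Obj T" using hom_in_Obj[OF x Unit_in_Obj] .
  have "inverse_arrows T (Assoc T x ?D y) ?a"
    using the_inverse_arrows[OF Assoc_iso[OF x D y]] .
  then have a: "?a \<in> Hom T (x \<boxtimes> (?D \<boxtimes> y)) ((x \<boxtimes> ?D) \<boxtimes> y)"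
    "?a \<cdot> Assoc T x ?D y = Ident T ((x \<boxtimes> ?D) \<boxtimes> y)"
    using Assoc_in_Hom[OF x D y] unfolding inverse_arrows_def Hom_def by auto
  have e: "ev x (Unit T) \<star> Ident T y \<in> Hom T ((x \<boxtimes> ?D) \<boxtimes> y) (Unit T \<boxtimes> y)"
    using TensA_in_Hom[OF ev_in_Hom[OF x Unit_in_Obj] Ident_in_Hom[OF y]] .
  have le: "Lunit T y \<cdot> (ev x (Unit T) \<star> Ident T y) \<in> Hom T ((x \<boxtimes> ?D) \<boxtimes> y) y"
    using Comp_in_Hom[OF e Lunit_in_Hom[OF y]] .
  then show "dual_ev x y \<in> Hom T (x \<boxtimes> (?D \<boxtimes> y)) y"
    unfolding dual_ev_def using Comp_in_Hom[OF a(1)] by blast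
  show "dual_ev x y \<cdot> Assoc T x ?D y = Lunit T y \<cdot> (ev x (Unit T) \<star> Ident T y)"
    unfolding dual_ev_def using Comp_assoc[OF Assoc_in_Hom[OF x D y] a(1) le] a(2)
      Comp_Ident_right[OF le] by simp
qed

text \<open>After precomposition with the associator, which removes the chosen inverse from
  \<open>dual_ev\<close>, both sides contain \<open>ev x (Unit T) \<star> \<phi>\<close>, expanded
  by the interchange law in its two orders.\<close>

lemma dual_ev_natural:
  assumes x: "x \<in> Obj T" and \<phi>: "\<phi> \<in> Hom T y z"
  shows "\<phi> \<cdot> dual_ev x y = dual_ev x z \<cdot> (Ident T x \<star> (Ident T (H x (Unit T)) \<star> \<phi>))"
proof -
  let ?D = "H x (Unit T)" and ?e = "ev x (Unit T)"
  have o: "y \<in> Obj T" "z \<in> Obj T" "?D \<in> Obj T" "x \<boxtimes> ?D \<in> Obj T"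
    using \<phi> Hom_Obj hom_in_Obj[OF x Unit_in_Obj] TensO_in_Obj x by blast+
  note e = ev_in_Hom[OF x Unit_in_Obj]
  note ay = Assoc_in_Hom[OF x o(3,1)] and az = Assoc_in_Hom[OF x o(3,2)]
  note dy = dual_ev_in_Hom[OF x o(1)] and dz = dual_ev_in_Hom[OF x o(2)]
  have ey: "?e \<star> Ident T y \<in> Hom T ((x \<boxtimes> ?D) \<boxtimes> y) (Unit T \<boxtimes> y)"
    and ez: "?e \<star> Ident T z \<in> Hom T ((x \<boxtimes> ?D) \<boxtimes> z) (Unit T \<boxtimes> z)"
    and u\<phi>: "Ident T (Unit T) \<star> \<phi> \<in> Hom T (Unit T \<boxtimes> y) (Unit T \<boxtimes> z)"
    and xD\<phi>: "Ident T (x \<boxtimes> ?D) \<star> \<phi> \<in> Hom T ((x \<boxtimes> ?D) \<boxtimes> y) ((x \<boxtimes> ?D) \<boxtimes> z)"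
    and w: "Ident T x \<star> (Ident T ?D \<star> \<phi>) \<in> Hom T (x \<boxtimes> (?D \<boxtimes> y)) (x \<boxtimes> (?D \<boxtimes> z))"
    using TensA_in_Hom Ident_in_Hom e \<phi> o x Unit_in_Obj by blast+
  have "(\<phi> \<cdot> dual_ev x y) \<cdot> Assoc T x ?D y = (\<phi> \<cdot> Lunit T y) \<cdot> (?e \<star> Ident T y)"
    using Comp_assoc[OF ay dy \<phi>] dual_ev_Assoc[OF x o(1)] Comp_assoc[OF ey Lunit_in_Hom[OF o(1)] \<phi>]
    by simp
  also have "\<dots> = Lunit T z \<cdot> ((Ident T (Unit T) \<star> \<phi>) \<cdot> (?e \<star> Ident T y))"
    using Lunit_natural[OF \<phi>] Comp_assoc[OF ey u\<phi> Lunit_in_Hom[OF o(2)]] by simp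
  also have "\<dots> = Lunit T z \<cdot> ((?e \<star> Ident T z) \<cdot> (Ident T (x \<boxtimes> ?D) \<star> \<phi>))"
    using interchange[OF e \<phi>] interchange'[OF e \<phi>] by simp
  also have "\<dots> = dual_ev x z \<cdot> (Assoc T x ?D z \<cdot> (Ident T (x \<boxtimes> ?D) \<star> \<phi>))"
    using Comp_assoc[OF xD\<phi> ez Lunit_in_Hom[OF o(2)]] dual_ev_Assoc[OF x o(2)]
      Comp_assoc[OF xD\<phi> az dz] by simp
  also have "\<dots> = (dual_ev x z \<cdot> (Ident T x \<star> (Ident T ?D \<star> \<phi>))) \<cdot> Assoc T x ?D y"
    using Assoc_natural[OF Ident_in_Hom[OF x] Ident_in_Hom[OF o(3)] \<phi>] TensA_Ident[OF x o(3)]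
      Comp_assoc[OF ay w dz] by simp
  finally show ?thesis
    by (rule iso_epi[OF Assoc_iso[OF x o(3,1)], rotated 2])
      (use ay dy dz w \<phi> in \<open>simp_all add: Hom_def\<close>)
qed

lemma
  assumes x: "x \<in> Obj T" and y: "y \<in> Obj T"
  shows natural_dual_map_in_Hom: "natural_dual_map T H ev x y \<in> Hom T (H x (Unit T) \<boxtimes> y) (H x y)"
    and ev_natural_dual_map: "ev x y \<cdot> (Ident T x \<star> natural_dual_map T H ev x y) = dual_ev x y"
proof -
  have "H x (Unit T) \<boxtimes> y \<in> Obj T"
    using hom_in_Obj[OF x Unit_in_Obj] TensO_in_Obj y by blast
  from theI'[OF transpose_ex1[OF x y this dual_ev_in_Hom[OF x y]]]
  have *: "natural_dual_map T H ev x y \<in> Hom T (H x (Unit T) \<boxtimes> y) (H x y) \<and>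
    ev x y \<cdot> (Ident T x \<star> natural_dual_map T H ev x y) = dual_ev x y"
    unfolding natural_dual_map_def dual_ev_def .
  then show "natural_dual_map T H ev x y \<in> Hom T (H x (Unit T) \<boxtimes> y) (H x y)"
    "ev x y \<cdot> (Ident T x \<star> natural_dual_map T H ev x y) = dual_ev x y"
    by blast+
qed

lemma hom_isomorphic: "x \<in> Obj T \<Longrightarrow> y \<in> Obj T \<Longrightarrow> isomorphic T (H x (Unit T) \<boxtimes> y) (H x y)"
  unfolding isomorphic_def using natural_dual_map_in_Hom natural_dual_map_iso by blast

text \<open>
  Every \<open>f : x \<rightarrow> y\<close> is the composite of \<open>x \<cong> x \<otimes> \<one> \<rightarrow> x \<otimes> (x\<^sup>\<or> \<otimes> y)\<close> with the evaluation,
  which is natural in \<open>y\<close>.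
\<close>

lemma Comp_eq_Zero_if_dual_annihilated:
  assumes f: "f \<in> Hom T x y" and \<phi>: "\<phi> \<in> Hom T y z" and D: "H x (Unit T) \<in> annihilator \<phi>"
  shows "\<phi> \<cdot> f = Zero T x z"
proof -
  let ?D = "H x (Unit T)" and ?\<theta> = "natural_dual_map T H ev x y"
  have o: "x \<in> Obj T" "y \<in> Obj T" "z \<in> Obj T" "?D \<in> Obj T"
    using f \<phi> Hom_Obj hom_in_Obj Unit_in_Obj by blast+
  have oo: "?D \<boxtimes> y \<in> Obj T" "?D \<boxtimes> z \<in> Obj T" "x \<boxtimes> Unit T \<in> Obj T" "x \<boxtimes> (?D \<boxtimes> y) \<in> Obj T"
    using o TensO_in_Obj Unit_in_Obj by blast+
  note R = Runit_in_Hom[OF o(1)] and ix = Ident_in_Hom[OF o(1)]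
  note dy = dual_ev_in_Hom[OF o(1,2)] and dz = dual_ev_in_Hom[OF o(1,3)]
  note \<theta> = natural_dual_map_in_Hom[OF o(1,2)]
  have fR: "f \<cdot> Runit T x \<in> Hom T (x \<boxtimes> Unit T) y"
    using Comp_in_Hom[OF R f] .
  obtain g where g: "g \<in> Hom T (Unit T) (H x y)" "ev x y \<cdot> (Ident T x \<star> g) = f \<cdot> Runit T x"
    using transpose_ex1[OF o(1,2) Unit_in_Obj fR] by blast
  \<comment> \<open>Rigidity moves the transpose \<open>g\<close> of \<open>f\<close> from
    \<open>H x y\<close> into \<open>?D \<boxtimes> y\<close>, where the hypothesis on
    \<open>?D\<close> applies.\<close>
  obtain \<theta>' where \<theta>': "\<theta>' \<in> Hom T (H x y) (?D \<boxtimes> y)" "?\<theta> \<cdot> \<theta>' = Ident T (H x y)"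
    using isoE[OF natural_dual_map_iso[OF o(1,2)] \<theta>] by metis
  define g' where "g' = \<theta>' \<cdot> g"
  have g': "g' \<in> Hom T (Unit T) (?D \<boxtimes> y)" "?\<theta> \<cdot> g' = g"
    unfolding g'_def using Comp_in_Hom[OF g(1) \<theta>'(1)] Comp_assoc[OF g(1) \<theta>'(1) \<theta>] \<theta>'(2)
      Comp_Ident_left[OF g(1)] by simp_all
  have xg': "Ident T x \<star> g' \<in> Hom T (x \<boxtimes> Unit T) (x \<boxtimes> (?D \<boxtimes> y))"
    using TensA_in_Hom[OF ix g'(1)] .
  have "f \<cdot> Runit T x = ev x y \<cdot> (Ident T x \<star> (?\<theta> \<cdot> g'))"
    using g g' by simp
  also have "\<dots> = ev x y \<cdot> ((Ident T x \<star> ?\<theta>) \<cdot> (Ident T x \<star> g'))"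
    using TensA_Comp[OF ix ix g'(1) \<theta>] Comp_Ident_left[OF ix] by simp
  also have "\<dots> = dual_ev x y \<cdot> (Ident T x \<star> g')"
    using Comp_assoc[OF xg' TensA_in_Hom[OF ix \<theta>] ev_in_Hom[OF o(1,2)]]
      ev_natural_dual_map[OF o(1,2)] by simp
  finally have fR': "f \<cdot> Runit T x = dual_ev x y \<cdot> (Ident T x \<star> g')" .
  have "Ident T x \<star> (Ident T ?D \<star> \<phi>) = Zero T (x \<boxtimes> (?D \<boxtimes> y)) (x \<boxtimes> (?D \<boxtimes> z))"
    using D TensA_Zero[OF ix oo(1,2)] unfolding annihilator_iff[OF \<phi>] by simp
  then have "\<phi> \<cdot> dual_ev x y = Zero T (x \<boxtimes> (?D \<boxtimes> y)) z"
    using dual_ev_natural[OF o(1) \<phi>] Comp_Zero_right[OF dz oo(4)] by simp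
  then have "(\<phi> \<cdot> f) \<cdot> Runit T x = Zero T x z \<cdot> Runit T x"
    using Comp_assoc[OF R f \<phi>] fR' Comp_assoc[OF xg' dy \<phi>] Comp_Zero_left[OF xg' o(3)]
      Comp_Zero_left[OF R o(3)] by simp
  then show ?thesis
    by (rule iso_epi[OF Runit_iso[OF o(1)], rotated 2])
      (use f \<phi> R o in \<open>simp_all add: Hom_def\<close>)
qed

text \<open>By the triangle identity, \<open>x\<^sup>\<or>\<close> is a retract of \<open>x\<^sup>\<or> \<otimes> (x \<otimes> x\<^sup>\<or>)\<close>.\<close>

lemma hom_in_ideal:
  assumes S: "thick_tensor_ideal T S" and x: "x \<in> S" and y: "y \<in> Obj T"
  shows "H x y \<in> S"
proof -
  note tS = triangulated_subcategoryD[OF ideal_triangulated[OF S]]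
  have xo: "x \<in> Obj T" using tS(1) x .
  let ?D = "H x (Unit T)"
  note D = hom_in_Obj[OF xo Unit_in_Obj] and ix = Ident_in_Hom[OF xo]
  have xD: "x \<boxtimes> ?D \<in> S" "x \<boxtimes> ?D \<in> Obj T"
    using ideal_tensor_right[OF S D x] tS(1) by blast+
  have HS: "H x (x \<boxtimes> ?D) \<in> S"
    using tS(3)[OF ideal_tensor[OF S D xD(1)] hom_isomorphic[OF xo xD(2)]] .
  have Ho: "H x (x \<boxtimes> ?D) \<in> Obj T" using tS(1) HS .
  note e = ev_in_Hom[OF xo Unit_in_Obj] and e' = ev_in_Hom[OF xo xD(2)]
  \<comment> \<open>The unit of the adjunction at \<open>?D\<close>.\<close>
  obtain i where i: "i \<in> Hom T ?D (H x (x \<boxtimes> ?D))"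
    "ev x (x \<boxtimes> ?D) \<cdot> (Ident T x \<star> i) = Ident T (x \<boxtimes> ?D)"
    using transpose_ex1[OF xo xD(2) D Ident_in_Hom[OF xD(2)]] by blast
  \<comment> \<open>The internal hom functor of \<open>x\<close> applied to the evaluation
    \<open>x \<otimes> ?D \<rightarrow> \<one>\<close>. The triangle identity
    \<open>p \<cdot> i = Ident T ?D\<close> is then read off from uniqueness of transposes.\<close>
  obtain p where p: "p \<in> Hom T (H x (x \<boxtimes> ?D)) ?D"
    "ev x (Unit T) \<cdot> (Ident T x \<star> p) = ev x (Unit T) \<cdot> ev x (x \<boxtimes> ?D)"
    using transpose_ex1[OF xo Unit_in_Obj Ho Comp_in_Hom[OF e' e]] by blast
  note xi = TensA_in_Hom[OF ix i(1)] and xp = TensA_in_Hom[OF ix p(1)]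
  have "ev x (Unit T) \<cdot> (Ident T x \<star> (p \<cdot> i)) = (ev x (Unit T) \<cdot> (Ident T x \<star> p)) \<cdot> (Ident T x \<star> i)"
    using TensA_Comp[OF ix ix i(1) p(1)] Comp_Ident_left[OF ix] Comp_assoc[OF xi xp e] by simp
  also have "\<dots> = ev x (Unit T)"
    using p(2) Comp_assoc[OF xi e' e] i(2) Comp_Ident_right[OF e] by simp
  finally have "p \<cdot> i \<in> Hom T ?D ?D \<and> ev x (Unit T) \<cdot> (Ident T x \<star> (p \<cdot> i)) = ev x (Unit T)"
    using Comp_in_Hom[OF i(1) p(1)] by blast
  moreover have "Ident T ?D \<in> Hom T ?D ?D \<and> ev x (Unit T) \<cdot> (Ident T x \<star> Ident T ?D) = ev x (Unit T)"
    using Ident_in_Hom[OF D] TensA_Ident[OF xo D] Comp_Ident_right[OF e] by simp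
  ultimately have "p \<cdot> i = Ident T ?D"
    using transpose_ex1[OF xo Unit_in_Obj D e] by blast
  then have "?D \<in> S"
    using thick_subcategory_retract[OF ideal_thick[OF S] HS i(1) p(1)] by blast
  then show ?thesis
    using tS(3)[OF ideal_tensor_right[OF S y] hom_isomorphic[OF xo y]] by blast
qed

section \<open>The fibre of the coevaluation and the complementary object\<close>

text \<open>Evaluation composed with \<open>g \<otimes> \<eta>\<close> is the right unitor, so
  \<open>g \<otimes> \<eta>\<close> is a split monomorphism. It kills
  \<open>g \<otimes> \<xi>\<close>, which must therefore be zero.\<close>

lemma generator_annihilates_fibre:
  assumes S: "thick_tensor_ideal T S" and g: "g \<in> S"
  obtains j c \<xi> u v where "dist_tri j (Unit T) c \<xi> u v" "c \<in> S" "g \<in> annihilator \<xi>"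
proof -
  have go: "g \<in> Obj T"
    using triangulated_subcategoryD(1)[OF ideal_triangulated[OF S] g] .
  have A: "H g g \<in> S" "H g g \<in> Obj T"
    using hom_in_ideal[OF S g go] hom_in_Obj[OF go go] by blast+
  note R = Runit_in_Hom[OF go] and ig = Ident_in_Hom[OF go]
  obtain \<eta> where \<eta>: "\<eta> \<in> Hom T (Unit T) (H g g)" "ev g g \<cdot> (Ident T g \<star> \<eta>) = Runit T g"
    using transpose_ex1[OF go go Unit_in_Obj R] by blast
  obtain j \<xi> v where t: "dist_tri j (Unit T) (H g g) \<xi> \<eta> v"
    using fibre_exists[OF \<eta>(1)] .
  note d = dist_triD[OF t]
  have gj: "g \<boxtimes> j \<in> Obj T" "g \<boxtimes> Unit T \<in> Obj T"
    using TensO_in_Obj go d by blast+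
  note g\<xi> = TensA_in_Hom[OF ig d(1)] and g\<eta> = TensA_in_Hom[OF ig \<eta>(1)]
  have "(Ident T g \<star> \<eta>) \<cdot> (Ident T g \<star> \<xi>) = Zero T (g \<boxtimes> j) (g \<boxtimes> H g g)"
    using TensA_Comp[OF ig ig d(1,2)] dist_tri_comp[OF t] TensA_Zero[OF ig d(5) A(2)]
      Comp_Ident_left[OF ig] by simp
  then have "Runit T g \<cdot> (Ident T g \<star> \<xi>) = Runit T g \<cdot> Zero T (g \<boxtimes> j) (g \<boxtimes> Unit T)"
    using \<eta>(2) Comp_assoc[OF g\<xi> g\<eta> ev_in_Hom[OF go go]]
      Comp_Zero_right[OF ev_in_Hom[OF go go] gj(1)] Comp_Zero_right[OF R gj(1)] by simp
  then have "Ident T g \<star> \<xi> = Zero T (g \<boxtimes> j) (g \<boxtimes> Unit T)"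
    by (rule iso_mono[OF Runit_iso[OF go], rotated 2])
      (use R gj g\<xi> in \<open>simp_all add: Hom_def\<close>)
  then show ?thesis
    using that[OF t A(1)] go unfolding annihilator_iff[OF d(1)] by blast
qed

text \<open>
  The witness is the cone of the idempotent \<open>a\<close>. With \<open>b = 1 - a\<close>, the relation \<open>b \<cdot> a = 0\<close> makes
  \<open>b\<close> factor through \<open>k\<close>, while \<open>a\<close> factors through an object of \<open>S\<close>.
\<close>

lemma complement_exists:
  assumes S: "thick_tensor_ideal T S" and g: "g \<in> S" and gen: "S \<subseteq> gen_level T g n"
  obtains k where "k \<in> Obj T" "zero_object T (g \<boxtimes> k)"
    and "\<And>P. \<lbrakk>thick_subcategory T P; S \<subseteq> P; k \<in> P\<rbrakk> \<Longrightarrow> Unit T \<in> P"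
proof -
  note tS = ideal_triangulated[OF S]
  have go: "g \<in> Obj T"
    using triangulated_subcategoryD(1)[OF tS g] .
  note i1 = Ident_in_Hom[OF Unit_in_Obj] and ig = Ident_in_Hom[OF go]
  obtain n' where n: "n = Suc n'"
    using gen g by (cases n) auto
  obtain j c0 \<xi> u0 v0 where \<xi>: "dist_tri j (Unit T) c0 \<xi> u0 v0" "c0 \<in> S" "g \<in> annihilator \<xi>"
    using generator_annihilates_fibre[OF S g] .
  obtain E e c u v where e: "dist_tri E (Unit T) c e u v" and c: "c \<in> S" and ann: "S \<subseteq> annihilator e"
    using annihilating_map_exists[OF S \<xi>, of n'] gen unfolding n by blast
  note de = dist_triD[OF e]
  \<comment> \<open>Now \<open>e \<cdot> m\<close> plays the role of \<open>e \<otimes> e\<close>,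
    and its cone \<open>c2\<close> is compared with the cone \<open>c\<close> of
    \<open>e\<close>.\<close>
  define m where "m = Runit T E \<cdot> (Ident T E \<star> e)"
  have m: "m \<in> Hom T (E \<boxtimes> E) E"
    unfolding m_def using cone_in_ideal_whisker(1)[OF S e c de(5)] .
  have em: "e \<cdot> m \<in> Hom T (E \<boxtimes> E) (Unit T)"
    using Comp_in_Hom[OF m de(1)] .
  obtain dm um vm where tm: "dist_tri (E \<boxtimes> E) E dm m um vm"
    using cone_exists[OF m] .
  obtain c2 u2 v2 where t2: "dist_tri (E \<boxtimes> E) (Unit T) c2 (e \<cdot> m) u2 v2"
    using cone_exists[OF em] .
  note d2 = dist_triD[OF t2]
  have "dm \<in> S"
    using cone_in_ideal_whisker(2)[OF S e c de(5)] tm unfolding m_def by blast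
  then have c2: "c2 \<in> S"
    using triangulated_subcategory_cone_Comp[OF tS tm e t2] c by blast
  then have D: "H c2 (Unit T) \<in> S"
    using hom_in_ideal[OF S _ Unit_in_Obj] by blast
  then have Do: "H c2 (Unit T) \<in> Obj T"
    using triangulated_subcategoryD(1)[OF tS] by blast
  obtain p where p: "p \<in> Hom T c2 c" "u \<cdot> Ident T (Unit T) = p \<cdot> u2" "v \<cdot> p = SuspA T m \<cdot> v2"
    by (rule dist_tri_morphism[OF t2 e m i1]) (use Comp_Ident_left[OF em] in simp)
  have "H c2 (Unit T) \<in> annihilator m"
    unfolding m_def
    using annihilator_Comp(1)[OF TensA_in_Hom[OF Ident_in_Hom[OF de(5)] de(1)] Runit_in_Hom[OF de(5)]]
      annihilator_whisker[OF de(1) _ de(5)] ann D by blast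
  then have "H c2 (Unit T) \<in> annihilator (SuspA T m)"
    using exact_functor_SuspA_Zero[OF tensor_exact_right[OF Do] m]
    unfolding annihilator_iff[OF m] annihilator_iff[OF SuspA_in_Hom[OF m]] by blast
  \<comment> \<open>The obstruction to lifting \<open>p\<close> along \<open>u\<close>: it ends with
    \<open>SuspA T m\<close>, which the dual of \<open>c2\<close> annihilates.\<close>
  then have "v \<cdot> p = Zero T c2 (SuspO T E)"
    using Comp_eq_Zero_if_dual_annihilated[OF d2(3) SuspA_in_Hom[OF m]] p(3) by simp
  then obtain r where r: "r \<in> Hom T c2 (Unit T)" "p = u \<cdot> r"
    using dist_tri_lift[OF rotate[OF e] p(1)] by blast
  define a where "a = r \<cdot> u2"
  have a: "a \<in> Hom T (Unit T) (Unit T)"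
    unfolding a_def using Comp_in_Hom[OF d2(2) r(1)] .
  obtain b where b: "b \<in> Hom T (Unit T) (Unit T)" "Ident T (Unit T) = Add T a b"
    using difference_exists[OF i1 a] by blast
  \<comment> \<open>Follows from \<open>u \<cdot> r = p\<close> and \<open>p \<cdot> u2 = u\<close>.
    Hence \<open>b = 1 - a\<close> is killed by \<open>u\<close>, factors through \<open>e\<close>,
    and inherits its annihilation of \<open>S\<close>.\<close>
  have "u \<cdot> a = u"
    unfolding a_def using Comp_assoc[OF d2(2) r(1) de(2)] r(2) p(2) Comp_Ident_right[OF de(2)] by simp
  then have "Add T u (u \<cdot> b) = u"
    using Comp_Add_right[OF a b(1) de(2)] b(2) Comp_Ident_right[OF de(2)] by simp
  then have "u \<cdot> b = Zero T (Unit T) c"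
    using Add_cancel[OF de(2) Comp_in_Hom[OF b(1) de(2)]] by blast
  then obtain t where t: "t \<in> Hom T (Unit T) E" "b = e \<cdot> t"
    using dist_tri_lift[OF e b(1)] by blast
  have annb: "S \<subseteq> annihilator b"
    unfolding t(2) using annihilator_Comp(2)[OF t(1) de(1)] ann by blast
  \<comment> \<open>The map \<open>r\<close> starts at \<open>c2\<close>, whose dual is in
    \<open>S\<close> and so annihilates \<open>b\<close>. With \<open>1 = a + b\<close> this yields
    \<open>b \<cdot> a = 0\<close>, the idempotence of \<open>a\<close>.\<close>
  have "b \<cdot> r = Zero T c2 (Unit T)"
    using Comp_eq_Zero_if_dual_annihilated[OF r(1) b(1)] D annb by blast
  then have ba: "b \<cdot> a = Zero T (Unit T) (Unit T)"
    unfolding a_def using Comp_assoc[OF d2(2) r(1) b(1)] Comp_Zero_left[OF d2(2) Unit_in_Obj] by simp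
  obtain k q l where k: "dist_tri (Unit T) (Unit T) k a q l"
    using cone_exists[OF a] .
  note dk = dist_triD[OF k]
  obtain w where w: "w \<in> Hom T k (Unit T)" "b = w \<cdot> q"
    using dist_tri_extend[OF k b(1) ba] .
  note ga = TensA_in_Hom[OF ig a]
  have "Ident T (g \<boxtimes> Unit T) = Add T (Ident T g \<star> a) (Ident T g \<star> b)"
    using TensA_Add(2)[OF a b(1) ig] b(2) TensA_Ident[OF go Unit_in_Obj] by simp
  also have "\<dots> = Ident T g \<star> a"
  proof -
    have "g \<in> annihilator b" using annb g by blast
    then show ?thesis
      using Add_Zero_right[OF ga ga] by (simp add: annihilator_iff[OF b(1)])
  qed
  finally have "is_iso T (Ident T g \<star> a)"
    using is_iso_Ident[OF TensO_in_Obj[OF go Unit_in_Obj]] by simp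
  then have "zero_object T (g \<boxtimes> k)"
    using exact_functor_dist_tri[OF tensor_exact_right[OF go] k] cone_iso_zero by blast
  moreover have "Unit T \<in> P" if "thick_subcategory T P" "S \<subseteq> P" "k \<in> P" for P
  proof (rule thick_subcategory_sum_of_factors[OF that(1) _ that(3) d2(2) r(1) dk(2) w(1)])
    show "c2 \<in> P" using c2 that(2) by blast
    show "Add T (r \<cdot> u2) (w \<cdot> q) = Ident T (Unit T)"
      using b(2) unfolding a_def w(2) by (rule sym)
  qed
  ultimately show ?thesis
    using that dk(7) by blast
qed

end


section \<open>Ideals with a strong generator\<close>

text \<open>The primes containing \<open>g\<close> and those containing \<open>k\<close> form two
  basic open sets, and the hypothesis \<open>compl\<close> says that they partition the
  spectrum.\<close>

lemma (in tensor_triangulated_category) connected_spectrum_cases: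
  assumes conn: "connected_space (Spc_topology T)" and "g \<in> Obj T" "k \<in> Obj T"
    and compl: "\<And>P. P \<in> Spc T \<Longrightarrow> g \<in> P \<longleftrightarrow> k \<notin> P"
  shows "(\<forall>P \<in> Spc T. g \<notin> P) \<or> (\<forall>P \<in> Spc T. k \<notin> P)"
proof -
  have op: "openin (Spc_topology T) (Spc T - supp T x)" if "x \<in> Obj T" for x
    unfolding openin_Spc_topology using that by (intro union_of_inc) (auto simp: arbitrary_def)
  have e: "Spc T - supp T x = {P \<in> Spc T. x \<in> P}" for x
    by (auto simp: supp_def)
  have "{P \<in> Spc T. g \<in> P} = {} \<or> {P \<in> Spc T. k \<in> P} = {}"
  proof (rule ccontr)
    assume "\<not> ?thesis"
    moreover have "Spc T \<subseteq> {P \<in> Spc T. g \<in> P} \<union> {P \<in> Spc T. k \<in> P}"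
      "{P \<in> Spc T. g \<in> P} \<inter> {P \<in> Spc T. k \<in> P} = {}"
      using compl by blast+
    ultimately show False
      using conn op[OF assms(2)] op[OF assms(3)]
      unfolding connected_space_def topspace_Spc_topology e by blast
  qed
  then show ?thesis by blast
qed

theorem theorem4p1:
  fixes T :: "('o, 'm) ttcat" and S :: "'o set"
  assumes "tensor_triangulated_category T"
    and "rigid T"
    and "connected_space (Spc_topology T)"
    and "thick_tensor_ideal T S"
    and "{z. zero_object T z} \<subset> S"
    and "S \<subset> Obj T"
  shows "\<not> strongly_generated (full_subcat T S)"
proof
  interpret tensor_triangulated_category T by fact
  obtain H ev where H: "internal_hom T H ev"
    "\<forall>x \<in> Obj T. \<forall>y \<in> Obj T. is_iso T (natural_dual_map T H ev x y)"
    using \<open>rigid T\<close> unfolding rigid_def by blast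
  interpret rigid_tensor_triangulated_category T H ev
    using H by unfold_locales blast+
  note S = \<open>thick_tensor_ideal T S\<close>
  assume "strongly_generated (full_subcat T S)"
  then obtain g n where g: "g \<in> S" "S \<subseteq> gen_level T g n"
    by (rule strongly_generated_full_subcatE[OF ideal_triangulated[OF S]])
  have go: "g \<in> Obj T" using g(1) \<open>S \<subset> Obj T\<close> by blast
  have gP: "S \<subseteq> P" if "thick_subcategory T P" "g \<in> P" for P
    using g(2) gen_level_subset_thick[OF that] by blast
  obtain k where k: "k \<in> Obj T" "zero_object T (g \<boxtimes>\<^bsub>T\<^esub> k)"
    and unit: "\<And>P. \<lbrakk>thick_subcategory T P; S \<subseteq> P; k \<in> P\<rbrakk> \<Longrightarrow> Unit T \<in> P"
    using complement_exists[OF S g] by blast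
  \<comment> \<open>A prime contains \<open>g \<otimes> k = 0\<close>, hence \<open>g\<close> or
    \<open>k\<close>. If it contained both, it would contain \<open>S\<close> and \<open>k\<close>,
    hence the unit.\<close>
  have "g \<in> P \<longleftrightarrow> k \<notin> P" if P: "P \<in> Spc T" for P
  proof -
    have I: "thick_tensor_ideal T P" "Unit T \<notin> P"
      and prime: "\<And>x y. \<lbrakk>x \<in> Obj T; y \<in> Obj T; x \<boxtimes>\<^bsub>T\<^esub> y \<in> P\<rbrakk> \<Longrightarrow> x \<in> P \<or> y \<in> P"
      using P ideal_eq_Obj unfolding Spc_def by blast+
    have "g \<boxtimes>\<^bsub>T\<^esub> k \<in> P"
      using triangulated_subcategoryD(2)[OF ideal_triangulated[OF I(1)] k(2)] .
    then show ?thesis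
      using prime[OF go k(1)] unit[OF ideal_thick[OF I(1)] gP[OF ideal_thick[OF I(1)]]] I(2) by blast
  qed
  from connected_spectrum_cases[OF assms(3) go k(1) this] show False
  proof
    assume "\<forall>P \<in> Spc T. g \<notin> P"
    moreover have "Unit T \<notin> S"
      using ideal_eq_Obj[OF S] \<open>S \<subset> Obj T\<close> by blast
    ultimately show False
      using prime_ideal_exists[OF S] g(1) by blast
  next
    assume none: "\<forall>P \<in> Spc T. k \<notin> P"
    \<comment> \<open>The objects killed by \<open>g\<close> form an ideal that contains
      \<open>k\<close>. Since no prime contains \<open>k\<close>, this ideal is not proper; so it
      contains the unit, and \<open>g\<close> is zero.\<close>
    let ?Z = "{z. zero_object T z}" and ?N = "{z \<in> Obj T. g \<boxtimes>\<^bsub>T\<^esub> z \<in> {z. zero_object T z}}"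
    have N: "thick_tensor_ideal T ?N" "k \<in> ?N"
      using ideal_quotient[OF zero_objects_ideal go] k by blast+
    have "Unit T \<in> ?N"
      using prime_ideal_exists[OF N(1)] N(2) none by blast
    then have "zero_object T g"
      using zero_object_isomorphic[OF TensO_unit(2)[OF go go]] by blast
    then have "S \<subseteq> ?Z"
      using gP[OF ideal_thick[OF zero_objects_ideal]] by blast
    then show False using \<open>?Z \<subset> S\<close> by blast
  qed
qed

end
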